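(* Let $G$ be a signed graph on $[n]$ and let $C_r^{(j)}(\Delta_G)=\tilde\rho_{r+1}^{(j)}C_r(\Delta_G)$. Then the chain complex of $\Delta_G$ decomposes as a direct sum of chain complexes \[ (C_{*}(\Delta_G), \partial_{*}) = \bigoplus_{j \geq 0} (C_{*}^{(j)}(\Delta_G), \partial_{*}) \, , \] and consequently $H_r(\Delta_G) = \bigoplus_{j \geq 0} H_{r}^{(j)}(\Delta_G)$, where $H_r^{(j)}(\Delta_G)$ is the homology of $(C_*^{(j)}(\Delta_G),\partial_* )$.
   Context: A signed graph $G$ on $[n]=\{1,\dots,n\}$ is a multiset $E(G)$ of one-element subsets $\{i\}$ of $[n]$ (half-edges) and two-element subsets $\{i,j\}$ (edges), with a sign map $\sigma$ from the edges to $\{1,-1\}$ such that the positive edges form the edge set of a simple graph and the negative edges form the edge set of a simple graph. Coloring complex: the signed graphic arrangement $\mathcal B_G$ in $\mathbb R^n$ consists of the hyperplanes $x_i=x_j$ for positive edges $\{i,j\}$, $x_i=-x_j$ for negative edges $\{i,j\}$, and $x_i=0$ for half-edges $\{i\}$. Call a nonempty $Q\subseteq[n]\cup-[n]$ admissible if it contains no pair $\{i,-i\}$; its vertex $v_Q\in\partial[-1,1]^n$ has $i$-th coordinate $1$ if $i\in Q$, $-1$ if $-i\in Q$, $0$ otherwise. The simplices $\mathrm{conv}(v_{Q_1},\dots,v_{Q_{r+1}})$ for chains $Q_1\subsetneq\cdots\subsetneq Q_{r+1}$ of admissible sets triangulate $\partial[-1,1]^n$; such an $r$-simplex is encoded as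 the ordered set partition $(P_1|\cdots|P_{r+2})$ of $[n]\cup-[n]$ with $P_1=Q_1$, $P_k=Q_k\setminus Q_{k-1}$ for $2\le k\le r+1$, $P_{r+2}=([n]\cup-[n])\setminus Q_{r+1}$. The coloring complex $\Delta_G$ is the subcomplex of simplices contained in the union of the hyperplanes of $\mathcal B_G$. For $r\ge0$, $C_r(\Delta_G)$ is the complex vector space with basis the $r$-simplices of $\Delta_G$; $C_{-1}(\Delta_G)$ is spanned by the one-block partition. For $1\le i\le r+1$, $d_i(P_1|\cdots|P_{r+2})=(P_1|\cdots|P_{i-1}|P_i\cup P_{i+1}|P_{i+2}|\cdots|P_{r+2})$, and $\partial_r=\sum_{i=1}^{r+1}(-1)^{i-1}d_i$. Hyperoctahedral group: $B_m$ is the group of permutations $\pi$ of $\{-m,\dots,m\}$ with $\pi(-i)=-\pi(i)$; $B_0$ is trivial. $\mathrm{sgn}(\pi)=(-1)^{\ell(\pi)}$ with $\ell$ the Coxeter length with respect to the generators $s_0$ (exchanging $1,-1$) and $s_i=(i,i+1)(-i,-i-1)$. $\mathrm{des}(\pi)=\#\{i\in\{0,\dots,m-1\}:\pi(i)>\pi(i+1)\}$ (with $\pi(0)=0$). $B_{r+1}$ acts linearly on $C_r(\Delta_G)$ by $\pi(P_1|\cdots|P_{r+2})=(P_{\pi^{-1}(1)}|\cdots|P_{\pi^{-1}(r+1)}|P')$, where $P_{-i}:=-P_i$ and $P'$ is the complement of the union of the first $r+1$ blocks. Type B Eulerian idempotents: $\tilde\rho_m^{(j)}\in\mathbb C[B_m]$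 are defined by $\sum_{j=0}^m x^j\tilde\rho_m^{(j)}=\sum_{\pi\in B_m}\Big[\frac{\prod_{k=1}^m(x-2\mathrm{des}(\pi)+2k-1)}{2^m m!}\Big]\mathrm{sgn}(\pi)\pi$. *)

theory Defs
  imports
    Complex_Main
    "HOL-Library.Multiset"
    "HOL-Library.Poly_Mapping"
    "HOL-Library.Set_Algebras"
    "HOL-Combinatorics.Permutations"
    "HOL-Computational_Algebra.Polynomial"
begin

section \<open>Signed graphs\<close>

definition verts :: "nat \<Rightarrow> int set" where
  "verts n = {1..int n}"

text \<open>The multiset of all edges is the disjoint union of the three components.  A two-element set
  may occur both as a positive and as a negative edge, but at most once with each sign; half-edges
  may be repeated.\<close>

record signed_graph =
  half_edges :: "int set multiset"
  pos_edges :: "int set set"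
  neg_edges :: "int set set"

definition signed_graph_on :: "nat \<Rightarrow> signed_graph \<Rightarrow> bool" where
  "signed_graph_on n G \<longleftrightarrow>
     (\<forall>e. e \<in># half_edges G \<longrightarrow> e \<subseteq> verts n \<and> card e = 1) \<and>
     (\<forall>e\<in>pos_edges G. e \<subseteq> verts n \<and> card e = 2) \<and>
     (\<forall>e\<in>neg_edges G. e \<subseteq> verts n \<and> card e = 2)"


section \<open>The signed graphic arrangement and the coloring complex\<close>

text \<open>A point of $n$-space is a function on the integers that vanishes off \<^term>\<open>verts n\<close>.\<close>

definition euclid :: "nat \<Rightarrow> (int \<Rightarrow> real) set" where
  "euclid n = {x. \<forall>i. i \<notin> verts n \<longrightarrow> x i = 0}"

definition arrangement :: "nat \<Rightarrow> signed_graph \<Rightarrow> (int \<Rightarrow> real) set set" where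
  "arrangement n G =
     {{x \<in> euclid n. x i = x j} | i j. {i, j} \<in> pos_edges G} \<union>
     {{x \<in> euclid n. x i = - x j} | i j. {i, j} \<in> neg_edges G} \<union>
     {{x \<in> euclid n. x i = 0} | i. {i} \<in># half_edges G}"

definition signed_verts :: "nat \<Rightarrow> int set" where
  "signed_verts n = verts n \<union> uminus ` verts n"

definition admissible :: "nat \<Rightarrow> int set \<Rightarrow> bool" where
  "admissible n Q \<longleftrightarrow> Q \<noteq> {} \<and> Q \<subseteq> signed_verts n \<and> \<not> (\<exists>i. i \<in> Q \<and> - i \<in> Q)"

definition cube_vertex :: "nat \<Rightarrow> int set \<Rightarrow> int \<Rightarrow> real" where
  "cube_vertex n Q i =
     (if i \<in> verts n then (if i \<in> Q then 1 else if - i \<in> Q then - 1 else 0) else 0)"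

definition conv_list :: "(int \<Rightarrow> real) list \<Rightarrow> (int \<Rightarrow> real) set" where
  "conv_list vs =
     {(\<lambda>i. \<Sum>k<length vs. t k * (vs ! k) i) | t :: nat \<Rightarrow> real.
        (\<forall>k<length vs. 0 \<le> t k) \<and> (\<Sum>k<length vs. t k) = 1}"

definition encode_chain :: "nat \<Rightarrow> int set list \<Rightarrow> int set list" where
  "encode_chain n Qs =
     hd Qs # map (\<lambda>k. Qs ! k - Qs ! (k - 1)) [1..<length Qs] @ [signed_verts n - last Qs]"

text \<open>The simplices of dimension \<open>r\<close> as ordered set partitions with \<open>r + 2\<close> blocks; in dimension
  \<open>- 1\<close> there is always the one-block partition, and there is nothing in lower dimensions.\<close>

definition simplices :: "nat \<Rightarrow> signed_graph \<Rightarrow> int \<Rightarrow> int set list set" where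
  "simplices n G r =
     (if r \<ge> 0 then
        {encode_chain n Qs | Qs.
           int (length Qs) = r + 1 \<and> (\<forall>Q\<in>set Qs. admissible n Q) \<and> sorted_wrt (\<subset>) Qs \<and>
           conv_list (map (cube_vertex n) Qs) \<subseteq> \<Union> (arrangement n G)}
      else if r = - 1 then {[signed_verts n]}
      else {})"


section \<open>Chains\<close>

type_synonym chain = "int set list \<Rightarrow>\<^sub>0 complex"

definition cscale :: "complex \<Rightarrow> ('a \<Rightarrow>\<^sub>0 complex) \<Rightarrow> ('a \<Rightarrow>\<^sub>0 complex)" where
  "cscale a c = Poly_Mapping.map ((*) a) c"

lemma lookup_cscale: "Poly_Mapping.lookup (cscale a c) x = a * Poly_Mapping.lookup c x"
  by (simp add: cscale_def Poly_Mapping.map.rep_eq when_def)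

global_interpretation chains: vector_space cscale
  by unfold_locales
     (auto intro!: poly_mapping_eqI simp: lookup_cscale lookup_add algebra_simps)

definition lin_ext :: "('a \<Rightarrow> 'b \<Rightarrow>\<^sub>0 complex) \<Rightarrow> ('a \<Rightarrow>\<^sub>0 complex) \<Rightarrow> ('b \<Rightarrow>\<^sub>0 complex)" where
  "lin_ext f c = (\<Sum>x\<in>Poly_Mapping.keys c. cscale (Poly_Mapping.lookup c x) (f x))"

definition chain_space :: "nat \<Rightarrow> signed_graph \<Rightarrow> int \<Rightarrow> chain set" where
  "chain_space n G r = {c. Poly_Mapping.keys c \<subseteq> simplices n G r}"

text \<open>Blocks are numbered from 1.\<close>

definition merge_blocks :: "nat \<Rightarrow> int set list \<Rightarrow> int set list" where
  "merge_blocks i P = take (i - 1) P @ [P ! (i - 1) \<union> P ! i] @ drop (i + 1) P"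

definition boundary_map :: "int \<Rightarrow> chain \<Rightarrow> chain" where
  "boundary_map r =
     lin_ext (\<lambda>P. \<Sum>i = 1..nat (r + 1). Poly_Mapping.single (merge_blocks i P) ((- 1) ^ (i - 1)))"


section \<open>The hyperoctahedral group and the type B Eulerian idempotents\<close>

definition hyperoct :: "nat \<Rightarrow> (int \<Rightarrow> int) set" where
  "hyperoct m = {\<pi>. \<pi> permutes {- int m..int m} \<and> (\<forall>i. \<pi> (- i) = - \<pi> i)}"

definition coxeter_gen :: "nat \<Rightarrow> int \<Rightarrow> int" where
  "coxeter_gen i =
     (if i = 0 then transpose 1 (- 1)
      else transpose (int i) (int i + 1) \<circ> transpose (- int i) (- int i - 1))"

definition coxeter_length :: "nat \<Rightarrow> (int \<Rightarrow> int) \<Rightarrow> nat" where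
  "coxeter_length m \<pi> =
     (LEAST l. \<exists>w. length w = l \<and> set w \<subseteq> {..<m} \<and> \<pi> = foldr (\<circ>) (map coxeter_gen w) id)"

definition hyperoct_sgn :: "nat \<Rightarrow> (int \<Rightarrow> int) \<Rightarrow> complex" where
  "hyperoct_sgn m \<pi> = (- 1) ^ coxeter_length m \<pi>"

definition descents :: "nat \<Rightarrow> (int \<Rightarrow> int) \<Rightarrow> nat" where
  "descents m \<pi> = card {i \<in> {0..int m - 1}. \<pi> i > \<pi> (i + 1)}"

definition eulerian_poly :: "nat \<Rightarrow> (int \<Rightarrow> int) \<Rightarrow> complex poly" where
  "eulerian_poly m \<pi> =
     smult (1 / (2 ^ m * fact m))
       (\<Prod>k = 1..m. [:- 2 * of_nat (descents m \<pi>) + 2 * of_nat k - 1, 1:])"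

text \<open>The group algebra is the space of formal linear combinations of elements of
  \<^term>\<open>hyperoct m\<close>.\<close>

definition eulerian_idem :: "nat \<Rightarrow> nat \<Rightarrow> (int \<Rightarrow> int) \<Rightarrow>\<^sub>0 complex" where
  "eulerian_idem m j =
     (\<Sum>\<pi>\<in>hyperoct m. Poly_Mapping.single \<pi> (coeff (eulerian_poly m \<pi>) j * hyperoct_sgn m \<pi>))"

lemma degree_eulerian_poly: "degree (eulerian_poly m \<pi>) \<le> m"
proof -
  have "degree (\<Prod>k = 1..m. [:- 2 * of_nat (descents m \<pi>) + 2 * of_nat k - 1, 1 :: complex:])
        \<le> sum (degree \<circ> (\<lambda>k. [:- 2 * of_nat (descents m \<pi>) + 2 * of_nat k - 1, 1 :: complex:])) {1..m}"
    by (rule degree_prod_sum_le) simp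
  then show ?thesis
    unfolding eulerian_poly_def by (simp add: o_def)
qed

lemma eulerian_idem_generating_function:
  "(\<Sum>j = 0..m. cscale (x ^ j) (eulerian_idem m j)) =
   (\<Sum>\<pi>\<in>hyperoct m. Poly_Mapping.single \<pi>
      ((\<Prod>k = 1..m. x - 2 * of_nat (descents m \<pi>) + 2 * of_nat k - 1) / (2 ^ m * fact m)
        * hyperoct_sgn m \<pi>))"
proof -
  have cs: "cscale a (Poly_Mapping.single \<pi> b) = Poly_Mapping.single \<pi> (a * b)"
    for a b and \<pi> :: "int \<Rightarrow> int"
    by (rule poly_mapping_eqI) (simp add: lookup_cscale lookup_single when_def)
  have ss: "(\<Sum>j\<in>A. Poly_Mapping.single \<pi> (f j)) = Poly_Mapping.single \<pi> (\<Sum>j\<in>A. f j)"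
    for A :: "nat set" and f :: "nat \<Rightarrow> complex" and \<pi> :: "int \<Rightarrow> int"
    by (induction A rule: infinite_finite_induct) (auto simp: single_add)
  have ev: "(\<Sum>j = 0..m. x ^ j * (coeff (eulerian_poly m \<pi>) j * s)) =
      (\<Prod>k = 1..m. x - 2 * of_nat (descents m \<pi>) + 2 * of_nat k - 1) / (2 ^ m * fact m) * s"
    for \<pi> s
  proof -
    have "(\<Sum>j = 0..m. x ^ j * (coeff (eulerian_poly m \<pi>) j * s)) =
          (\<Sum>j\<le>m. coeff (eulerian_poly m \<pi>) j * x ^ j) * s"
      by (simp add: sum_distrib_left atMost_atLeast0 mult_ac)
    also have "(\<Sum>j\<le>m. coeff (eulerian_poly m \<pi>) j * x ^ j) = poly (eulerian_poly m \<pi>) x"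
      unfolding poly_altdef using degree_eulerian_poly[of m \<pi>]
      by (intro sum.mono_neutral_right) (auto simp: coeff_eq_0)
    also have "\<dots> = (\<Prod>k = 1..m. x - 2 * of_nat (descents m \<pi>) + 2 * of_nat k - 1) / (2 ^ m * fact m)"
      by (simp add: eulerian_poly_def poly_prod algebra_simps)
    finally show ?thesis .
  qed
  show ?thesis
    unfolding eulerian_idem_def
    by (simp add: chains.scale_sum_right cs sum.swap[of _ "hyperoct m"] ss ev)
qed

definition signed_block :: "int set list \<Rightarrow> int \<Rightarrow> int set" where
  "signed_block P i = (if i > 0 then P ! (nat i - 1) else uminus ` (P ! (nat (- i) - 1)))"

definition act_simplex :: "nat \<Rightarrow> nat \<Rightarrow> (int \<Rightarrow> int) \<Rightarrow> int set list \<Rightarrow> int set list" where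
  "act_simplex n m \<pi> P =
     (let Bs = map (\<lambda>k. signed_block P (inv \<pi> k)) [1..int m]
      in Bs @ [signed_verts n - \<Union> (set Bs)])"

definition act_chain :: "nat \<Rightarrow> nat \<Rightarrow> ((int \<Rightarrow> int) \<Rightarrow>\<^sub>0 complex) \<Rightarrow> chain \<Rightarrow> chain" where
  "act_chain n m a c =
     lin_ext (\<lambda>\<pi>. lin_ext (\<lambda>P. Poly_Mapping.single (act_simplex n m \<pi> P) 1) c) a"

definition eulerian_space :: "nat \<Rightarrow> signed_graph \<Rightarrow> nat \<Rightarrow> int \<Rightarrow> chain set" where
  "eulerian_space n G j r =
     act_chain n (nat (r + 1)) (eulerian_idem (nat (r + 1)) j) ` chain_space n G r"


section \<open>Direct sums of chain complexes and of homology\<close>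

definition chain_complex :: "(int \<Rightarrow> chain set) \<Rightarrow> (int \<Rightarrow> chain \<Rightarrow> chain) \<Rightarrow> bool" where
  "chain_complex C d \<longleftrightarrow>
     (\<forall>r. chains.subspace (C r) \<and> Vector_Spaces.linear cscale cscale (d r) \<and>
          d r ` C r \<subseteq> C (r - 1) \<and> (\<forall>c\<in>C r. d (r - 1) (d r c) = 0))"

definition internal_direct_sum :: "chain set \<Rightarrow> (nat \<Rightarrow> chain set) \<Rightarrow> bool" where
  "internal_direct_sum V W \<longleftrightarrow>
     chains.subspace V \<and> (\<forall>j. chains.subspace (W j) \<and> W j \<subseteq> V) \<and>
     (\<forall>v\<in>V. \<exists>!w. (\<forall>j. w j \<in> W j) \<and> finite {j. w j \<noteq> 0} \<and> v = (\<Sum>j | w j \<noteq> 0. w j))"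

definition complex_direct_sum ::
    "(int \<Rightarrow> chain set) \<Rightarrow> (nat \<Rightarrow> int \<Rightarrow> chain set) \<Rightarrow> (int \<Rightarrow> chain \<Rightarrow> chain) \<Rightarrow> bool" where
  "complex_direct_sum C D d \<longleftrightarrow>
     chain_complex C d \<and> (\<forall>j. chain_complex (D j) d) \<and>
     (\<forall>r. internal_direct_sum (C r) (\<lambda>j. D j r))"

definition cycles :: "(int \<Rightarrow> chain set) \<Rightarrow> (int \<Rightarrow> chain \<Rightarrow> chain) \<Rightarrow> int \<Rightarrow> chain set" where
  "cycles C d r = {c \<in> C r. d r c = 0}"

definition boundaries :: "(int \<Rightarrow> chain set) \<Rightarrow> (int \<Rightarrow> chain \<Rightarrow> chain) \<Rightarrow> int \<Rightarrow> chain set" where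
  "boundaries C d r = d (r + 1) ` C (r + 1)"

text \<open>The quotient of cycles by boundaries, as a set of cosets.  Cosets are added as sets, and the
  zero coset is \<^term>\<open>boundaries C d r\<close>.  In \<open>coset_scale B\<close>, the summand \<open>B\<close> makes
  the product with the scalar 0 a coset of \<open>B\<close> again.\<close>

definition homology :: "(int \<Rightarrow> chain set) \<Rightarrow> (int \<Rightarrow> chain \<Rightarrow> chain) \<Rightarrow> int \<Rightarrow> chain set set" where
  "homology C d r = (\<lambda>z. z +o boundaries C d r) ` cycles C d r"

definition coset_scale :: "chain set \<Rightarrow> complex \<Rightarrow> chain set \<Rightarrow> chain set" where
  "coset_scale B a X = cscale a ` X + B"

text \<open>The external direct sum of the homology spaces of the complexes \<open>D j\<close>, and the
  map to the homology of \<open>C\<close> induced by the inclusions of the \<open>D j\<close>: the image of a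
  coset \<open>X\<close> under such an inclusion is \<open>X + boundaries C d r\<close>.\<close>

definition homology_sum_carrier ::
    "(nat \<Rightarrow> int \<Rightarrow> chain set) \<Rightarrow> (int \<Rightarrow> chain \<Rightarrow> chain) \<Rightarrow> int \<Rightarrow> (nat \<Rightarrow> chain set) set" where
  "homology_sum_carrier D d r =
     {h. (\<forall>j. h j \<in> homology (D j) d r) \<and> finite {j. h j \<noteq> boundaries (D j) d r}}"

definition homology_sum_map ::
    "(int \<Rightarrow> chain set) \<Rightarrow> (nat \<Rightarrow> int \<Rightarrow> chain set) \<Rightarrow> (int \<Rightarrow> chain \<Rightarrow> chain) \<Rightarrow> int \<Rightarrow>
     (nat \<Rightarrow> chain set) \<Rightarrow> chain set" where
  "homology_sum_map C D d r h =
     (\<Sum>j | h j \<noteq> boundaries (D j) d r. h j) + boundaries C d r"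

definition homology_direct_sum ::
    "(int \<Rightarrow> chain set) \<Rightarrow> (nat \<Rightarrow> int \<Rightarrow> chain set) \<Rightarrow> (int \<Rightarrow> chain \<Rightarrow> chain) \<Rightarrow> int \<Rightarrow> bool" where
  "homology_direct_sum C D d r \<longleftrightarrow>
     bij_betw (homology_sum_map C D d r) (homology_sum_carrier D d r) (homology C d r) \<and>
     (\<forall>g\<in>homology_sum_carrier D d r. \<forall>h\<in>homology_sum_carrier D d r.
        homology_sum_map C D d r (\<lambda>j. g j + h j) =
        homology_sum_map C D d r g + homology_sum_map C D d r h) \<and>
     (\<forall>a. \<forall>h\<in>homology_sum_carrier D d r.
        homology_sum_map C D d r (\<lambda>j. coset_scale (boundaries (D j) d r) a (h j)) =
        coset_scale (boundaries C d r) a (homology_sum_map C D d r h))"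

end

theory Submission
  imports Defs
begin

text \<open>
  At an odd argument \<open>2 k + 1\<close> the coefficient of a signed permutation \<open>\<pi>\<close> in the generating
  function of the Eulerian idempotents is, up to sign, a binomial coefficient, and it counts the odd
  maps \<open>g\<close> from \<open>{-m..m}\<close> to \<open>{-k..k}\<close> that are sorted by \<open>\<pi>\<close>, that is, for which \<open>\<pi>\<close>
  enumerates \<open>{-m..m}\<close> in the lexicographic order of the pairs \<open>(g v, v)\<close>.  Hence the generating
  function at \<open>2 k + 1\<close> is the Adams operation \<open>\<psi>\<^sub>k\<close>, the signed sum of the sorting permutations of
  all odd maps.  Combining two odd maps lexicographically gives
  \<open>\<psi>\<^sub>k \<psi>\<^sub>l = \<psi>\<^sub>K\<close> with \<open>2 K + 1 = (2 k + 1) (2 l + 1)\<close>, and comparing coefficients of polynomials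
  makes the Eulerian elements orthogonal idempotents with sum 1.

  The Adams operations commute with the boundary: the terms in which positions \<open>p\<close> and \<open>p + 1\<close>
  are merged cancel in pairs unless \<open>g\<close> agrees on them, the terms in which the last block is dropped
  cancel in pairs unless \<open>g\<close> is maximal at the last position, and the remaining terms are those of
  the Adams operation applied to the boundary.  Comparing coefficients once more, every Eulerian
  idempotent is a chain map.
\<close>

section \<open>The hyperoctahedral group and its sign character\<close>

text \<open>Odd arguments are the natural ones: the interval \<open>{-k..k}\<close> is stable under
  negation and has \<open>2 * k + 1\<close> elements, and at \<open>x = 2 * k + 1\<close> every
  factor \<open>x - 2 * des + 2 * i - 1\<close> is even, so the powers of 2 cancel. Breaking ties by
  \<open>v\<close> turns each descent of \<pi> into a forced strict increase of the values, which is
  how the descent number enters the count. The obstacle in the boundary formula is that the groups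
  differ: rank \<open>m + 1\<close> acts on the source, rank \<open>m\<close> on the target, and a
  single permutation does not in general commute with the boundary. The signed sum does, because odd
  maps, unlike permutations, can be pulled back along the merging of two positions. This requires a
  model of the geometric simplices in which faces and permutations both act by composition. It also
  requires the sign, which is defined through a minimal word length, to be recognised as a group
  character that does not change when the rank is raised.\<close>

lemma hyperoct_permutes: "\<pi> \<in> hyperoct m \<Longrightarrow> \<pi> permutes {- int m..int m}"
  by (simp add: hyperoct_def)

lemma hyperoct_odd: "\<pi> \<in> hyperoct m \<Longrightarrow> \<pi> (- v) = - \<pi> v"
  by (simp add: hyperoct_def)

lemma hyperoct_zero: "\<pi> \<in> hyperoct m \<Longrightarrow> \<pi> 0 = 0"
  using hyperoct_odd[of \<pi> m 0] by simp

lemma hyperoct_bij: "\<pi> \<in> hyperoct m \<Longrightarrow> bij \<pi>"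
  using hyperoct_permutes permutes_bij by blast

lemma hyperoct_inj: "\<pi> \<in> hyperoct m \<Longrightarrow> \<pi> v = \<pi> w \<longleftrightarrow> v = w"
  using hyperoct_bij bij_is_inj inj_eq by metis

lemma hyperoct_inv_simps:
  assumes "\<pi> \<in> hyperoct m"
  shows "inv \<pi> (\<pi> v) = v" "\<pi> (inv \<pi> v) = v" "inv \<pi> \<circ> \<pi> = id" "\<pi> \<circ> inv \<pi> = id"
  using permutes_inverses[OF hyperoct_permutes[OF assms]] by auto

lemma hyperoct_outside: "\<pi> \<in> hyperoct m \<Longrightarrow> \<bar>v\<bar> > int m \<Longrightarrow> \<pi> v = v"
  using permutes_not_in[OF hyperoct_permutes, of \<pi> m v] by (auto simp: abs_if split: if_splits)

lemma hyperoct_abs_le: "\<pi> \<in> hyperoct m \<Longrightarrow> \<bar>\<pi> v\<bar> \<le> int m \<longleftrightarrow> \<bar>v\<bar> \<le> int m"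
  using permutes_in_image[OF hyperoct_permutes, of \<pi> m v] by (auto simp: abs_le_iff)

lemma hyperoct_eq_zero: "\<pi> \<in> hyperoct m \<Longrightarrow> \<pi> v = 0 \<longleftrightarrow> v = 0"
  using hyperoct_zero hyperoct_inj by metis

lemma hyperoct_abs: "\<pi> \<in> hyperoct m \<Longrightarrow> \<bar>\<pi> \<bar>v\<bar>\<bar> = \<bar>\<pi> v\<bar>"
  by (cases "v \<ge> 0") (auto simp: hyperoct_odd)

lemma hyperoct_id: "id \<in> hyperoct m"
  by (simp add: hyperoct_def permutes_id)

lemma hyperoct_comp: "\<pi> \<in> hyperoct m \<Longrightarrow> \<sigma> \<in> hyperoct m \<Longrightarrow> \<pi> \<circ> \<sigma> \<in> hyperoct m"
  by (simp add: hyperoct_def permutes_compose)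

lemma hyperoct_inv: "\<pi> \<in> hyperoct m \<Longrightarrow> inv \<pi> \<in> hyperoct m"
  by (smt (verit) hyperoct_def mem_Collect_eq permutes_inv permutes_inverses)

lemma finite_hyperoct: "finite (hyperoct m)"
  by (rule finite_subset[OF _ finite_permutations[of "{- int m..int m}"]])
     (auto simp: hyperoct_def)

text \<open>Signed permutations are functions on all integers that fix everything outside their
  range, so the standard embedding of a smaller group into a larger one is literal
  inclusion.\<close>

lemma hyperoct_mono: "m \<le> m' \<Longrightarrow> hyperoct m \<subseteq> hyperoct m'"
  by (auto simp: hyperoct_def elim!: permutes_subset)

lemma hyperoct_0: "hyperoct 0 = {id}"
  by (auto simp: hyperoct_def)

lemma hyperoctI:
  assumes "\<And>v. f (f' v) = v" "\<And>v. f' (f v) = v" "\<And>v. f (- v) = - f v"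
    "\<And>v. \<bar>v\<bar> > int m \<Longrightarrow> f v = v"
  shows "f \<in> hyperoct m"
proof -
  have "f permutes {- int m..int m}"
    unfolding permutes_def
  proof (intro conjI allI impI)
    show "f v = v" if "v \<notin> {- int m..int m}" for v
      using that by (intro assms(4)) (auto simp: abs_if)
    show "\<exists>!v. f v = w" for w
      using assms(1,2) by metis
  qed
  with assms(3) show ?thesis
    by (simp add: hyperoct_def)
qed

lemma hyperoct_fix_last:
  assumes "\<pi> \<in> hyperoct (Suc m)" "\<pi> (int (Suc m)) = int (Suc m)"
  shows "\<pi> \<in> hyperoct m"
proof -
  have "\<pi> permutes {- int m..int m}"
  proof (rule permutes_superset[OF hyperoct_permutes[OF assms(1)]])
    fix v assume "v \<in> {- int (Suc m)..int (Suc m)} - {- int m..int m}"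
    hence "v = int (Suc m) \<or> v = - int (Suc m)"
      by auto
    thus "\<pi> v = v"
      using assms by (metis hyperoct_odd)
  qed
  with assms(1) show ?thesis
    by (simp add: hyperoct_def)
qed

section \<open>Words in the Coxeter generators\<close>

lemma coxeter_gen_0: "coxeter_gen 0 v = (if \<bar>v\<bar> = 1 then - v else v)"
  by (auto simp: coxeter_gen_def transpose_def abs_if)

lemma coxeter_gen_pos:
  "i \<ge> 1 \<Longrightarrow> coxeter_gen i v =
    (if \<bar>v\<bar> = int i then v + sgn v else if \<bar>v\<bar> = int i + 1 then v - sgn v else v)"
  by (auto simp: coxeter_gen_def transpose_def abs_if sgn_if)

lemma coxeter_gen_invol: "coxeter_gen i (coxeter_gen i v) = v"
proof (cases "i = 0")
  case True
  then show ?thesis by (auto simp: coxeter_gen_0)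
next
  case False
  then show ?thesis by (auto simp: coxeter_gen_pos abs_if sgn_if)
qed

lemma coxeter_gen_hyperoct:
  assumes "i < m" shows "coxeter_gen i \<in> hyperoct m"
proof (rule hyperoctI[of _ "coxeter_gen i"])
  show "coxeter_gen i (- v) = - coxeter_gen i v" for v
    by (cases "i = 0") (auto simp: coxeter_gen_0 coxeter_gen_pos)
  show "coxeter_gen i v = v" if "\<bar>v\<bar> > int m" for v
    using that assms by (cases "i = 0") (auto simp: coxeter_gen_0 coxeter_gen_pos)
qed (simp_all add: coxeter_gen_invol)

definition neg_at :: "nat \<Rightarrow> int \<Rightarrow> int" where
  "neg_at j v = (if \<bar>v\<bar> = int j then - v else v)"

text \<open>The product of the generators with indices \<open>p, p + 1, ..., m - 1\<close>. It
  serves as a coset representative in the proof of generation, and later to insert a new element at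
  place \<open>p\<close>.\<close>

definition cyc :: "nat \<Rightarrow> nat \<Rightarrow> int \<Rightarrow> int" where
  "cyc p m v = (if \<bar>v\<bar> = int m then sgn v * int p
     else if int p \<le> \<bar>v\<bar> \<and> \<bar>v\<bar> < int m then v + sgn v else v)"

lemma neg_at_hyperoct: "j \<le> m \<Longrightarrow> neg_at j \<in> hyperoct m"
  by (rule hyperoctI[of _ "neg_at j"]) (auto simp: neg_at_def)

lemma cyc_hyperoct:
  assumes "1 \<le> p" "p \<le> m" shows "cyc p m \<in> hyperoct m"
  by (rule hyperoctI[of _ "\<lambda>v. if \<bar>v\<bar> = int p then sgn v * int m
        else if int p < \<bar>v\<bar> \<and> \<bar>v\<bar> \<le> int m then v - sgn v else v"])
     (use assms in \<open>auto simp: cyc_def abs_if sgn_if\<close>)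

lemma cyc_last: "1 \<le> m \<Longrightarrow> cyc m m = id"
  by (auto simp: cyc_def fun_eq_iff abs_if sgn_if)

lemma cyc_step: "1 \<le> p \<Longrightarrow> p < m \<Longrightarrow> cyc p m = coxeter_gen p \<circ> cyc (Suc p) m"
  by (auto simp: cyc_def coxeter_gen_pos fun_eq_iff abs_if sgn_if)

lemma neg_at_1: "neg_at 1 = coxeter_gen 0"
  by (auto simp: neg_at_def coxeter_gen_0 fun_eq_iff)

text \<open>Conjugation by the generator that exchanges \<open>j\<close> and \<open>j + 1\<close>
  moves a sign change from \<open>j\<close> to \<open>j + 1\<close>, so every single sign change is
  a word of odd length.\<close>

lemma neg_at_Suc: "1 \<le> j \<Longrightarrow> neg_at (Suc j) = coxeter_gen j \<circ> neg_at j \<circ> coxeter_gen j"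
proof (intro ext)
  fix v assume "1 \<le> j"
  consider "\<bar>v\<bar> = int j" | "\<bar>v\<bar> = int j + 1" | "\<bar>v\<bar> \<noteq> int j" "\<bar>v\<bar> \<noteq> int j + 1"
    by blast
  thus "neg_at (Suc j) v = (coxeter_gen j \<circ> neg_at j \<circ> coxeter_gen j) v"
    using \<open>1 \<le> j\<close>
    by cases (auto simp: neg_at_def coxeter_gen_pos abs_if sgn_if split: if_splits)
qed

definition gen_words :: "nat \<Rightarrow> (int \<Rightarrow> int) set" where
  "gen_words m = {foldr (\<circ>) (map coxeter_gen w) id | w. set w \<subseteq> {..<m}}"

lemma gen_words_id: "id \<in> gen_words m"
  unfolding gen_words_def by (force intro: exI[of _ "[]"])

lemma foldr_comp_append: "foldr (\<circ>) (fs @ gs) id = foldr (\<circ>) fs id \<circ> foldr (\<circ>) gs id"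
  by (induction fs) auto

lemma gen_words_comp:
  assumes "f \<in> gen_words m" "g \<in> gen_words m" shows "f \<circ> g \<in> gen_words m"
proof -
  from assms obtain w w' where
    "f = foldr (\<circ>) (map coxeter_gen w) id" "set w \<subseteq> {..<m}"
    "g = foldr (\<circ>) (map coxeter_gen w') id" "set w' \<subseteq> {..<m}"
    by (auto simp: gen_words_def)
  then show ?thesis
    unfolding gen_words_def
    by (intro CollectI exI[of _ "w @ w'"]) (simp only: map_append foldr_comp_append set_append, auto)
qed

lemma gen_words_gen: "i < m \<Longrightarrow> coxeter_gen i \<in> gen_words m"
  unfolding gen_words_def by (intro CollectI exI[of _ "[i]"]) auto

lemma gen_words_mono: "m \<le> m' \<Longrightarrow> gen_words m \<subseteq> gen_words m'"
  unfolding gen_words_def by fastforce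

lemma cyc_gen_words:
  assumes "1 \<le> p" "p \<le> m" shows "cyc p m \<in> gen_words m"
  using assms(2,1)
proof (induction p rule: inc_induct)
  case base
  then show ?case using cyc_last gen_words_id by metis
next
  case (step p)
  then show ?case
    by (subst cyc_step) (auto intro!: gen_words_comp gen_words_gen)
qed

lemma neg_at_gen_words:
  assumes "1 \<le> j" "j \<le> m" shows "neg_at j \<in> gen_words m"
  using assms
proof (induction j rule: nat_induct_at_least)
  case base
  then show ?case by (simp add: neg_at_1[simplified] gen_words_gen)
next
  case (Suc j)
  then show ?case
    by (subst neg_at_Suc) (auto intro!: gen_words_comp gen_words_gen)
qed

text \<open>The Coxeter length is a \<open>LEAST\<close> over words and says nothing unless some
  word exists. A word \<rho> that agrees with \<pi> at the last element is split off; the remaining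
  factor fixes that element, hence has smaller rank.\<close>

lemma hyperoct_generated: "\<pi> \<in> hyperoct m \<Longrightarrow> \<pi> \<in> gen_words m"
proof (induction m arbitrary: \<pi>)
  case 0
  then show ?case using hyperoct_0 gen_words_id by (metis singletonD)
next
  case (Suc m)
  define M where "M = Suc m"
  note pi = Suc.prems[folded M_def]
  define p where "p = nat \<bar>\<pi> (int M)\<bar>"
  have "\<pi> (int M) \<noteq> 0" "\<bar>\<pi> (int M)\<bar> \<le> int M"
    using hyperoct_eq_zero[OF pi] hyperoct_abs_le[OF pi] by (auto simp: M_def)
  hence p: "1 \<le> p" "p \<le> M"
    by (auto simp: p_def)
  \<comment> \<open>\<open>cyc\<close> preserves signs, so a negative value at \<open>M\<close>
    needs a sign change before the cycle.\<close>
  define \<rho> where "\<rho> = (if \<pi> (int M) > 0 then cyc p M else cyc p M \<circ> neg_at M)"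
  have \<rho>: "\<rho> \<in> hyperoct M" "\<rho> \<in> gen_words M"
    using p cyc_hyperoct neg_at_hyperoct hyperoct_comp cyc_gen_words neg_at_gen_words gen_words_comp
    by (auto simp: \<rho>_def)
  have "\<rho> (int M) = \<pi> (int M)"
    using \<open>\<pi> (int M) \<noteq> 0\<close> by (auto simp: \<rho>_def cyc_def neg_at_def p_def M_def sgn_if)
  hence "(inv \<rho> \<circ> \<pi>) (int M) = int M"
    using hyperoct_inv_simps(1)[OF \<rho>(1), of "int M"] by simp
  hence "inv \<rho> \<circ> \<pi> \<in> hyperoct m"
    using \<rho>(1) pi hyperoct_fix_last hyperoct_comp hyperoct_inv unfolding M_def by metis
  hence "inv \<rho> \<circ> \<pi> \<in> gen_words M"
    using Suc.IH gen_words_mono[of m M] by (auto simp: M_def)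
  hence "\<rho> \<circ> (inv \<rho> \<circ> \<pi>) \<in> gen_words M"
    using \<rho> gen_words_comp by blast
  thus ?case
    using hyperoct_inv_simps[OF \<rho>(1)] by (simp add: o_assoc M_def)
qed

section \<open>The sign as a group character\<close>

definition abs_perm :: "nat \<Rightarrow> (int \<Rightarrow> int) \<Rightarrow> int \<Rightarrow> int" where
  "abs_perm m \<pi> i = (if 1 \<le> i \<and> i \<le> int m then \<bar>\<pi> i\<bar> else i)"

lemma abs_perm_comp:
  assumes "\<pi> \<in> hyperoct m" "\<sigma> \<in> hyperoct m"
  shows "abs_perm m (\<pi> \<circ> \<sigma>) = abs_perm m \<pi> \<circ> abs_perm m \<sigma>"
proof
  fix i
  have "1 \<le> \<bar>\<sigma> i\<bar> \<and> \<bar>\<sigma> i\<bar> \<le> int m" if "1 \<le> i" "i \<le> int m"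
    using that hyperoct_eq_zero[OF assms(2), of i] hyperoct_abs_le[OF assms(2), of i] by auto
  thus "abs_perm m (\<pi> \<circ> \<sigma>) i = (abs_perm m \<pi> \<circ> abs_perm m \<sigma>) i"
    by (auto simp: abs_perm_def hyperoct_abs[OF assms(1)])
qed

lemma abs_perm_permutes:
  assumes "\<pi> \<in> hyperoct m" shows "abs_perm m \<pi> permutes {1..int m}"
proof -
  have id: "abs_perm m id = id"
    by (auto simp: abs_perm_def fun_eq_iff)
  have "abs_perm m \<pi> \<circ> abs_perm m (inv \<pi>) = id" "abs_perm m (inv \<pi>) \<circ> abs_perm m \<pi> = id"
    using abs_perm_comp[of \<pi> m "inv \<pi>"] abs_perm_comp[of "inv \<pi>" m \<pi>] assms
    by (simp_all add: hyperoct_inv hyperoct_inv_simps id)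
  hence "bij (abs_perm m \<pi>)"
    using o_bij by blast
  moreover have "abs_perm m \<pi> i = i" if "i \<notin> {1..int m}" for i
    using that by (auto simp: abs_perm_def)
  ultimately show ?thesis
    by (auto simp: permutes_def bij_iff)
qed

text \<open>The first factor is the parity of the number of sign changes: as a permutation of
  \<open>{-m..m}\<close>, a generator \<open>s\<^sub>i\<close> with \<open>i \<ge> 1\<close> is a product of two transpositions.\<close>

definition hyperoct_char :: "nat \<Rightarrow> (int \<Rightarrow> int) \<Rightarrow> int" where
  "hyperoct_char m \<pi> = sign \<pi> * sign (abs_perm m \<pi>)"

lemma hyperoct_char_comp:
  assumes "\<pi> \<in> hyperoct m" "\<sigma> \<in> hyperoct m"
  shows "hyperoct_char m (\<pi> \<circ> \<sigma>) = hyperoct_char m \<pi> * hyperoct_char m \<sigma>"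
proof -
  have "permutation \<tau> \<and> permutation (abs_perm m \<tau>)" if "\<tau> \<in> hyperoct m" for \<tau>
    using that hyperoct_permutes[OF that] abs_perm_permutes[OF that] permutation_permutes by blast
  with assms show ?thesis
    by (simp add: hyperoct_char_def abs_perm_comp sign_compose mult_ac)
qed

lemma hyperoct_char_gen:
  assumes "i < m" shows "hyperoct_char m (coxeter_gen i) = - 1"
proof (cases "i = 0")
  case True
  have "abs_perm m (coxeter_gen 0) = id"
    by (auto simp: abs_perm_def coxeter_gen_0 fun_eq_iff)
  moreover have "sign (coxeter_gen 0) = - 1"
    by (simp add: coxeter_gen_def sign_swap_id)
  ultimately show ?thesis
    using True by (simp add: hyperoct_char_def)
next
  case False
  have "abs_perm m (coxeter_gen i) = transpose (int i) (int i + 1)"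
    using False assms by (auto simp: abs_perm_def coxeter_gen_pos fun_eq_iff transpose_def)
  moreover have "sign (coxeter_gen i) = 1"
    using False by (simp add: coxeter_gen_def sign_compose sign_swap_id permutation_swap_id)
  ultimately show ?thesis
    by (simp add: hyperoct_char_def sign_swap_id)
qed

text \<open>The character is -1 on every generator, so it gives the parity of the length of any word
  for \<pi>, in particular of a shortest one.\<close>

lemma hyperoct_sgn_eq_char:
  assumes "\<pi> \<in> hyperoct m" shows "hyperoct_sgn m \<pi> = of_int (hyperoct_char m \<pi>)"
proof -
  have word: "foldr (\<circ>) (map coxeter_gen w) id \<in> hyperoct m \<and>
      hyperoct_char m (foldr (\<circ>) (map coxeter_gen w) id) = (- 1) ^ length w"
    if "set w \<subseteq> {..<m}" for w
    using that
  proof (induction w)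
    case Nil
    have "hyperoct_char m id * hyperoct_char m id = hyperoct_char m id"
      using hyperoct_char_comp[OF hyperoct_id hyperoct_id, of m] by simp
    moreover have "hyperoct_char m id \<noteq> 0"
      by (auto simp: hyperoct_char_def sign_def)
    ultimately have "hyperoct_char m id = 1"
      by simp
    moreover have "foldr (\<circ>) (map coxeter_gen []) id = id"
      by (simp add: fun_eq_iff)
    ultimately show ?case
      using hyperoct_id[of m] by (simp only: list.size power_0 simp_thms)
  next
    case (Cons i w)
    define \<sigma> where "\<sigma> = foldr (\<circ>) (map coxeter_gen w) id"
    have "foldr (\<circ>) (map coxeter_gen (i # w)) id = coxeter_gen i \<circ> \<sigma>"
      by (simp add: \<sigma>_def fun_eq_iff)
    moreover have "\<sigma> \<in> hyperoct m" "hyperoct_char m \<sigma> = (- 1) ^ length w" "i < m"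
      using Cons unfolding \<sigma>_def by (metis set_subset_Cons subset_trans, metis set_subset_Cons subset_trans, auto)
    ultimately show ?case
      using coxeter_gen_hyperoct[of i m] hyperoct_char_gen[of i m]
      by (metis hyperoct_comp hyperoct_char_comp length_Cons power_Suc)
  qed
  have "\<exists>l w. length w = l \<and> set w \<subseteq> {..<m} \<and> \<pi> = foldr (\<circ>) (map coxeter_gen w) id"
    using hyperoct_generated[OF assms] by (auto simp: gen_words_def)
  from LeastI_ex[OF this] obtain w where
    "length w = coxeter_length m \<pi>" "set w \<subseteq> {..<m}" "\<pi> = foldr (\<circ>) (map coxeter_gen w) id"
    unfolding coxeter_length_def by blast
  with word[of w] show ?thesis
    by (simp add: hyperoct_sgn_def)
qed

lemma hyperoct_sgn_comp:
  "\<pi> \<in> hyperoct m \<Longrightarrow> \<sigma> \<in> hyperoct m \<Longrightarrow>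
    hyperoct_sgn m (\<pi> \<circ> \<sigma>) = hyperoct_sgn m \<pi> * hyperoct_sgn m \<sigma>"
  by (simp add: hyperoct_sgn_eq_char hyperoct_comp hyperoct_char_comp)

lemma hyperoct_sgn_gen: "i < m \<Longrightarrow> hyperoct_sgn m (coxeter_gen i) = - 1"
  by (simp add: hyperoct_sgn_eq_char coxeter_gen_hyperoct hyperoct_char_gen)

lemma hyperoct_sgn_square: "hyperoct_sgn m \<pi> * hyperoct_sgn m \<pi> = 1"
  by (simp add: hyperoct_sgn_def flip: power_add mult_2)

lemma hyperoct_sgn_id: "hyperoct_sgn m id = 1"
  using hyperoct_sgn_comp[OF hyperoct_id hyperoct_id, of m] hyperoct_sgn_square[of m id] by simp

lemma hyperoct_sgn_inv:
  assumes "\<pi> \<in> hyperoct m" shows "hyperoct_sgn m (inv \<pi>) = hyperoct_sgn m \<pi>"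
proof -
  have "hyperoct_sgn m (inv \<pi>) * hyperoct_sgn m \<pi> = 1"
    using hyperoct_sgn_comp[OF hyperoct_inv[OF assms] assms] hyperoct_inv_simps[OF assms]
    by (simp add: hyperoct_sgn_id)
  thus ?thesis
    using hyperoct_sgn_square[of m \<pi>] by (metis mult.assoc mult.right_neutral mult.left_neutral)
qed

text \<open>There is one generator for each of the \<open>m - p\<close> steps; the exponent
  \<open>m + p\<close> has the same parity and avoids truncated subtraction.\<close>

lemma hyperoct_sgn_cyc:
  assumes "1 \<le> p" "p \<le> m" shows "hyperoct_sgn m (cyc p m) = (- 1) ^ (m + p)"
  using assms(2,1)
proof (induction p rule: inc_induct)
  case base
  have "hyperoct_sgn m (cyc m m) = 1"
    using base cyc_last hyperoct_sgn_id by metis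
  then show ?case by simp
next
  case (step p)
  have "hyperoct_sgn m (cyc p m) = - hyperoct_sgn m (cyc (Suc p) m)"
    using step by (simp add: cyc_step hyperoct_sgn_comp coxeter_gen_hyperoct cyc_hyperoct
        hyperoct_sgn_gen)
  with step show ?case by simp
qed

lemma hyperoct_sgn_neg_at:
  assumes "1 \<le> j" "j \<le> m" shows "hyperoct_sgn m (neg_at j) = - 1"
  using assms
proof (induction j rule: nat_induct_at_least)
  case base
  then show ?case by (simp add: neg_at_1[simplified] hyperoct_sgn_gen)
next
  case (Suc j)
  have "hyperoct_sgn m (neg_at (Suc j)) = hyperoct_sgn m (coxeter_gen j) *
      hyperoct_sgn m (neg_at j) * hyperoct_sgn m (coxeter_gen j)"
    using Suc by (simp only: neg_at_Suc hyperoct_sgn_comp hyperoct_comp neg_at_hyperoct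
        coxeter_gen_hyperoct Suc_le_lessD Suc_leD)
  with Suc show ?case
    by (simp add: hyperoct_sgn_gen)
qed

text \<open>The larger rank admits more generators, so a shortest word could a priori change; the
  parity cannot, because both factors of the character are the same in the two ranks.\<close>

lemma hyperoct_sgn_Suc:
  assumes "\<pi> \<in> hyperoct m" shows "hyperoct_sgn (Suc m) \<pi> = hyperoct_sgn m \<pi>"
proof -
  have "\<pi> (int (Suc m)) = int (Suc m)"
    by (rule hyperoct_outside[OF assms]) simp
  hence "abs_perm (Suc m) \<pi> = abs_perm m \<pi>"
    by (intro ext) (simp add: abs_perm_def, smt (verit))
  moreover have "\<pi> \<in> hyperoct (Suc m)"
    using assms hyperoct_mono[of m "Suc m"] by auto
  ultimately show ?thesis
    using assms by (simp add: hyperoct_sgn_eq_char hyperoct_char_def)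
qed

section \<open>Odd maps and their sorting permutations\<close>

text \<open>With the value 0 prescribed outside the range, such a map is determined by its values at
  \<open>1, ..., m\<close>, so there are \<open>(2 * k + 1) ^ m\<close> of them and sums over them
  make sense.\<close>

definition odd_maps :: "nat \<Rightarrow> nat \<Rightarrow> (int \<Rightarrow> int) set" where
  "odd_maps m k = {g. (\<forall>v. g (- v) = - g v) \<and> (\<forall>v. \<bar>v\<bar> > int m \<longrightarrow> g v = 0) \<and>
     (\<forall>v. \<bar>g v\<bar> \<le> int k)}"

definition lexlt :: "(int \<Rightarrow> int) \<Rightarrow> int \<Rightarrow> int \<Rightarrow> bool" where
  "lexlt g v w \<longleftrightarrow> g v < g w \<or> g v = g w \<and> v < w"

definition sorts :: "nat \<Rightarrow> (int \<Rightarrow> int) \<Rightarrow> (int \<Rightarrow> int) \<Rightarrow> bool" where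
  "sorts m g \<pi> \<longleftrightarrow> (\<forall>u v. - int m \<le> u \<and> u < v \<and> v \<le> int m \<longrightarrow> lexlt g (\<pi> u) (\<pi> v))"

definition srt :: "nat \<Rightarrow> (int \<Rightarrow> int) \<Rightarrow> int \<Rightarrow> int" where
  "srt m g = (THE \<pi>. \<pi> \<in> hyperoct m \<and> sorts m g \<pi>)"

text \<open>The place of \<open>v\<close> in the sorted enumeration, numbered so that the middle
  place is 0; this is the inverse of the sorting permutation.\<close>

definition rank :: "nat \<Rightarrow> (int \<Rightarrow> int) \<Rightarrow> int \<Rightarrow> int" where
  "rank m g v = (if \<bar>v\<bar> \<le> int m then int (card {w \<in> {- int m..int m}. lexlt g w v}) - int m else v)"

lemma odd_mapsD:
  assumes "g \<in> odd_maps m k"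
  shows "g (- v) = - g v" "\<bar>v\<bar> > int m \<Longrightarrow> g v = 0" "\<bar>g v\<bar> \<le> int k" "g 0 = 0"
proof -
  show odd: "g (- v) = - g v" for v
    using assms by (simp add: odd_maps_def)
  show "\<bar>v\<bar> > int m \<Longrightarrow> g v = 0" "\<bar>g v\<bar> \<le> int k"
    using assms by (auto simp: odd_maps_def)
  show "g 0 = 0"
    using odd[of 0] by simp
qed

lemma finite_odd_maps: "finite (odd_maps m k)"
proof (rule finite_subset)
  show "odd_maps m k \<subseteq> {g. \<forall>v. (v \<in> {- int m..int m} \<longrightarrow> g v \<in> {- int k..int k}) \<and>
      (v \<notin> {- int m..int m} \<longrightarrow> g v = 0)}"
    by (auto simp: odd_maps_def abs_le_iff abs_less_iff) (smt (verit))+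
  show "finite {g. \<forall>v. (v \<in> {- int m..int m} \<longrightarrow> g v \<in> {- int k..int k}) \<and>
      (v \<notin> {- int m..int m} \<longrightarrow> g v = 0)}"
    by (rule finite_set_of_finite_funs) auto
qed

lemma lexlt_trans: "lexlt g u v \<Longrightarrow> lexlt g v w \<Longrightarrow> lexlt g u w"
  by (auto simp: lexlt_def)

lemma lexlt_linear: "lexlt g v w \<or> v = w \<or> lexlt g w v"
  by (auto simp: lexlt_def)

lemma lexlt_irrefl: "\<not> lexlt g v v"
  by (simp add: lexlt_def)

lemma lexlt_uminus: "g \<in> odd_maps m k \<Longrightarrow> lexlt g (- v) (- w) \<longleftrightarrow> lexlt g w v"
  by (auto simp: lexlt_def odd_mapsD)

lemma sortsD:
  "sorts m g \<pi> \<Longrightarrow> u < v \<Longrightarrow> \<bar>u\<bar> \<le> int m \<Longrightarrow> \<bar>v\<bar> \<le> int m \<Longrightarrow> lexlt g (\<pi> u) (\<pi> v)"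
  by (simp add: sorts_def abs_le_iff)

lemma sorts_rank:
  assumes \<pi>: "\<pi> \<in> hyperoct m" and s: "sorts m g \<pi>" and u: "\<bar>u\<bar> \<le> int m"
  shows "rank m g (\<pi> u) = u"
proof -
  have "{w \<in> {- int m..int m}. lexlt g w (\<pi> u)} = \<pi> ` {- int m..<u}"
  proof (intro equalityI subsetI)
    fix w assume w: "w \<in> {w \<in> {- int m..int m}. lexlt g w (\<pi> u)}"
    define x where "x = inv \<pi> w"
    have x: "w = \<pi> x"
      by (simp add: x_def hyperoct_inv_simps[OF \<pi>])
    have "\<bar>x\<bar> \<le> int m"
      using w hyperoct_abs_le[OF \<pi>, of x] by (auto simp: x)
    moreover have "lexlt g (\<pi> x) (\<pi> u)"
      using w by (simp add: x)
    hence "u \<noteq> x" "\<not> lexlt g (\<pi> u) (\<pi> x)"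
      using lexlt_irrefl lexlt_trans by blast+
    moreover have "u < x \<longrightarrow> lexlt g (\<pi> u) (\<pi> x)"
      using s u \<open>\<bar>x\<bar> \<le> int m\<close> by (simp add: sorts_def abs_le_iff)
    ultimately show "w \<in> \<pi> ` {- int m..<u}"
      by (auto simp: x)
  next
    fix w assume "w \<in> \<pi> ` {- int m..<u}"
    then obtain x where x: "w = \<pi> x" "- int m \<le> x" "x < u"
      by auto
    then show "w \<in> {w \<in> {- int m..int m}. lexlt g w (\<pi> u)}"
      using u s hyperoct_abs_le[OF \<pi>, of x] by (auto simp: sorts_def abs_le_iff)
  qed
  moreover have "card (\<pi> ` {- int m..<u}) = card {- int m..<u}"
    by (rule card_image) (use hyperoct_inj[OF \<pi>] in \<open>auto simp: inj_on_def\<close>)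
  ultimately show ?thesis
    using u hyperoct_abs_le[OF \<pi>, of u] by (auto simp: rank_def)
qed

lemma sorts_unique:
  assumes "\<pi> \<in> hyperoct m" "sorts m g \<pi>" "\<sigma> \<in> hyperoct m" "sorts m g \<sigma>"
  shows "\<pi> = \<sigma>"
proof
  fix u
  show "\<pi> u = \<sigma> u"
  proof (cases "\<bar>u\<bar> \<le> int m")
    case True
    define w where "w = inv \<sigma> (\<pi> u)"
    have w: "\<pi> u = \<sigma> w"
      by (simp add: w_def hyperoct_inv_simps[OF assms(3)])
    have "\<bar>w\<bar> \<le> int m"
      using True hyperoct_abs_le[OF assms(3), of w] hyperoct_abs_le[OF assms(1), of u] w by simp
    hence "u = w"
      using sorts_rank[OF assms(1,2) True] sorts_rank[OF assms(3,4), of w] w by simp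
    with w show ?thesis
      by simp
  next
    case False
    thus ?thesis
      using hyperoct_outside[OF assms(1), of u] hyperoct_outside[OF assms(3), of u] by simp
  qed
qed

lemma rank_strict_mono:
  assumes "v \<in> {- int m..int m}" "w \<in> {- int m..int m}" "lexlt g v w"
  shows "rank m g v < rank m g w"
proof -
  have "{x \<in> {- int m..int m}. lexlt g x v} \<subset> {x \<in> {- int m..int m}. lexlt g x w}"
    using assms lexlt_trans lexlt_irrefl by blast
  hence "card {x \<in> {- int m..int m}. lexlt g x v} < card {x \<in> {- int m..int m}. lexlt g x w}"
    by (rule psubset_card_mono[rotated]) (rule finite_subset[of _ "{- int m..int m}"], auto)
  thus ?thesis
    using assms by (auto simp: rank_def abs_le_iff)
qed

lemma rank_hyperoct:
  assumes g: "g \<in> odd_maps m k"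
  shows "rank m g \<in> hyperoct m"
proof -
  let ?I = "{- int m..int m}"
  have "inj_on (rank m g) ?I"
    by (rule inj_onI) (metis rank_strict_mono lexlt_linear less_irrefl)
  moreover have "rank m g v \<in> ?I" if "v \<in> ?I" for v
  proof -
    have "card {x \<in> ?I. lexlt g x v} \<le> card (?I - {v})"
      by (rule card_mono) (auto simp: lexlt_irrefl)
    also have "\<dots> = 2 * m"
      using that by (subst card_Diff_singleton) auto
    finally show ?thesis
      using that by (auto simp: rank_def)
  qed
  ultimately have "bij_betw (rank m g) ?I ?I"
    by (intro bij_betw_imageI endo_inj_surj image_subsetI finite_atLeastAtMost_int)
  hence perm: "rank m g permutes ?I"
    by (rule bij_imp_permutes) (auto simp: rank_def abs_le_iff)
  \<comment> \<open>Negation reverses the lexicographic order, so as many elements precede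
    \<open>- v\<close> as follow \<open>v\<close>. The elements before \<open>v\<close>, those after
    it and \<open>v\<close> itself number \<open>2 * m + 1\<close>.\<close>
  have "rank m g (- v) = - rank m g v" for v
  proof (cases "v \<in> ?I")
    case True
    let ?L = "{x \<in> ?I. lexlt g x v}" and ?R = "{x \<in> ?I. lexlt g v x}"
    have "{x \<in> ?I. lexlt g x (- v)} = uminus ` ?R"
    proof (intro equalityI subsetI)
      fix x assume "x \<in> {x \<in> ?I. lexlt g x (- v)}"
      hence "- x \<in> ?R"
        using lexlt_uminus[OF g, of "-x" v] by auto
      thus "x \<in> uminus ` ?R"
        by (metis imageI minus_minus)
    qed (use lexlt_uminus[OF g] in auto)
    moreover have "card (uminus ` ?R) = card ?R"
      by (rule card_image) (auto simp: inj_on_def)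
    ultimately have R: "card {x \<in> ?I. lexlt g x (- v)} = card ?R"
      by (rule ssubst)
    have "?I = insert v (?L \<union> ?R)"
      using True lexlt_linear[of g _ v] by auto
    hence c: "card ?I = card (insert v (?L \<union> ?R))"
      by (rule arg_cong)
    have "finite (?L \<union> ?R)"
      by (rule finite_subset[of _ ?I]) auto
    moreover have "v \<notin> ?L \<union> ?R"
      by (simp add: lexlt_irrefl)
    ultimately have "card (insert v (?L \<union> ?R)) = Suc (card (?L \<union> ?R))"
      by (rule card_insert_disjoint)
    note c = c[unfolded this]
    have "card (?L \<union> ?R) = card ?L + card ?R"
      using lexlt_trans lexlt_irrefl
      by (intro card_Un_disjoint finite_subset[of ?L ?I] finite_subset[of ?R ?I]) fastforce+
    with c R True show ?thesis
      unfolding rank_def by (simp add: abs_le_iff)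
  qed (auto simp: rank_def)
  with perm show ?thesis
    by (simp add: hyperoct_def)
qed

lemma ex_sorts:
  assumes g: "g \<in> odd_maps m k"
  shows "\<exists>\<pi>\<in>hyperoct m. sorts m g \<pi>"
proof
  define \<rho> where "\<rho> = rank m g"
  have \<rho>: "\<rho> \<in> hyperoct m"
    unfolding \<rho>_def by (rule rank_hyperoct[OF g])
  show "inv \<rho> \<in> hyperoct m"
    using \<rho> by (rule hyperoct_inv)
  show "sorts m g (inv \<rho>)"
    unfolding sorts_def
  proof (intro allI impI)
    fix u v assume uv: "- int m \<le> u \<and> u < v \<and> v \<le> int m"
    have b: "\<bar>inv \<rho> u\<bar> \<le> int m" "\<bar>inv \<rho> v\<bar> \<le> int m"
      using uv by (auto simp: hyperoct_abs_le[OF hyperoct_inv[OF \<rho>]])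
    have "inv \<rho> u \<noteq> inv \<rho> v"
      using uv hyperoct_inj[OF hyperoct_inv[OF \<rho>]] by auto
    moreover have "\<not> lexlt g (inv \<rho> v) (inv \<rho> u)"
      using rank_strict_mono[of "inv \<rho> v" m "inv \<rho> u" g] b uv
      by (auto simp: hyperoct_inv_simps[OF \<rho>] abs_le_iff simp flip: \<rho>_def)
    ultimately show "lexlt g (inv \<rho> u) (inv \<rho> v)"
      using lexlt_linear by blast
  qed
qed

lemma srt_eqI: "\<pi> \<in> hyperoct m \<Longrightarrow> sorts m g \<pi> \<Longrightarrow> srt m g = \<pi>"
  unfolding srt_def by (rule the_equality) (auto intro: sorts_unique)

lemma
  assumes "g \<in> odd_maps m k"
  shows srt_hyperoct: "srt m g \<in> hyperoct m" and srt_sorts: "sorts m g (srt m g)"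
  using ex_sorts[OF assms] srt_eqI by auto

lemma srt_eq_iff: "g \<in> odd_maps m k \<Longrightarrow> \<pi> \<in> hyperoct m \<Longrightarrow> srt m g = \<pi> \<longleftrightarrow> sorts m g \<pi>"
  using srt_eqI srt_sorts by blast

text \<open>The way to find the sorting permutation of a modified map: it is enough to exhibit a
  relabelling \<tau> that carries the old order to the new one.\<close>

lemma sorts_comp:
  assumes "\<pi> \<in> hyperoct m" "sorts m g \<pi>"
    and "\<And>v w. \<bar>v\<bar> \<le> int m \<Longrightarrow> \<bar>w\<bar> \<le> int m \<Longrightarrow> lexlt g v w \<Longrightarrow> lexlt g' (\<tau> v) (\<tau> w)"
  shows "sorts m g' (\<tau> \<circ> \<pi>)"
proof -
  have "lexlt g' (\<tau> (\<pi> u)) (\<tau> (\<pi> v))" if "- int m \<le> u" "u < v" "v \<le> int m" for u v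
    using that assms(2) by (intro assms(3)) (auto simp: sorts_def hyperoct_abs_le[OF assms(1)])
  thus ?thesis
    by (simp add: sorts_def)
qed

text \<open>Oddness reflects comparisons at negative places to nonnegative ones, and transitivity
  does the rest. This is why the descents at \<open>0, ..., m - 1\<close> alone control
  sorting.\<close>

lemma sortsI_consecutive:
  assumes \<pi>: "\<pi> \<in> hyperoct m" and g: "g \<in> odd_maps m k"
    and step: "\<And>i. i < m \<Longrightarrow> lexlt g (\<pi> (int i)) (\<pi> (int i + 1))"
  shows "sorts m g \<pi>"
proof -
  have cons: "lexlt g (\<pi> u) (\<pi> (u + 1))" if "- int m \<le> u" "u < int m" for u
  proof (cases "u \<ge> 0")
    case True
    then show ?thesis using step[of "nat u"] that by simp
  next
    case False
    hence "lexlt g (\<pi> (- u - 1)) (\<pi> (- u))"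
      using step[of "nat (- u - 1)"] that by simp
    hence "lexlt g (- \<pi> (- u)) (- \<pi> (- u - 1))"
      by (simp add: lexlt_uminus[OF g])
    moreover have "\<pi> (- u - 1) = - \<pi> (u + 1)"
      using hyperoct_odd[OF \<pi>, of "u + 1"] by simp
    ultimately show ?thesis
      by (simp add: hyperoct_odd[OF \<pi>])
  qed
  have "lexlt g (\<pi> u) (\<pi> v)" if "- int m \<le> u" "u < v" "v \<le> int m" for u v
    using that(2,3)
  proof (induction v rule: int_gr_induct)
    case base
    then show ?case using cons[of u] that by simp
  next
    case (step v)
    then show ?case using cons[of v] that lexlt_trans by force
  qed
  thus ?thesis
    by (simp add: sorts_def)
qed

subsection \<open>Counting the odd maps with a given sorting permutation\<close>

text \<open>The possible values of an odd map along \<open>\<pi> 0, ..., \<pi> m\<close>, where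
  \<open>D\<close> marks the descents of \<pi>; at a descent the value has to jump.\<close>

definition step_seqs :: "(nat \<Rightarrow> bool) \<Rightarrow> nat \<Rightarrow> nat \<Rightarrow> (nat \<Rightarrow> nat) set" where
  "step_seqs D m k = {a. a 0 = 0 \<and> (\<forall>i<m. a i + of_bool (D i) \<le> a (Suc i)) \<and> a m \<le> k \<and>
     (\<forall>i>m. a i = 0)}"

lemma step_seqs_last:
  assumes "of_bool (D m) \<le> t"
  shows "{a \<in> step_seqs D (Suc m) t. a (Suc m) = t} =
    (\<lambda>a. a(Suc m := t)) ` step_seqs D m (t - of_bool (D m))" (is "?L = ?R")
proof (intro equalityI subsetI)
  fix a assume "a \<in> ?L"
  hence "a(Suc m := 0) \<in> step_seqs D m (t - of_bool (D m))" "a = (a(Suc m := 0))(Suc m := t)"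
    using assms by (auto simp: step_seqs_def fun_eq_iff less_Suc_eq of_bool_def split: if_splits)
  thus "a \<in> ?R"
    by blast
next
  fix a assume "a \<in> ?R"
  then obtain b where "b \<in> step_seqs D m (t - of_bool (D m))" "a = b(Suc m := t)"
    by auto
  thus "a \<in> ?L"
    using assms by (auto simp: step_seqs_def less_Suc_eq of_bool_def split: if_splits)
qed

lemma card_step_seqs_last:
  assumes "of_bool (D m) \<le> t" "finite (step_seqs D m (t - of_bool (D m)))"
  shows "finite {a \<in> step_seqs D (Suc m) t. a (Suc m) = t}"
    "card {a \<in> step_seqs D (Suc m) t. a (Suc m) = t} = card (step_seqs D m (t - of_bool (D m)))"
proof -
  have "inj_on (\<lambda>a. a(Suc m := t)) (step_seqs D m (t - of_bool (D m)))"
    by (rule inj_onI) (auto simp: step_seqs_def fun_eq_iff, metis lessI)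
  thus "card {a \<in> step_seqs D (Suc m) t. a (Suc m) = t} = card (step_seqs D m (t - of_bool (D m)))"
    unfolding step_seqs_last[of D m, OF assms(1)] by (rule card_image)
  show "finite {a \<in> step_seqs D (Suc m) t. a (Suc m) = t}"
    unfolding step_seqs_last[of D m, OF assms(1)] using assms(2) by simp
qed

text \<open>Splitting off the sequences whose last value attains the bound is Pascal's rule, whence
  an outer induction on \<open>m\<close> and an inner one on \<open>k\<close>.\<close>

lemma card_step_seqs:
  "finite (step_seqs D m k) \<and> card (step_seqs D m k) = (k + m - card {i. i < m \<and> D i}) choose m"
proof (induction m arbitrary: k)
  case 0
  have "step_seqs D 0 k = {\<lambda>_. 0}"
    by (auto simp: step_seqs_def fun_eq_iff) (metis gr0I)
  then show ?case by simp
next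
  case (Suc m)
  define d where "d = card {i. i < m \<and> D i}"
  have "d \<le> card {..<m}"
    unfolding d_def by (rule card_mono) auto
  hence d: "d \<le> m" by simp
  have set_Suc: "{i. i < Suc m \<and> D i} = (if D m then insert m {i. i < m \<and> D i} else {i. i < m \<and> D i})"
    by (auto simp: less_Suc_eq)
  have d': "card {i. i < Suc m \<and> D i} = d + of_bool (D m)"
    unfolding set_Suc d_def by simp
  let ?Z = "\<lambda>t. {a \<in> step_seqs D (Suc m) t. a (Suc m) = t}"
  have Z: "finite (?Z t) \<and> card (?Z t) = (t - of_bool (D m) + m - d) choose m" if "of_bool (D m) \<le> t" for t
    using card_step_seqs_last[of D m, OF that] Suc.IH by (simp add: d_def)
  show ?case
    unfolding d'
  proof (induction k)
    case 0
    have eq: "step_seqs D (Suc m) 0 = ?Z 0"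
      by (auto simp: step_seqs_def)
    show ?case
    proof (cases "D m")
      case True
      hence "?Z 0 = {}"
        by (auto simp: step_seqs_def)
      hence "step_seqs D (Suc m) 0 = {}"
        using eq by (rule trans[rotated])
      thus ?thesis
        using True d by simp
    next
      case False
      have "(m - d) choose m = (Suc m - d) choose (Suc m)"
        using d by (cases "d = 0") (auto simp: binomial_eq_0)
      thus ?thesis
        using Z[of 0] False d by (subst eq, subst (2) eq) simp
    qed
  next
    case (Suc k)
    have eq: "step_seqs D (Suc m) (Suc k) = step_seqs D (Suc m) k \<union> ?Z (Suc k)"
      by (auto simp: step_seqs_def)
    have "step_seqs D (Suc m) k \<inter> ?Z (Suc k) = {}"
      by (auto simp: step_seqs_def)
    moreover have fZ: "finite (?Z (Suc k))" "card (?Z (Suc k)) = (Suc k - of_bool (D m) + m - d) choose m"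
      using Z[of "Suc k"] by (auto simp: of_bool_def)
    ultimately have "card (step_seqs D (Suc m) (Suc k)) =
        ((k + Suc m - (d + of_bool (D m))) choose Suc m) + ((Suc k - of_bool (D m) + m - d) choose m)"
      using Suc by (subst eq) (simp add: card_Un_disjoint)
    also have "\<dots> = (Suc k + Suc m - (d + of_bool (D m))) choose Suc m"
      using d by (cases "D m") (auto simp: Suc_diff_le)
    finally have "card (step_seqs D (Suc m) (Suc k)) =
        (Suc k + Suc m - (d + of_bool (D m))) choose Suc m" .
    moreover have "finite (step_seqs D (Suc m) (Suc k))"
      using Suc fZ(1) by (subst eq) (rule finite_UnI, simp_all)
    ultimately show ?case
      by simp
  qed
qed

lemma descents_eq_card: "descents m \<pi> = card {i. i < m \<and> \<pi> (int i) > \<pi> (int i + 1)}"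
proof -
  have "{i \<in> {0..int m - 1}. \<pi> i > \<pi> (i + 1)} = int ` {i. i < m \<and> \<pi> (int i) > \<pi> (int i + 1)}"
  proof (intro equalityI subsetI)
    fix i assume "i \<in> {i \<in> {0..int m - 1}. \<pi> i > \<pi> (i + 1)}"
    thus "i \<in> int ` {i. i < m \<and> \<pi> (int i) > \<pi> (int i + 1)}"
      by (intro image_eqI[of _ _ "nat i"]) auto
  qed auto
  thus ?thesis
    by (simp add: descents_def card_image)
qed

text \<open>Along a sorting permutation the values increase weakly, and a tie requires \<pi> to
  increase, so a descent forces a strict step. Starting from \<open>g 0 = 0\<close>, the values at
  nonnegative places determine the others by oddness.\<close>

lemma card_sorted_odd_maps:
  assumes \<pi>: "\<pi> \<in> hyperoct m"
  shows "card {g \<in> odd_maps m k. sorts m g \<pi>} = (k + m - descents m \<pi>) choose m"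
proof -
  define D where "D i \<longleftrightarrow> \<pi> (int i) > \<pi> (int i + 1)" for i :: nat
  define \<phi> where "\<phi> g i = (if i \<le> m then nat (g (\<pi> (int i))) else 0)" for g :: "int \<Rightarrow> int" and i
  define \<psi> where "\<psi> a v = sgn (inv \<pi> v) * int (a (nat \<bar>inv \<pi> v\<bar>))" for a and v :: int
  have nonneg: "g (\<pi> (int i)) \<ge> 0" if "g \<in> odd_maps m k" "sorts m g \<pi>" "i \<le> m" for g and i :: nat
  proof (cases "i = 0")
    case True
    thus ?thesis using odd_mapsD(4)[OF that(1)] hyperoct_zero[OF \<pi>] by simp
  next
    case False
    hence "lexlt g (\<pi> 0) (\<pi> (int i))"
      using that by (auto simp: sorts_def)
    thus ?thesis using odd_mapsD(4)[OF that(1)] hyperoct_zero[OF \<pi>] by (auto simp: lexlt_def)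
  qed
  have "bij_betw \<phi> {g \<in> odd_maps m k. sorts m g \<pi>} (step_seqs D m k)"
  proof (rule bij_betw_byWitness[of _ \<psi>])
    show "\<forall>g\<in>{g \<in> odd_maps m k. sorts m g \<pi>}. \<psi> (\<phi> g) = g"
    proof (intro ballI ext)
      fix g v assume "g \<in> {g \<in> odd_maps m k. sorts m g \<pi>}"
      hence g: "g \<in> odd_maps m k" "sorts m g \<pi>" by auto
      define u where "u = inv \<pi> v"
      have v: "v = \<pi> u"
        by (simp add: u_def hyperoct_inv_simps[OF \<pi>])
      consider "u > int m" | "0 \<le> u" "u \<le> int m" | "- int m \<le> u" "u < 0" | "u < - int m"
        by linarith
      thus "\<psi> (\<phi> g) v = g v"
      proof cases
        case 1
        thus ?thesis using odd_mapsD(2)[OF g(1), of u] hyperoct_outside[OF \<pi>, of u]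
          by (simp add: \<psi>_def \<phi>_def flip: u_def) (simp add: v)
      next
        case 2
        thus ?thesis using nonneg[OF g, of "nat u"] odd_mapsD(4)[OF g(1)] hyperoct_zero[OF \<pi>]
            hyperoct_zero[OF hyperoct_inv[OF \<pi>]]
          by (cases "u = 0") (simp_all add: \<psi>_def \<phi>_def v hyperoct_inv_simps[OF \<pi>])
      next
        case 3
        have "g (\<pi> u) = - g (\<pi> (- u))"
          by (simp add: hyperoct_odd[OF \<pi>] odd_mapsD(1)[OF g(1)])
        thus ?thesis using 3 nonneg[OF g, of "nat (- u)"]
          by (simp add: \<psi>_def \<phi>_def v hyperoct_inv_simps[OF \<pi>])
      next
        case 4
        thus ?thesis using odd_mapsD(2)[OF g(1), of u] hyperoct_outside[OF \<pi>, of u]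
          by (simp add: \<psi>_def \<phi>_def flip: u_def) (simp add: v)
      qed
    qed
    have \<psi>_odd: "\<psi> a (- v) = - \<psi> a v" for a v
      by (simp add: \<psi>_def hyperoct_odd[OF hyperoct_inv[OF \<pi>]])
    have \<psi>_\<pi>: "\<psi> a (\<pi> (int i)) = int (a i)" if "a \<in> step_seqs D m k" for a i
      using that by (cases "i = 0") (auto simp: \<psi>_def hyperoct_inv_simps[OF \<pi>] step_seqs_def)
    show "\<forall>a\<in>step_seqs D m k. \<phi> (\<psi> a) = a"
    proof (intro ballI ext)
      fix a i assume "a \<in> step_seqs D m k"
      thus "\<phi> (\<psi> a) i = a i"
        using \<psi>_\<pi>[of a i] by (auto simp: \<phi>_def step_seqs_def)
    qed
    show "\<phi> ` {g \<in> odd_maps m k. sorts m g \<pi>} \<subseteq> step_seqs D m k"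
    proof (intro image_subsetI)
      fix g assume "g \<in> {g \<in> odd_maps m k. sorts m g \<pi>}"
      hence g: "g \<in> odd_maps m k" "sorts m g \<pi>" by auto
      have "\<phi> g i + of_bool (D i) \<le> \<phi> g (Suc i)" if "i < m" for i
      proof -
        have "lexlt g (\<pi> (int i)) (\<pi> (int i + 1))"
          using g(2) that by (simp add: sorts_def)
        thus ?thesis
          using nonneg[OF g, of i] nonneg[OF g, of "Suc i"] that
          by (auto simp: \<phi>_def D_def lexlt_def add.commute)
      qed
      thus "\<phi> g \<in> step_seqs D m k"
        using odd_mapsD(3)[OF g(1), of "\<pi> (int m)"] odd_mapsD(4)[OF g(1)] hyperoct_zero[OF \<pi>]
        by (auto simp: step_seqs_def \<phi>_def)
    qed
    show "\<psi> ` step_seqs D m k \<subseteq> {g \<in> odd_maps m k. sorts m g \<pi>}"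
    proof (intro image_subsetI CollectI conjI)
      fix a assume a: "a \<in> step_seqs D m k"
      have "a i \<le> a m" if "i \<le> m" for i
        using that
      proof (induction i rule: inc_induct)
        case (step i)
        have "a i \<le> a (Suc i)"
          using a step by (auto simp: step_seqs_def intro: add_leD1)
        with step show ?case by simp
      qed simp
      hence bound: "a i \<le> k" for i
        using a by (cases "i \<le> m") (auto simp: step_seqs_def intro: order_trans)
      have "\<psi> a v = 0" if "\<bar>v\<bar> > int m" for v
        using that a hyperoct_outside[OF hyperoct_inv[OF \<pi>] that] by (auto simp: \<psi>_def step_seqs_def)
      moreover have "\<bar>\<psi> a v\<bar> \<le> int k" for v
        using bound by (auto simp: \<psi>_def abs_mult sgn_if)
      ultimately show \<psi>: "\<psi> a \<in> odd_maps m k"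
        using \<psi>_odd by (auto simp: odd_maps_def)
      show "sorts m (\<psi> a) \<pi>"
      proof (rule sortsI_consecutive[OF \<pi> \<psi>])
        fix i assume "i < m"
        moreover have "\<pi> (int i) \<noteq> \<pi> (int i + 1)"
          by (simp add: hyperoct_inj[OF \<pi>])
        ultimately show "lexlt (\<psi> a) (\<pi> (int i)) (\<pi> (int i + 1))"
          using a \<psi>_\<pi>[OF a, of i] \<psi>_\<pi>[OF a, of "Suc i"]
          by (fastforce simp: lexlt_def step_seqs_def D_def of_bool_def add.commute split: if_splits)
      qed
    qed
  qed
  hence "card {g \<in> odd_maps m k. sorts m g \<pi>} = card (step_seqs D m k)"
    by (rule bij_betw_same_card)
  thus ?thesis
    using card_step_seqs[of D m k] by (simp add: descents_eq_card D_def)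
qed

lemma poly_eulerian_poly_odd:
  assumes "\<pi> \<in> hyperoct m"
  shows "poly (eulerian_poly m \<pi>) (of_nat (2 * k + 1)) =
    of_nat (card {g \<in> odd_maps m k. sorts m g \<pi>})"
proof -
  define d where "d = descents m \<pi>"
  have "d \<le> card {..<m}"
    unfolding d_def descents_eq_card by (rule card_mono) auto
  hence d: "d \<le> m" by simp
  have "poly (eulerian_poly m \<pi>) (of_nat (2 * k + 1)) =
      (\<Prod>i = 1..m. - 2 * of_nat d + 2 * of_nat i - 1 + of_nat (2 * k + 1)) / (2 ^ m * fact m)"
    by (simp add: eulerian_poly_def poly_prod d_def)
  also have "(\<Prod>i = 1..m. - 2 * of_nat d + 2 * of_nat i - 1 + of_nat (2 * k + 1) :: complex) =
      (\<Prod>i = 1..m. 2 * (of_nat k - of_nat d + of_nat i))"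
    by (intro prod.cong) (auto simp: algebra_simps)
  also have "\<dots> = 2 ^ m * (\<Prod>i = 1..m. of_nat k - of_nat d + of_nat i)"
    by (subst prod.distrib) simp
  \<comment> \<open>These factors are those of the falling factorial from \<open>k + m - d\<close>
    down to \<open>k - d + 1\<close>, so division by \<open>fact m\<close> leaves a binomial
    coefficient.\<close>
  also have "(\<Prod>i = 1..m. of_nat k - of_nat d + of_nat i :: complex) =
      (\<Prod>i = 0..<m. of_nat (k + m - d) - of_nat m + 1 + of_nat i)"
    using d by (intro prod.reindex_bij_witness[of _ Suc "\<lambda>i. i - 1"]) (auto simp: of_nat_diff)
  also have "2 ^ m * \<dots> / (2 ^ m * fact m) = of_nat (k + m - d) gchoose m"
    by (simp add: gbinomial_pochhammer' pochhammer_prod)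
  finally show ?thesis
    by (simp add: card_sorted_odd_maps[OF assms] binomial_gbinomial d_def)
qed

subsection \<open>Products of sorting permutations\<close>

text \<open>A number in balanced base \<open>2 * k + 1\<close>: the low digit is \<open>g v\<close>
  in \<open>{-k..k}\<close>, the high digit is \<open>f\<close> at the place of \<open>v\<close> in
  the enumeration \<pi>. Reading \<open>f\<close> at the place of \<open>v\<close> rather than at
  \<open>v\<close> itself is what makes sorting permutations compose.\<close>

definition lex_pair :: "nat \<Rightarrow> (int \<Rightarrow> int) \<Rightarrow> (int \<Rightarrow> int) \<Rightarrow> (int \<Rightarrow> int) \<Rightarrow> int \<Rightarrow> int" where
  "lex_pair k \<pi> g f v = f (inv \<pi> v) * (2 * int k + 1) + g v"

lemma lex_pair_odd_maps:
  assumes \<pi>: "\<pi> \<in> hyperoct m" and g: "g \<in> odd_maps m k" and f: "f \<in> odd_maps m l"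
  shows "lex_pair k \<pi> g f \<in> odd_maps m (l * (2 * k + 1) + k)"
proof -
  have "\<bar>lex_pair k \<pi> g f v\<bar> \<le> int (l * (2 * k + 1) + k)" for v
  proof -
    have "\<bar>f (inv \<pi> v) * (2 * int k + 1)\<bar> \<le> int l * (2 * int k + 1)"
      unfolding abs_mult using odd_mapsD(3)[OF f] by (intro mult_mono) auto
    thus ?thesis
      using odd_mapsD(3)[OF g, of v] unfolding lex_pair_def
      by (simp add: algebra_simps)
  qed
  moreover have "lex_pair k \<pi> g f (- v) = - lex_pair k \<pi> g f v" for v
    by (simp add: lex_pair_def hyperoct_odd[OF hyperoct_inv[OF \<pi>]] odd_mapsD(1)[OF g] odd_mapsD(1)[OF f])
  moreover have "lex_pair k \<pi> g f v = 0" if "\<bar>v\<bar> > int m" for v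
    using that by (simp add: lex_pair_def hyperoct_outside[OF hyperoct_inv[OF \<pi>]]
        odd_mapsD(2)[OF g] odd_mapsD(2)[OF f])
  ultimately show ?thesis
    by (simp add: odd_maps_def)
qed

text \<open>This is radix sort: after sorting by the low digit \<open>g\<close>, the places are
  sorted by the high digit \<open>f\<close>, and ties of \<open>f\<close> keep the order of the
  places, which is the order given by \<open>g\<close>.\<close>

lemma srt_comp:
  assumes g: "g \<in> odd_maps m k" and f: "f \<in> odd_maps m l"
  shows "srt m (lex_pair k (srt m g) g f) = srt m g \<circ> srt m f"
proof (rule srt_eqI)
  note \<pi> = srt_hyperoct[OF g]
  show "srt m g \<circ> srt m f \<in> hyperoct m"
    using \<pi> srt_hyperoct[OF f] by (rule hyperoct_comp)
  show "sorts m (lex_pair k (srt m g) g f) (srt m g \<circ> srt m f)"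
  proof (rule sorts_comp[OF srt_hyperoct[OF f] srt_sorts[OF f]])
    fix v w assume v: "\<bar>v\<bar> \<le> int m" and w: "\<bar>w\<bar> \<le> int m" and lt: "lexlt f v w"
    have e: "lex_pair k (srt m g) g f (srt m g u) = f u * (2 * int k + 1) + g (srt m g u)" for u
      by (simp add: lex_pair_def hyperoct_inv_simps[OF \<pi>])
    show "lexlt (lex_pair k (srt m g) g f) (srt m g v) (srt m g w)"
    proof (cases "f v < f w")
      case True
      \<comment> \<open>One unit of the high digit is worth \<open>2 * k + 1\<close>, whereas two
        low digits differ by at most \<open>2 * k\<close>.\<close>
      hence "(f v + 1) * (2 * int k + 1) \<le> f w * (2 * int k + 1)"
        by (intro mult_right_mono) auto
      hence "f v * (2 * int k + 1) + (2 * int k + 1) \<le> f w * (2 * int k + 1)"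
        by (simp add: distrib_right)
      thus ?thesis
        using odd_mapsD(3)[OF g, of "srt m g v"] odd_mapsD(3)[OF g, of "srt m g w"]
        unfolding lexlt_def e by linarith
    next
      case False
      with lt have "f v = f w" "v < w"
        by (auto simp: lexlt_def)
      hence "lexlt g (srt m g v) (srt m g w)"
        using srt_sorts[OF g] v w by (intro sortsD)
      thus ?thesis
        using \<open>f v = f w\<close> by (auto simp: lexlt_def e)
    qed
  qed
qed

text \<open>The bound comes from
  \<open>(2 * l + 1) * (2 * k + 1) = 2 * (l * (2 * k + 1) + k) + 1\<close>. Division with balanced
  remainder recovers \<open>g\<close> from the low digits, and then \<open>f\<close>, since the
  permutation to be undone depends on \<open>g\<close> only.\<close>

lemma lex_pair_bij:
  "bij_betw (\<lambda>(g, f). lex_pair k (srt m g) g f) (odd_maps m k \<times> odd_maps m l)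
     (odd_maps m (l * (2 * k + 1) + k))"
proof -
  define K where "K = 2 * int k + 1"
  have K: "K > 0" by (simp add: K_def)
  \<comment> \<open>The shift by \<open>k\<close> moves the remainder from \<open>{0..2 * k}\<close>
    to \<open>{-k..k}\<close>, so that both digits of an odd map are odd.\<close>
  define lo where "lo e v = (e v + int k) mod K - int k" for e :: "int \<Rightarrow> int" and v
  define hi where "hi e v = (e v + int k) div K" for e :: "int \<Rightarrow> int" and v
  have split: "e v = hi e v * K + lo e v" for e v
    unfolding lo_def hi_def using div_mult_mod_eq[of "e v + int k" K] by linarith
  have lohi: "lo e v = b" "hi e v = a" if "e v = a * K + b" "\<bar>b\<bar> \<le> int k" for e v a b
  proof -
    have "e v + int k = (b + int k) + a * K"
      using that by simp
    moreover have "(b + int k) mod K = b + int k" "(b + int k) div K = 0"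
      using that by (auto simp: K_def mod_pos_pos_trivial div_pos_pos_trivial)
    ultimately show "lo e v = b" "hi e v = a"
      using K unfolding lo_def hi_def by (simp_all only: mod_mult_self1 div_mult_self1)
  qed
  show ?thesis
  proof (rule bij_betw_byWitness[of _ "\<lambda>e. (lo e, hi e \<circ> srt m (lo e))"])
    show "\<forall>x\<in>odd_maps m k \<times> odd_maps m l. (\<lambda>e. (lo e, hi e \<circ> srt m (lo e)))
        ((\<lambda>(g, f). lex_pair k (srt m g) g f) x) = x"
    proof
      fix x assume "x \<in> odd_maps m k \<times> odd_maps m l"
      then obtain g f where x: "x = (g, f)" and g: "g \<in> odd_maps m k" and f: "f \<in> odd_maps m l"
        by auto
      let ?e = "lex_pair k (srt m g) g f"
      have e: "?e v = f (inv (srt m g) v) * K + g v" for v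
        by (simp add: lex_pair_def K_def)
      have "lo ?e = g" "hi ?e = f \<circ> inv (srt m g)"
        using lohi[of ?e, OF e odd_mapsD(3)[OF g]] by (simp_all add: fun_eq_iff)
      thus "(\<lambda>e. (lo e, hi e \<circ> srt m (lo e))) ((\<lambda>(g, f). lex_pair k (srt m g) g f) x) = x"
        by (simp add: x comp_assoc hyperoct_inv_simps[OF srt_hyperoct[OF g]])
    qed
    have odd: "lo e \<in> odd_maps m k" "hi e \<circ> srt m (lo e) \<in> odd_maps m l"
      if e: "e \<in> odd_maps m (l * (2 * k + 1) + k)" for e
    proof -
      have lo_le: "\<bar>lo e v\<bar> \<le> int k" for v
        using pos_mod_bound[OF K, of "e v + int k"] pos_mod_sign[OF K, of "e v + int k"]
          K_def
        unfolding lo_def by linarith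
      have neg: "lo e (- v) = - lo e v" "hi e (- v) = - hi e v" for v
        using lohi[of e "- v" "- hi e v" "- lo e v"] odd_mapsD(1)[OF e, of v] split[of e v] lo_le[of v]
        by auto
      have out: "lo e v = 0" "hi e v = 0" if "\<bar>v\<bar> > int m" for v
        using lohi[of e v 0 0] odd_mapsD(2)[OF e that] by auto
      show lo: "lo e \<in> odd_maps m k"
        using lo_le neg out by (simp add: odd_maps_def)
      have "\<bar>hi e v\<bar> \<le> int l" for v
      proof -
        have "\<bar>e v\<bar> \<le> int l * K + int k"
          using odd_mapsD(3)[OF e, of v] by (simp add: K_def algebra_simps)
        hence "\<bar>hi e v * K\<bar> \<le> int l * K + 2 * int k"
          using split[of e v] lo_le[of v] by linarith
        hence "\<bar>hi e v\<bar> * K < (int l + 1) * K"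
          using K by (simp add: abs_mult distrib_right) (simp add: K_def)
        thus ?thesis
          using K by (simp add: mult_less_cancel_right)
      qed
      thus "hi e \<circ> srt m (lo e) \<in> odd_maps m l"
        using neg out hyperoct_odd[OF srt_hyperoct[OF lo]] hyperoct_outside[OF srt_hyperoct[OF lo]]
        by (simp add: odd_maps_def)
    qed
    show "\<forall>e\<in>odd_maps m (l * (2 * k + 1) + k).
        (\<lambda>(g, f). lex_pair k (srt m g) g f) (lo e, hi e \<circ> srt m (lo e)) = e"
    proof (intro ballI ext)
      fix e v assume "e \<in> odd_maps m (l * (2 * k + 1) + k)"
      from hyperoct_inv_simps[OF srt_hyperoct[OF odd(1)[OF this]]]
      show "(\<lambda>(g, f). lex_pair k (srt m g) g f) (lo e, hi e \<circ> srt m (lo e)) v = e v"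
        using split[of e v] by (simp add: lex_pair_def K_def)
    qed
    show "(\<lambda>(g, f). lex_pair k (srt m g) g f) ` (odd_maps m k \<times> odd_maps m l) \<subseteq>
        odd_maps m (l * (2 * k + 1) + k)"
      using lex_pair_odd_maps srt_hyperoct by (fastforce simp del: of_nat_add of_nat_mult)
    show "(\<lambda>e. (lo e, hi e \<circ> srt m (lo e))) ` odd_maps m (l * (2 * k + 1) + k) \<subseteq>
        odd_maps m k \<times> odd_maps m l"
      using odd by auto
  qed
qed

subsection \<open>Sorting permutations of modified maps\<close>

text \<open>The generator reverses the order of labels only inside the pairs \<open>p, p + 1\<close>
  and \<open>- p - 1, - p\<close>. There the values of \<open>g\<close> differ, so no tie is broken
  differently.\<close>

lemma srt_swap:
  assumes g: "g \<in> odd_maps m k" and p: "1 \<le> p" "p < m" and ne: "g (int p) \<noteq> g (int p + 1)"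
  shows "srt m (g \<circ> coxeter_gen p) = coxeter_gen p \<circ> srt m g"
proof (rule srt_eqI)
  show "coxeter_gen p \<circ> srt m g \<in> hyperoct m"
    using p srt_hyperoct[OF g] by (intro hyperoct_comp coxeter_gen_hyperoct)
  show "sorts m (g \<circ> coxeter_gen p) (coxeter_gen p \<circ> srt m g)"
  proof (rule sorts_comp[OF srt_hyperoct[OF g] srt_sorts[OF g]])
    fix v w assume lt: "lexlt g v w"
    have ne': "g (- int p) \<noteq> g (- int p - 1)"
      using ne odd_mapsD(1)[OF g, of "int p"] odd_mapsD(1)[OF g, of "int p + 1"] by simp
    have "coxeter_gen p v < coxeter_gen p w" if "g v = g w" "v < w"
    proof -
      have "\<not> (v = int p \<and> w = int p + 1)" "\<not> (v = - int p - 1 \<and> w = - int p)"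
        using that ne ne' by auto
      thus ?thesis
        using that(2) p(1) unfolding coxeter_gen_def by (simp add: transpose_def) linarith
    qed
    thus "lexlt (g \<circ> coxeter_gen p) (coxeter_gen p v) (coxeter_gen p w)"
      using lt by (auto simp: lexlt_def coxeter_gen_invol)
  qed
qed

lemma odd_maps_swap:
  assumes "g \<in> odd_maps m k" "p < m" shows "g \<circ> coxeter_gen p \<in> odd_maps m k"
  using assms hyperoct_odd[OF coxeter_gen_hyperoct] hyperoct_outside[OF coxeter_gen_hyperoct]
  by (simp add: odd_maps_def)

text \<open>Among equal values the label \<open>m\<close> comes last and \<open>- m\<close> comes
  first. For \<open>- m\<close> to take over the place of \<open>m\<close> behind all labels of
  value \<open>a = g m\<close>, it needs the value \<open>a + 1\<close>, so \<open>m\<close> needs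
  \<open>- 1 - a\<close>. Only for \<open>a = k\<close> does this leave the range
  \<open>{-k..k}\<close>.\<close>

definition flip_last :: "nat \<Rightarrow> (int \<Rightarrow> int) \<Rightarrow> int \<Rightarrow> int" where
  "flip_last m g v = (if v = int m then - 1 - g (int m) else if v = - int m then 1 + g (int m) else g v)"

lemma flip_last_odd_maps:
  assumes g: "g \<in> odd_maps m k" and m: "1 \<le> m" and ne: "g (int m) \<noteq> int k"
  shows "flip_last m g \<in> odd_maps m k" "flip_last m g (int m) \<noteq> int k"
    "flip_last m (flip_last m g) = g"
proof -
  have "\<bar>- 1 - g (int m)\<bar> \<le> int k" "\<bar>1 + g (int m)\<bar> \<le> int k"
    using odd_mapsD(3)[OF g, of "int m"] ne by auto
  thus "flip_last m g \<in> odd_maps m k"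
    using g m by (auto simp: odd_maps_def flip_last_def)
  show "flip_last m g (int m) \<noteq> int k"
    using odd_mapsD(3)[OF g, of "int m"] by (auto simp: flip_last_def)
  show "flip_last m (flip_last m g) = g"
    using m odd_mapsD(1)[OF g, of "int m"] by (auto simp: flip_last_def fun_eq_iff)
qed

lemma srt_flip_last:
  assumes g: "g \<in> odd_maps m k" and m: "1 \<le> m"
  shows "srt m (flip_last m g) = neg_at m \<circ> srt m g"
proof (rule srt_eqI)
  show "neg_at m \<circ> srt m g \<in> hyperoct m"
    using srt_hyperoct[OF g] by (intro hyperoct_comp neg_at_hyperoct) auto
  show "sorts m (flip_last m g) (neg_at m \<circ> srt m g)"
  proof (rule sorts_comp[OF srt_hyperoct[OF g] srt_sorts[OF g]])
    fix v w assume b: "\<bar>v\<bar> \<le> int m" "\<bar>w\<bar> \<le> int m" and lt: "lexlt g v w"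
    have key: "flip_last m g (neg_at m u) = (if u = int m then 1 + g (int m)
        else if u = - int m then - 1 - g (int m) else g u)" for u
      using m by (auto simp: flip_last_def neg_at_def)
    have neg: "g (- int m) = - g (int m)"
      by (rule odd_mapsD(1)[OF g])
    consider "v = int m" | "v = - int m" | "\<bar>v\<bar> < int m"
      using b by linarith
    thus "lexlt (flip_last m g) (neg_at m v) (neg_at m w)"
    proof cases
      case 1
      have "w \<noteq> int m"
        using lt 1 lexlt_irrefl by auto
      hence "w = - int m \<or> \<bar>w\<bar> < int m"
        using b by linarith
      then show ?thesis
        using lt m 1 neg unfolding lexlt_def key by (elim disjE) (auto simp: neg_at_def)
    next
      case 2
      have "w \<noteq> - int m"
        using lt 2 lexlt_irrefl by auto
      hence "w = int m \<or> \<bar>w\<bar> < int m"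
        using b by linarith
      then show ?thesis
        using lt m 2 neg unfolding lexlt_def key by (elim disjE) (auto simp: neg_at_def)
    next
      case 3
      consider "w = int m" | "w = - int m" | "\<bar>w\<bar> < int m"
        using b by linarith
      then show ?thesis
        using lt m 3 neg unfolding lexlt_def key by cases (auto simp: neg_at_def)
    qed
  qed
qed

definition extend_max :: "nat \<Rightarrow> nat \<Rightarrow> (int \<Rightarrow> int) \<Rightarrow> int \<Rightarrow> int" where
  "extend_max m k g v =
     (if v = int m + 1 then int k else if v = - int m - 1 then - int k else g v)"

lemma extend_max_bij:
  "bij_betw (extend_max m k) (odd_maps m k) {g \<in> odd_maps (Suc m) k. g (int (Suc m)) = int k}"
proof (rule bij_betw_byWitness[of _ "\<lambda>g v. if \<bar>v\<bar> \<le> int m then g v else 0"])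
  show "\<forall>g\<in>odd_maps m k. (\<lambda>v. if \<bar>v\<bar> \<le> int m then extend_max m k g v else 0) = g"
    using odd_mapsD(2) by (force simp: extend_max_def)
  show "\<forall>g\<in>{g \<in> odd_maps (Suc m) k. g (int (Suc m)) = int k}.
      extend_max m k (\<lambda>v. if \<bar>v\<bar> \<le> int m then g v else 0) = g"
  proof (intro ballI ext)
    fix g v assume "g \<in> {g \<in> odd_maps (Suc m) k. g (int (Suc m)) = int k}"
    hence g: "g \<in> odd_maps (Suc m) k" "g (int m + 1) = int k"
      by (auto simp: add.commute)
    moreover have "g (- int m - 1) = - int k"
      using odd_mapsD(1)[OF g(1), of "int m + 1"] g(2) by simp
    ultimately show "extend_max m k (\<lambda>v. if \<bar>v\<bar> \<le> int m then g v else 0) v = g v"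
      using odd_mapsD(2)[OF g(1), of v] by (auto simp: extend_max_def)
  qed
  show "extend_max m k ` odd_maps m k \<subseteq> {g \<in> odd_maps (Suc m) k. g (int (Suc m)) = int k}"
  proof (intro image_subsetI)
    fix g assume g: "g \<in> odd_maps m k"
    have "extend_max m k g (- v) = - extend_max m k g v" for v
      using odd_mapsD(1)[OF g, of v] by (auto simp: extend_max_def)
    moreover have "extend_max m k g v = 0" if "\<bar>v\<bar> > int (Suc m)" for v
      using odd_mapsD(2)[OF g, of v] that by (auto simp: extend_max_def)
    moreover have "\<bar>extend_max m k g v\<bar> \<le> int k" for v
      using odd_mapsD(3)[OF g, of v] by (auto simp: extend_max_def)
    ultimately show "extend_max m k g \<in> {g \<in> odd_maps (Suc m) k. g (int (Suc m)) = int k}"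
      by (simp add: odd_maps_def) (simp add: extend_max_def)
  qed
  show "(\<lambda>g v. if \<bar>v\<bar> \<le> int m then g v else 0) `
      {g \<in> odd_maps (Suc m) k. g (int (Suc m)) = int k} \<subseteq> odd_maps m k"
    by (auto simp: odd_maps_def)
qed

text \<open>The new label has the maximal value and is the largest label, so it wins all ties and
  occupies the last place; its negative occupies the first.\<close>

lemma srt_extend_max:
  assumes g: "g \<in> odd_maps m k"
  shows "srt (Suc m) (extend_max m k g) = srt m g"
proof (rule srt_eqI)
  note \<pi> = srt_hyperoct[OF g]
  show "srt m g \<in> hyperoct (Suc m)"
    using \<pi> hyperoct_mono[of m "Suc m"] by auto
  have last: "srt m g (int m + 1) = int m + 1" "srt m g (- int m - 1) = - int m - 1"
    using hyperoct_outside[OF \<pi>] by auto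
  show "sorts (Suc m) (extend_max m k g) (srt m g)"
    unfolding sorts_def
  proof (intro allI impI)
    fix u v assume uv: "- int (Suc m) \<le> u \<and> u < v \<and> v \<le> int (Suc m)"
    have b: "\<bar>srt m g w\<bar> \<le> int m" "\<bar>g (srt m g w)\<bar> \<le> int k" if "\<bar>w\<bar> \<le> int m" for w
      using that by (simp_all add: hyperoct_abs_le[OF \<pi>] odd_mapsD(3)[OF g])
    consider "u = - int m - 1" "v = int m + 1" | "u = - int m - 1" "\<bar>v\<bar> \<le> int m"
      | "\<bar>u\<bar> \<le> int m" "v = int m + 1" | "\<bar>u\<bar> \<le> int m" "\<bar>v\<bar> \<le> int m"
      using uv by fastforce
    thus "lexlt (extend_max m k g) (srt m g u) (srt m g v)"
    proof cases
      case 1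
      then show ?thesis by (auto simp: lexlt_def last extend_max_def)
    next
      case 2
      then show ?thesis using b[OF 2(2)] by (auto simp: lexlt_def last extend_max_def)
    next
      case 3
      then show ?thesis using b[OF 3(1)] by (auto simp: lexlt_def last extend_max_def)
    next
      case 4
      have "lexlt g (srt m g u) (srt m g v)"
        using srt_sorts[OF g] 4 uv by (intro sortsD) auto
      then show ?thesis
        using b[OF 4(1)] b[OF 4(2)] by (auto simp: lexlt_def extend_max_def)
    qed
  qed
qed

section \<open>Pulling odd maps back along a merging of labels\<close>

definition collapse :: "nat \<Rightarrow> int \<Rightarrow> int" where
  "collapse p v = (if \<bar>v\<bar> \<le> int p then v else v - sgn v)"

lemma collapse_odd: "collapse p (- v) = - collapse p v"
  by (simp add: collapse_def)

lemma collapse_mono: "u \<le> v \<Longrightarrow> collapse p u \<le> collapse p v"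
  by (auto simp: collapse_def abs_if sgn_if split: if_splits)

lemma collapse_eq: "1 \<le> p \<Longrightarrow> u < v \<Longrightarrow> collapse p u = collapse p v \<Longrightarrow>
    u = int p \<and> v = int p + 1 \<or> u = - int p - 1 \<and> v = - int p"
  by (auto simp: collapse_def abs_if sgn_if split: if_splits)

lemma collapse_abs_le: "p \<le> m \<Longrightarrow> \<bar>v\<bar> \<le> int (Suc m) \<Longrightarrow> \<bar>collapse p v\<bar> \<le> int m"
  by (auto simp: collapse_def abs_if sgn_if split: if_splits)

lemma collapse_bij:
  assumes p: "1 \<le> p" "p \<le> m"
  shows "bij_betw (\<lambda>g. g \<circ> collapse p) (odd_maps m k)
    {g \<in> odd_maps (Suc m) k. g (int p) = g (int p + 1)}"
proof (rule bij_betw_byWitness)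
  \<comment> \<open>The section of \<open>collapse p\<close> that avoids \<open>p + 1\<close> and
    \<open>- p - 1\<close>.\<close>
  define ins where "ins v = (if \<bar>v\<bar> \<le> int p then v else v + sgn v)" for v
  have "collapse p (ins v) = v" for v
    by (auto simp: collapse_def ins_def abs_if sgn_if)
  thus "\<forall>g\<in>odd_maps m k. (g \<circ> collapse p) \<circ> ins = g"
    by (simp add: fun_eq_iff)
  show "\<forall>g\<in>{g \<in> odd_maps (Suc m) k. g (int p) = g (int p + 1)}. (g \<circ> ins) \<circ> collapse p = g"
  proof (intro ballI ext)
    fix g v assume "g \<in> {g \<in> odd_maps (Suc m) k. g (int p) = g (int p + 1)}"
    hence g: "g \<in> odd_maps (Suc m) k" "g (int p) = g (int p + 1)"
      by auto
    have g': "g (- int p) = g (- int p - 1)"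
      using odd_mapsD(1)[OF g(1), of "int p"] odd_mapsD(1)[OF g(1), of "int p + 1"] g(2) by simp
    consider "v = int p + 1" | "v = - int p - 1" | "\<bar>v\<bar> \<noteq> int p + 1"
      by linarith
    thus "((g \<circ> ins) \<circ> collapse p) v = g v"
      by cases (use p g g' in \<open>auto simp: collapse_def ins_def abs_if sgn_if\<close>)
  qed
  show "(\<lambda>g. g \<circ> collapse p) ` odd_maps m k \<subseteq> {g \<in> odd_maps (Suc m) k. g (int p) = g (int p + 1)}"
  proof (intro image_subsetI)
    fix g assume g: "g \<in> odd_maps m k"
    have "g (collapse p v) = 0" if "\<bar>v\<bar> > int (Suc m)" for v
      by (rule odd_mapsD(2)[OF g]) (use that p in \<open>auto simp: collapse_def abs_if sgn_if\<close>)
    moreover have "collapse p (int p) = collapse p (int p + 1)"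
      by (simp add: collapse_def)
    ultimately show "g \<circ> collapse p \<in> {g \<in> odd_maps (Suc m) k. g (int p) = g (int p + 1)}"
      using g by (simp add: odd_maps_def collapse_odd)
  qed
  show "(\<lambda>g. g \<circ> ins) ` {g \<in> odd_maps (Suc m) k. g (int p) = g (int p + 1)} \<subseteq> odd_maps m k"
  proof (intro image_subsetI)
    fix g assume "g \<in> {g \<in> odd_maps (Suc m) k. g (int p) = g (int p + 1)}"
    hence g: "g \<in> odd_maps (Suc m) k"
      by auto
    have "g (ins v) = 0" if "\<bar>v\<bar> > int m" for v
      by (rule odd_mapsD(2)[OF g]) (use that p in \<open>auto simp: ins_def abs_if sgn_if\<close>)
    moreover have "ins (- v) = - ins v" for v
      by (simp add: ins_def)
    ultimately show "g \<circ> ins \<in> odd_maps m k"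
      using g by (simp add: odd_maps_def)
  qed
qed

text \<open>Here \<pi> lifts \<pi>' along the merging of places \<open>q, q + 1\<close> and of
  labels \<open>p, p + 1\<close>. Places with different images are compared through \<pi>'. Places
  with the same image carry labels of equal value, and there \<open>lt\<close> and oddness supply
  the order.\<close>

lemma sorts_collapse:
  assumes g: "g \<in> odd_maps m k" and s: "sorts m g \<pi>'" and \<pi>: "\<pi> \<in> hyperoct (Suc m)"
    and q: "1 \<le> q" "q \<le> m"
    and comm: "\<And>v. \<bar>v\<bar> \<le> int (Suc m) \<Longrightarrow> collapse p (\<pi> v) = \<pi>' (collapse q v)"
    and lt: "\<pi> (int q) < \<pi> (int q + 1)"
  shows "sorts (Suc m) (g \<circ> collapse p) \<pi>"
  unfolding sorts_def
proof (intro allI impI)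
  fix u v assume uv: "- int (Suc m) \<le> u \<and> u < v \<and> v \<le> int (Suc m)"
  hence b: "\<bar>u\<bar> \<le> int (Suc m)" "\<bar>v\<bar> \<le> int (Suc m)"
    by auto
  show "lexlt (g \<circ> collapse p) (\<pi> u) (\<pi> v)"
  proof (cases "collapse q u = collapse q v")
    case True
    hence "\<pi> u < \<pi> v"
      using collapse_eq[OF q(1) _ True] uv lt hyperoct_odd[OF \<pi>, of "int q"]
        hyperoct_odd[OF \<pi>, of "int q + 1"] by auto
    moreover have "collapse p (\<pi> u) = collapse p (\<pi> v)"
      by (simp only: comm b True)
    ultimately show ?thesis
      by (simp add: lexlt_def)
  next
    case False
    hence "collapse q u < collapse q v"
      using collapse_mono[of u v q] uv by simp
    hence "lexlt g (\<pi>' (collapse q u)) (\<pi>' (collapse q v))"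
      using s collapse_abs_le[OF q(2) b(1)] collapse_abs_le[OF q(2) b(2)] by (intro sortsD)
    moreover have "\<pi> u < \<pi> v" if "\<pi>' (collapse q u) < \<pi>' (collapse q v)"
      using that collapse_mono[of "\<pi> v" "\<pi> u" p] by (fastforce simp flip: comm[OF b(1)] comm[OF b(2)])
    ultimately show ?thesis
      by (auto simp: lexlt_def comm[OF b(1)] comm[OF b(2)])
  qed
qed

lemma inv_cyc:
  assumes "1 \<le> q" "q \<le> m"
  shows "inv (cyc q m) v = (if \<bar>v\<bar> = int q then sgn v * int m
     else if int q < \<bar>v\<bar> \<and> \<bar>v\<bar> \<le> int m then v - sgn v else v)" (is "_ = ?w")
proof -
  have "cyc q m ?w = v"
    using assms by (auto simp: cyc_def abs_if sgn_if)
  thus ?thesis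
    using hyperoct_inv_simps(1)[OF cyc_hyperoct[OF assms], of ?w] by metis
qed

text \<open>Doubling the label \<open>p\<close> doubles the place \<open>q\<close> where it stands
  up to sign: the two copies are tied, hence adjacent and in increasing order. The exponent
  \<open>p + q\<close> arises from moving a new last element to label \<open>p\<close> and to place
  \<open>q\<close>.\<close>

lemma srt_collapse:
  assumes g: "g \<in> odd_maps m k" and p: "1 \<le> p" "p \<le> m"
    and q_def: "q = nat \<bar>inv (srt m g) (int p)\<bar>"
  shows "\<bar>v\<bar> \<le> int (Suc m) \<Longrightarrow>
      collapse p (srt (Suc m) (g \<circ> collapse p) v) = srt m g (collapse q v)"
    and "hyperoct_sgn (Suc m) (srt (Suc m) (g \<circ> collapse p)) =
      (- 1) ^ (p + q) * hyperoct_sgn m (srt m g)"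
proof -
  define M where "M = Suc m"
  define \<pi>' where "\<pi>' = srt m g"
  have \<pi>': "\<pi>' \<in> hyperoct m" "\<pi>' \<in> hyperoct M"
    using srt_hyperoct[OF g] hyperoct_mono[of m M] by (auto simp: \<pi>'_def M_def)
  have last: "\<pi>' (int M) = int M" "\<pi>' (- int M) = - int M"
    using hyperoct_outside[OF \<pi>'(1)] by (auto simp: M_def)
  have "\<bar>inv \<pi>' (int p)\<bar> \<le> int m" "inv \<pi>' (int p) \<noteq> 0"
    using hyperoct_abs_le[OF hyperoct_inv[OF \<pi>'(1)], of "int p"]
      hyperoct_eq_zero[OF hyperoct_inv[OF \<pi>'(1)], of "int p"] p by auto
  hence q: "1 \<le> q" "q \<le> m" "q \<le> M"
    by (auto simp: q_def \<pi>'_def M_def)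
  have pM: "1 \<le> p" "p \<le> M" "1 \<le> Suc p" "Suc p \<le> M" "1 \<le> M"
    using p by (auto simp: M_def)
  have \<pi>'q: "\<pi>' (int q) = int p \<or> \<pi>' (int q) = - int p"
  proof (cases "inv \<pi>' (int p) \<ge> 0")
    case True
    hence "int q = inv \<pi>' (int p)"
      by (simp add: q_def \<pi>'_def)
    thus ?thesis
      by (simp add: hyperoct_inv_simps[OF \<pi>'(1)])
  next
    case False
    hence "int q = - inv \<pi>' (int p)"
      by (simp add: q_def \<pi>'_def)
    thus ?thesis
      by (simp add: hyperoct_inv_simps[OF \<pi>'(1)] hyperoct_odd[OF \<pi>'(1)])
  qed
  define \<rho> where "\<rho> = (if \<pi>' (int q) = int p then cyc p M else cyc (Suc p) M \<circ> neg_at M)"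
  have \<rho>: "\<rho> \<in> hyperoct M" "hyperoct_sgn M \<rho> = (- 1) ^ (M + p)"
    using pM by (auto simp: \<rho>_def cyc_hyperoct neg_at_hyperoct hyperoct_comp hyperoct_sgn_comp
        hyperoct_sgn_cyc hyperoct_sgn_neg_at)
  define \<pi> where "\<pi> = \<rho> \<circ> \<pi>' \<circ> inv (cyc q M)"
  have cq: "cyc q M \<in> hyperoct M"
    by (rule cyc_hyperoct[OF q(1,3)])
  have \<pi>: "\<pi> \<in> hyperoct M"
    unfolding \<pi>_def by (intro hyperoct_comp \<rho>(1) \<pi>'(2) hyperoct_inv cq)
  have \<rho>_low: "collapse p (\<rho> x) = x" if "\<bar>x\<bar> \<le> int m" for x
  proof -
    have "neg_at M x = x"
      using that by (simp add: neg_at_def M_def)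
    moreover have "collapse p (cyc p M x) = x" "collapse p (cyc (Suc p) M x) = x"
      using that p by (auto simp: collapse_def cyc_def M_def abs_if sgn_if)
    ultimately show ?thesis
      by (simp add: \<rho>_def)
  qed
  have comm: "collapse p (\<pi> v) = \<pi>' (collapse q v)" if "\<bar>v\<bar> \<le> int M" for v
  proof -
    consider "\<bar>v\<bar> \<noteq> int q" | "v = int q" | "v = - int q"
      by linarith
    thus ?thesis
    proof cases
      case 1
      hence "inv (cyc q M) v = collapse q v"
        using that by (auto simp: inv_cyc[OF q(1,3)] collapse_def)
      moreover have "\<bar>\<pi>' (collapse q v)\<bar> \<le> int m"
        using collapse_abs_le[OF q(2), of v] that by (simp add: hyperoct_abs_le[OF \<pi>'(1)] M_def)
      ultimately show ?thesis
        by (simp add: \<pi>_def \<rho>_low)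
    next
      case 2
      thus ?thesis
        using q pM \<pi>'q by (auto simp: \<pi>_def inv_cyc last \<rho>_def cyc_def neg_at_def collapse_def)
    next
      case 3
      thus ?thesis
        using q pM \<pi>'q
        by (auto simp: \<pi>_def inv_cyc last \<rho>_def cyc_def neg_at_def collapse_def hyperoct_odd[OF \<pi>'(1)])
    qed
  qed
  have "\<pi> (int q) < \<pi> (int q + 1)"
  proof -
    have "inv (cyc q M) (int q) = int M" "inv (cyc q M) (int q + 1) = int q"
      unfolding inv_cyc[OF q(1,3)] using q by (auto simp: M_def)
    hence "\<pi> (int q) = \<rho> (int M)" "\<pi> (int q + 1) = \<rho> (\<pi>' (int q))"
      by (simp_all add: \<pi>_def last)
    moreover have "\<rho> (int M) < \<rho> (\<pi>' (int q))"
      using \<pi>'q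
    proof
      assume "\<pi>' (int q) = int p"
      thus ?thesis
        using p by (simp add: \<rho>_def cyc_def M_def)
    next
      assume eq: "\<pi>' (int q) = - int p"
      hence "\<rho> = cyc (Suc p) M \<circ> neg_at M"
        using p by (simp add: \<rho>_def)
      thus ?thesis
        using p by (simp add: eq cyc_def neg_at_def M_def)
    qed
    ultimately show ?thesis
      by simp
  qed
  hence "sorts M (g \<circ> collapse p) \<pi>"
    unfolding M_def using sorts_collapse[OF g srt_sorts[OF g] \<pi>[unfolded M_def] q(1,2)] comm
    by (simp add: M_def \<pi>'_def)
  hence srt: "srt (Suc m) (g \<circ> collapse p) = \<pi>"
    using srt_eqI[OF \<pi>] by (simp add: M_def)
  show "\<bar>v\<bar> \<le> int (Suc m) \<Longrightarrow>
      collapse p (srt (Suc m) (g \<circ> collapse p) v) = srt m g (collapse q v)"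
    using comm by (simp add: srt M_def \<pi>'_def)
  have "hyperoct_sgn M \<pi> = (- 1) ^ (M + p) * hyperoct_sgn M \<pi>' * (- 1) ^ (M + q)"
    unfolding \<pi>_def using \<rho> \<pi>'(2) cq hyperoct_sgn_cyc[OF q(1,3)]
    by (simp only: hyperoct_sgn_comp hyperoct_comp hyperoct_inv hyperoct_sgn_inv)
  also have "\<dots> = (- 1) ^ (p + q) * hyperoct_sgn M \<pi>'"
    by (simp add: power_add)
  finally show "hyperoct_sgn (Suc m) (srt (Suc m) (g \<circ> collapse p)) =
      (- 1) ^ (p + q) * hyperoct_sgn m (srt m g)"
    using hyperoct_sgn_Suc[OF \<pi>'(1)] by (simp add: srt M_def \<pi>'_def)
qed

section \<open>Simplices as odd block maps\<close>

text \<open>An ordered partition \<open>(P\<^sub>1|\<dots>|P\<^sub>m\<^sub>+\<^sub>1)\<close> is encoded by the odd map with value \<open>k\<close> on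
  \<open>P\<^sub>k\<close> for \<open>k \<le> m\<close>, and 0 where neither \<open>x\<close> nor \<open>-x\<close> lies in these blocks.  Both the faces
  and the group action then become compositions with maps of the integers.\<close>

definition block_map :: "nat \<Rightarrow> nat \<Rightarrow> (int \<Rightarrow> int) \<Rightarrow> bool" where
  "block_map n m f \<longleftrightarrow> (\<forall>x. f (- x) = - f x) \<and> (\<forall>x. \<bar>f x\<bar> \<le> int m) \<and>
     {1..int m} \<subseteq> f ` signed_verts n"

text \<open>For a block map the last block consists of the zeros of \<open>f\<close> together with
  the negatives of all earlier blocks.\<close>

definition block_part :: "nat \<Rightarrow> nat \<Rightarrow> (int \<Rightarrow> int) \<Rightarrow> int set list" where
  "block_part n m f =
     map (\<lambda>k. {x \<in> signed_verts n. f x = int k}) [1..<Suc m] @ [{x \<in> signed_verts n. f x \<le> 0}]"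

definition on_arrangement :: "signed_graph \<Rightarrow> (int \<Rightarrow> int) \<Rightarrow> bool" where
  "on_arrangement G f \<longleftrightarrow> (\<exists>i j. {i, j} \<in> pos_edges G \<and> f i = f j) \<or>
     (\<exists>i j. {i, j} \<in> neg_edges G \<and> f i = - f j) \<or> (\<exists>i. {i} \<in># half_edges G \<and> f i = 0)"

lemma signed_verts_uminus: "- x \<in> signed_verts n \<longleftrightarrow> x \<in> signed_verts n"
  by (auto simp: signed_verts_def image_iff) (metis minus_minus)+

lemma length_block_part: "length (block_part n m f) = Suc m"
  by (simp add: block_part_def)

lemma nth_block_part:
  "k \<le> m \<Longrightarrow> block_part n m f ! k =
    (if k < m then {x \<in> signed_verts n. f x = int k + 1} else {x \<in> signed_verts n. f x \<le> 0})"
  by (auto simp: block_part_def nth_append add.commute simp del: upt_Suc)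

text \<open>A preimage may be negative in the last assumption: the signed vertex set is stable under
  negation, so an odd map takes the values \<open>v\<close> and \<open>- v\<close> together.\<close>

lemma block_map_comp:
  assumes "block_map n m f" "\<And>v. \<phi> (- v) = - \<phi> v" "\<And>v. \<bar>v\<bar> \<le> int m \<Longrightarrow> \<bar>\<phi> v\<bar> \<le> int l"
    "\<And>u. 1 \<le> u \<Longrightarrow> u \<le> int l \<Longrightarrow> \<exists>v. v \<noteq> 0 \<and> \<bar>v\<bar> \<le> int m \<and> \<phi> v = u"
  shows "block_map n l (\<phi> \<circ> f)"
proof -
  have "u \<in> (\<phi> \<circ> f) ` signed_verts n" if u: "1 \<le> u" "u \<le> int l" for u
  proof -
    obtain v where v: "v \<noteq> 0" "\<bar>v\<bar> \<le> int m" "\<phi> v = u"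
      using assms(4)[OF u] by blast
    hence "\<bar>v\<bar> \<in> {1..int m}"
      by auto
    then obtain x where x: "x \<in> signed_verts n" "f x = \<bar>v\<bar>"
      using assms(1) by (auto simp: block_map_def)
    show ?thesis
    proof (cases "v > 0")
      case True
      with x v show ?thesis by force
    next
      case False
      hence "f (- x) = v" "- x \<in> signed_verts n"
        using x assms(1) by (auto simp: block_map_def signed_verts_uminus)
      with v show ?thesis by force
    qed
  qed
  thus ?thesis
    using assms(1-3) by (auto simp: block_map_def)
qed

text \<open>The three incidences are equalities of values, of values up to sign, and with 0, all of
  which survive an odd map. Hence faces and group action stay inside the coloring complex.\<close>

lemma on_arrangement_comp:
  assumes "on_arrangement G f" "\<And>v. \<phi> (- v) = - \<phi> v" shows "on_arrangement G (\<phi> \<circ> f)"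
proof -
  have "\<phi> 0 = 0"
    using assms(2)[of 0] by simp
  with assms show ?thesis
    unfolding on_arrangement_def by fastforce
qed

lemma encode_chain_block_part:
  assumes m: "length Qs = m" "1 \<le> m" and f: "block_map n m f"
    and Qs: "\<And>k. k < m \<Longrightarrow> Qs ! k = {x \<in> signed_verts n. 1 \<le> f x \<and> f x \<le> int k + 1}"
  shows "encode_chain n Qs = block_part n m f"
proof (rule nth_equalityI)
  show "length (encode_chain n Qs) = length (block_part n m f)"
    using m by (simp add: encode_chain_def length_block_part)
  fix k assume "k < length (encode_chain n Qs)"
  hence k: "k \<le> m"
    using m by (simp add: encode_chain_def)
  have fm: "f x \<le> int m" for x
    using f by (auto simp: block_map_def abs_le_iff)
  have last: "last Qs = Qs ! (m - 1)" "hd Qs = Qs ! 0"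
    using m last_conv_nth[of Qs] hd_conv_nth[of Qs] by fastforce+
  consider "k = 0" | "1 \<le> k" "k < m" | "k = m" "1 \<le> m"
    using k m by linarith
  thus "encode_chain n Qs ! k = block_part n m f ! k"
  proof cases
    case 1
    then show ?thesis
      using m Qs[of 0] by (simp add: nth_block_part encode_chain_def last) force
  next
    case 2
    hence "encode_chain n Qs ! k = Qs ! k - Qs ! (k - 1)"
      using m by (cases k) (auto simp: encode_chain_def nth_append simp del: upt_Suc)
    also have "Qs ! (k - 1) = {x \<in> signed_verts n. 1 \<le> f x \<and> f x \<le> int k}"
      using 2 by (subst Qs) (auto simp: of_nat_diff)
    also have "Qs ! k - \<dots> = {x \<in> signed_verts n. f x = int k + 1}"
      unfolding Qs[OF 2(2)] by auto
    finally show ?thesis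
      using 2 by (simp add: nth_block_part)
  next
    case 3
    hence "encode_chain n Qs ! k = signed_verts n - Qs ! (m - 1)"
      using m by (cases k) (simp_all add: encode_chain_def nth_append last)
    also have "Qs ! (m - 1) = {x \<in> signed_verts n. 1 \<le> f x}"
      using m(2) fm by (subst Qs) (auto simp: of_nat_diff)
    also have "signed_verts n - \<dots> = {x \<in> signed_verts n. f x \<le> 0}"
      by auto
    finally show ?thesis
      using 3 by (simp add: nth_block_part)
  qed
qed

text \<open>The value at an element is the index, counted from 1, of the first set of the chain that
  contains it, extended oddly. Admissibility of the larger of two sets rules out a conflict between
  an element and its negative; nonemptiness and strict inclusions make every value occur.\<close>

lemma block_map_of_chain:
  assumes m: "length Qs = m" "1 \<le> m" and adm: "\<forall>Q\<in>set Qs. admissible n Q"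
    and sorted: "sorted_wrt (\<subset>) Qs"
  obtains f where "block_map n m f"
    "\<And>k. k < m \<Longrightarrow> Qs ! k = {x \<in> signed_verts n. 1 \<le> f x \<and> f x \<le> int k + 1}"
proof -
  have strict: "Qs ! k \<subset> Qs ! l" if "k < l" "l < m" for k l
    using sorted_wrt_nth_less[OF sorted] that m by simp
  hence mono: "Qs ! k \<subseteq> Qs ! l" if "k \<le> l" "l < m" for k l
    using that by (cases "k = l") (auto simp: psubset_eq)
  have admQ: "admissible n (Qs ! k)" if "k < m" for k
    using adm that m by simp
  define A where "A x k \<longleftrightarrow> k < m \<and> x \<in> Qs ! k" for x k
  define L where "L x = (LEAST k. A x k)" for x
  have L: "A x (L x)" "L x \<le> k" if "A x k" for x k
    using that unfolding L_def by (auto intro: LeastI Least_le)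
  have excl: "\<not> (A x k \<and> A (- x) l)" for x k l
  proof
    assume "A x k \<and> A (- x) l"
    hence "max k l < m" "x \<in> Qs ! (max k l)" "- x \<in> Qs ! (max k l)"
      using mono[of k "max k l"] mono[of l "max k l"] by (auto simp: A_def)
    with admQ[of "max k l"] show False
      by (auto simp: admissible_def)
  qed
  define f where "f x = (if \<exists>k. A x k then int (L x) + 1
    else if \<exists>k. A (- x) k then - int (L (- x)) - 1 else 0)" for x
  have odd: "f (- x) = - f x" for x
    using excl[of x] by (auto simp: f_def)
  have bound: "\<bar>f x\<bar> \<le> int m" for x
  proof -
    have "L y < m" if "A y k" for y k
      using L(1)[OF that] by (simp add: A_def)
    thus ?thesis
      by (fastforce simp: f_def)
  qed
  have char: "Qs ! k = {x \<in> signed_verts n. 1 \<le> f x \<and> f x \<le> int k + 1}" if k: "k < m" for k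
  proof (intro equalityI subsetI)
    fix x assume x: "x \<in> Qs ! k"
    hence "A x k"
      using k by (simp add: A_def)
    moreover have "x \<in> signed_verts n"
      using x admQ[OF k] by (auto simp: admissible_def)
    ultimately show "x \<in> {x \<in> signed_verts n. 1 \<le> f x \<and> f x \<le> int k + 1}"
      using L(2)[of x k] by (auto simp: f_def)
  next
    fix x assume x: "x \<in> {x \<in> signed_verts n. 1 \<le> f x \<and> f x \<le> int k + 1}"
    hence ex: "\<exists>l. A x l" and "L x \<le> k"
      by (auto simp: f_def split: if_splits)
    thus "x \<in> Qs ! k"
      using L(1)[of x] mono[of "L x" k] k by (auto simp: A_def)
  qed
  have "u \<in> f ` signed_verts n" if u: "1 \<le> u" "u \<le> int m" for u
  proof -
    define k where "k = nat (u - 1)"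
    have k: "k < m" "u = int k + 1"
      using u by (auto simp: k_def)
    have "\<exists>x\<in>Qs ! k. k = 0 \<or> x \<notin> Qs ! (k - 1)"
      using admQ[of k] strict[of "k - 1" k] k(1) by (cases "k = 0") (auto simp: admissible_def)
    then obtain x where x: "x \<in> Qs ! k" "k = 0 \<or> x \<notin> Qs ! (k - 1)"
      by blast
    hence "x \<in> signed_verts n" "f x = u"
      using char[OF k(1)] char[of "k - 1"] k by (auto simp: of_nat_diff)
    thus ?thesis
      by blast
  qed
  hence "block_map n m f"
    using odd bound by (auto simp: block_map_def)
  with char show thesis
    using that by blast
qed

lemma chain_of_block_map:
  assumes f: "block_map n m f"
    and Qs: "Qs = map (\<lambda>k. {x \<in> signed_verts n. 1 \<le> f x \<and> f x \<le> int k + 1}) [0..<m]"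
  shows "\<forall>Q\<in>set Qs. admissible n Q" "sorted_wrt (\<subset>) Qs"
proof -
  have surj: "\<exists>x\<in>signed_verts n. f x = u" if "1 \<le> u" "u \<le> int m" for u
    using f that by (force simp: block_map_def)
  show "\<forall>Q\<in>set Qs. admissible n Q"
  proof
    fix Q assume "Q \<in> set Qs"
    then obtain k where k: "k < m" "Q = {x \<in> signed_verts n. 1 \<le> f x \<and> f x \<le> int k + 1}"
      by (auto simp: Qs)
    have "Q \<noteq> {}"
      using surj[of 1] k by auto
    moreover have "f (- x) = - f x" for x
      using f by (simp add: block_map_def)
    ultimately show "admissible n Q"
      by (auto simp: admissible_def k(2))
  qed
  show "sorted_wrt (\<subset>) Qs"
    unfolding sorted_wrt_iff_nth_less
  proof (intro allI impI)
    fix i j assume ij: "i < j" "j < length Qs"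
    obtain x where "x \<in> signed_verts n" "f x = int j + 1"
      using surj[of "int j + 1"] ij by (auto simp: Qs)
    hence "x \<in> Qs ! j - Qs ! i"
      using ij by (simp add: Qs)
    moreover have "Qs ! i \<subseteq> Qs ! j"
      using ij by (auto simp: Qs)
    ultimately show "Qs ! i \<subset> Qs ! j"
      by blast
  qed
qed

text \<open>The barycenter of a simplex separates the blocks, so it lies on a hyperplane only if the
  whole simplex does.\<close>

lemma conv_subset_arrangement_iff:
  assumes G: "signed_graph_on n G" and m: "length Qs = m" "1 \<le> m" and f: "block_map n m f"
    and Qs: "\<And>k. k < m \<Longrightarrow> Qs ! k = {x \<in> signed_verts n. 1 \<le> f x \<and> f x \<le> int k + 1}"
  shows "conv_list (map (cube_vertex n) Qs) \<subseteq> \<Union> (arrangement n G) \<longleftrightarrow> on_arrangement G f"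
proof -
  have odd: "f (- x) = - f x" and fm: "\<bar>f x\<bar> \<le> int m" for x
    using f by (auto simp: block_map_def)
  have cv: "cube_vertex n (Qs ! k) i = (if \<bar>f i\<bar> \<le> int k + 1 then of_int (sgn (f i)) else 0)"
    if "k < m" "i \<in> verts n" for k i
  proof -
    have "i \<in> signed_verts n" "- i \<in> signed_verts n"
      using that(2) by (auto simp: signed_verts_def)
    thus ?thesis
      using that odd[of i] by (auto simp: cube_vertex_def Qs sgn_if)
  qed
  have edges: "{i, j} \<in> pos_edges G \<Longrightarrow> i \<in> verts n \<and> j \<in> verts n"
    "{i, j} \<in> neg_edges G \<Longrightarrow> i \<in> verts n \<and> j \<in> verts n"
    "{i} \<in># half_edges G \<Longrightarrow> i \<in> verts n" for i j
    using G by (auto simp: signed_graph_on_def)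
  have len: "length (map (cube_vertex n) Qs) = m"
    using m by simp
  define pt where "pt t = (\<lambda>i. \<Sum>k<m. t k * cube_vertex n (Qs ! k) i)" for t :: "nat \<Rightarrow> real"
  have conv: "conv_list (map (cube_vertex n) Qs) =
      {pt t | t. (\<forall>k<m. 0 \<le> t k) \<and> (\<Sum>k<m. t k) = 1}"
    unfolding conv_list_def len pt_def using m(1)
    by (intro Collect_cong ex_cong1 conj_cong refl arg_cong2[of _ _ _ _ "(=)"] ext sum.cong) auto
  show ?thesis
  proof
    assume sub: "conv_list (map (cube_vertex n) Qs) \<subseteq> \<Union> (arrangement n G)"
    define x where "x = pt (\<lambda>_. 1 / real m)"
    have "x \<in> conv_list (map (cube_vertex n) Qs)"
      unfolding conv x_def using m by (intro CollectI exI[of _ "\<lambda>_. 1 / real m"]) auto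
    with sub have "x \<in> \<Union> (arrangement n G)"
      by blast
    \<comment> \<open>If \<open>f i\<close> is nonzero, coordinate \<open>i\<close> is nonzero
      exactly at the \<open>m + 1 - |f i|\<close> vertices from index \<open>|f i| - 1\<close> on.
      At the barycenter it therefore determines \<open>f i\<close>, which turns equations between
      coordinates into equations between values of \<open>f\<close>.\<close>
    define val where "val u = sgn u * (int m + 1 - \<bar>u\<bar>)" for u
    have x: "x i = of_int (val (f i)) / real m" if i: "i \<in> verts n" for i
    proof -
      have "x i = (\<Sum>k<m. if \<bar>f i\<bar> \<le> int k + 1 then of_int (sgn (f i)) / real m else 0)"
        unfolding x_def pt_def by (intro sum.cong) (auto simp: cv i)
      also have "\<dots> = (\<Sum>k | k < m \<and> \<bar>f i\<bar> \<le> int k + 1. of_int (sgn (f i)) / real m)"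
        by (subst sum.inter_filter[symmetric]) auto
      also have "\<dots> = of_int (val (f i)) / real m"
      proof (cases "f i = 0")
        case False
        have "{k. k < m \<and> \<bar>f i\<bar> \<le> int k + 1} = {nat \<bar>f i\<bar> - 1..<m}"
          by auto
        moreover have "int (m - (nat \<bar>f i\<bar> - 1)) = int m + 1 - \<bar>f i\<bar>"
          using False fm[of i] by auto
        hence "real (m - (nat \<bar>f i\<bar> - 1)) = of_int (int m + 1 - \<bar>f i\<bar>)"
          by (metis of_int_of_nat_eq)
        ultimately show ?thesis
          by (simp add: val_def)
      qed (simp add: val_def)
      finally show ?thesis .
    qed
    have val_inj: "u = w" if "val u = val w" "\<bar>u\<bar> \<le> int m" "\<bar>w\<bar> \<le> int m" for u w
      using that by (auto simp: val_def sgn_if abs_if split: if_splits)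
    have val_uminus: "val (- u) = - val u" for u
      by (simp add: val_def)
    have val_0: "val 0 = 0"
      by (simp add: val_def)
    from \<open>x \<in> \<Union> (arrangement n G)\<close> consider
        (pos) i j where "{i, j} \<in> pos_edges G" "x i = x j"
      | (neg) i j where "{i, j} \<in> neg_edges G" "x i = - x j"
      | (half) i where "{i} \<in># half_edges G" "x i = 0"
      unfolding arrangement_def by blast
    thus "on_arrangement G f"
    proof cases
      case pos
      hence "val (f i) = val (f j)"
        using m edges(1)[OF pos(1)] by (simp add: x)
      with pos val_inj fm show ?thesis
        unfolding on_arrangement_def by blast
    next
      case neg
      hence "real_of_int (val (f i)) = - real_of_int (val (f j))"
        using m edges(2)[OF neg(1)] by (simp add: x field_simps)
      hence "val (f i) = val (- f j)"
        unfolding val_uminus by (metis of_int_eq_iff of_int_minus)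
      hence "f i = - f j"
        by (rule val_inj) (simp_all add: fm)
      with neg show ?thesis
        unfolding on_arrangement_def by blast
    next
      case half
      hence "val (f i) = val 0"
        using m edges(3)[OF half(1)] by (simp add: x val_0)
      hence "f i = 0"
        by (rule val_inj) (simp_all add: fm)
      with half show ?thesis
        unfolding on_arrangement_def by blast
    qed
  next
    \<comment> \<open>Conversely, an incidence of \<open>f\<close> gives the same linear equation at
      every vertex, and convex combinations inherit it.\<close>
    assume hit: "on_arrangement G f"
    have eu: "pt t \<in> euclid n" for t
      by (auto simp: euclid_def pt_def cube_vertex_def)
    show "conv_list (map (cube_vertex n) Qs) \<subseteq> \<Union> (arrangement n G)"
    proof
      fix x assume "x \<in> conv_list (map (cube_vertex n) Qs)"
      then obtain t where t: "x = pt t"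
        by (auto simp: conv)
      from hit consider
          (pos) i j where "{i, j} \<in> pos_edges G" "f i = f j"
        | (neg) i j where "{i, j} \<in> neg_edges G" "f i = - f j"
        | (half) i where "{i} \<in># half_edges G" "f i = 0"
        unfolding on_arrangement_def by blast
      thus "x \<in> \<Union> (arrangement n G)"
      proof cases
        case pos
        hence "pt t i = pt t j"
          unfolding pt_def using edges(1)[OF pos(1)] by (intro sum.cong refl) (simp add: cv)
        hence "x \<in> {x \<in> euclid n. x i = x j}"
          using eu[of t] by (simp add: t)
        moreover have "{x \<in> euclid n. x i = x j} \<in> arrangement n G"
          unfolding arrangement_def using pos(1) by blast
        ultimately show ?thesis
          by blast
      next
        case neg
        hence "pt t i = - pt t j"
          unfolding pt_def sum_negf[symmetric] using edges(2)[OF neg(1)]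
          by (intro sum.cong refl) (simp add: cv)
        hence "x \<in> {x \<in> euclid n. x i = - x j}"
          using eu[of t] by (simp add: t)
        moreover have "{x \<in> euclid n. x i = - x j} \<in> arrangement n G"
          unfolding arrangement_def using neg(1) by blast
        ultimately show ?thesis
          by blast
      next
        case half
        hence "pt t i = 0"
          unfolding pt_def using edges(3)[OF half(1)] by (intro sum.neutral ballI) (simp add: cv)
        hence "x \<in> {x \<in> euclid n. x i = 0}"
          using eu[of t] by (simp add: t)
        moreover have "{x \<in> euclid n. x i = 0} \<in> arrangement n G"
          unfolding arrangement_def using half(1) by blast
        ultimately show ?thesis
          by blast
      qed
    qed
  qed
qed

text \<open>The exception at \<open>m = 0\<close> accounts for the one-block partition, which spans
  degree -1 for every graph.\<close>

definition block_maps :: "nat \<Rightarrow> signed_graph \<Rightarrow> nat \<Rightarrow> (int \<Rightarrow> int) set" where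
  "block_maps n G m = {f. block_map n m f \<and> (m = 0 \<or> on_arrangement G f)}"

lemma simplices_eq:
  assumes G: "signed_graph_on n G"
  shows "simplices n G (int m - 1) = block_part n m ` block_maps n G m"
proof (cases "m = 0")
  case True
  have "block_part n 0 f = [signed_verts n]" if "block_map n 0 f" for f
    using that by (simp add: block_part_def block_map_def)
  moreover have "block_map n 0 (\<lambda>_. 0)"
    by (simp add: block_map_def)
  ultimately show ?thesis
    using True by (force simp: simplices_def block_maps_def)
next
  case False
  hence m: "1 \<le> m" by simp
  show ?thesis
  proof (intro equalityI subsetI)
    fix P assume "P \<in> simplices n G (int m - 1)"
    then obtain Qs where Qs: "P = encode_chain n Qs" "length Qs = m" "\<forall>Q\<in>set Qs. admissible n Q"
      "sorted_wrt (\<subset>) Qs" "conv_list (map (cube_vertex n) Qs) \<subseteq> \<Union> (arrangement n G)"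
      using m by (auto simp: simplices_def)
    from block_map_of_chain[OF Qs(2) m Qs(3,4)] obtain f where f: "block_map n m f"
      "\<And>k. k < m \<Longrightarrow> Qs ! k = {x \<in> signed_verts n. 1 \<le> f x \<and> f x \<le> int k + 1}"
      by blast
    have "on_arrangement G f"
      using conv_subset_arrangement_iff[OF G Qs(2) m f] Qs(5) by blast
    moreover have "P = block_part n m f"
      using encode_chain_block_part[OF Qs(2) m f] Qs(1) by simp
    ultimately show "P \<in> block_part n m ` block_maps n G m"
      using f(1) by (auto simp: block_maps_def)
  next
    fix P assume "P \<in> block_part n m ` block_maps n G m"
    then obtain f where f: "block_map n m f" "on_arrangement G f" "P = block_part n m f"
      using False by (auto simp: block_maps_def)
    define Qs where "Qs = map (\<lambda>k. {x \<in> signed_verts n. 1 \<le> f x \<and> f x \<le> int k + 1}) [0..<m]"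
    have Qs: "length Qs = m"
      "\<And>k. k < m \<Longrightarrow> Qs ! k = {x \<in> signed_verts n. 1 \<le> f x \<and> f x \<le> int k + 1}"
      by (auto simp: Qs_def)
    have "P = encode_chain n Qs"
      using encode_chain_block_part[OF Qs(1) m f(1) Qs(2)] f(3) by simp
    moreover have "conv_list (map (cube_vertex n) Qs) \<subseteq> \<Union> (arrangement n G)"
      using conv_subset_arrangement_iff[OF G Qs(1) m f(1) Qs(2)] f(2) by blast
    ultimately show "P \<in> simplices n G (int m - 1)"
      using chain_of_block_map[OF f(1) Qs_def] m Qs(1) unfolding simplices_def by auto
  qed
qed

lemma signed_block_block_part:
  assumes "block_map n m f" "u \<noteq> 0" "\<bar>u\<bar> \<le> int m"
  shows "signed_block (block_part n m f) u = {x \<in> signed_verts n. f x = u}"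
proof (cases "u > 0")
  case True
  hence "nat u - 1 < m" "int (nat u - 1) + 1 = u"
    using assms by auto
  thus ?thesis
    using True by (simp add: signed_block_def nth_block_part)
next
  case False
  hence "nat (- u) - 1 < m" "int (nat (- u) - 1) + 1 = - u"
    using assms by auto
  hence "signed_block (block_part n m f) u = uminus ` {x \<in> signed_verts n. f x = - u}"
    using False by (simp add: signed_block_def nth_block_part)
  also have "\<dots> = {x \<in> signed_verts n. f x = u}"
  proof (intro equalityI subsetI)
    fix x assume "x \<in> {x \<in> signed_verts n. f x = u}"
    hence "- x \<in> {x \<in> signed_verts n. f x = - u}"
      using assms(1) by (auto simp: block_map_def signed_verts_uminus)
    thus "x \<in> uminus ` {x \<in> signed_verts n. f x = - u}"
      by (metis imageI minus_minus)
  qed (use assms(1) in \<open>auto simp: block_map_def signed_verts_uminus\<close>)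
  finally show ?thesis .
qed

text \<open>The signed block of index \<open>inv \<pi> k\<close> is the fibre of \<open>f\<close>
  over \<open>inv \<pi> k\<close>, that is, the fibre of \<open>\<pi> \<circ> f\<close> over
  \<open>k\<close>. So the action is composition from the left.\<close>

lemma act_simplex_block_part:
  assumes f: "block_map n m f" and \<pi>: "\<pi> \<in> hyperoct m"
  shows "act_simplex n m \<pi> (block_part n m f) = block_part n m (\<pi> \<circ> f)"
proof -
  define Bs where "Bs = map (\<lambda>k. signed_block (block_part n m f) (inv \<pi> k)) [1..int m]"
  have "[1..int m] = map int [1..<Suc m]"
    by (rule nth_equalityI) (auto simp del: upt_Suc)
  hence Bs: "Bs = map (\<lambda>k. {x \<in> signed_verts n. \<pi> (f x) = int k}) [1..<Suc m]"
    unfolding Bs_def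
  proof (simp only: map_map, intro map_cong refl)
    fix k assume "k \<in> set [1..<Suc m]"
    hence "inv \<pi> (int k) \<noteq> 0" "\<bar>inv \<pi> (int k)\<bar> \<le> int m"
      using hyperoct_eq_zero[OF hyperoct_inv[OF \<pi>]] hyperoct_abs_le[OF hyperoct_inv[OF \<pi>]] by auto
    moreover have "f x = inv \<pi> (int k) \<longleftrightarrow> \<pi> (f x) = int k" for x
      using hyperoct_inv_simps[OF \<pi>] by metis
    ultimately show "((\<lambda>k. signed_block (block_part n m f) (inv \<pi> k)) \<circ> int) k =
        {x \<in> signed_verts n. \<pi> (f x) = int k}"
      using signed_block_block_part[OF f] by simp
  qed
  have le: "\<pi> (f x) \<le> int m" for x
    using hyperoct_abs_le[OF \<pi>, of "f x"] f by (auto simp: block_map_def)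
  have "signed_verts n - \<Union> (set Bs) = {x \<in> signed_verts n. \<pi> (f x) \<le> 0}"
  proof (intro equalityI subsetI)
    fix x assume x: "x \<in> signed_verts n - \<Union> (set Bs)"
    have "\<pi> (f x) \<noteq> int k" if "1 \<le> k" "k \<le> m" for k
      using x that by (auto simp: Bs simp del: upt_Suc)
    from this[of "nat (\<pi> (f x))"] le[of x] have "\<pi> (f x) \<le> 0"
      by linarith
    thus "x \<in> {x \<in> signed_verts n. \<pi> (f x) \<le> 0}"
      using x by simp
  qed (auto simp: Bs simp del: upt_Suc)
  thus ?thesis
    unfolding act_simplex_def Let_def Bs_def[symmetric] by (simp add: block_part_def Bs)
qed

section \<open>Faces as compositions with odd maps\<close>

definition cut :: "nat \<Rightarrow> int \<Rightarrow> int" where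
  "cut m v = (if \<bar>v\<bar> \<le> int m then v else 0)"

text \<open>In the last face the block \<open>m + 1\<close> is absorbed by the final block, so
  \<open>m + 1\<close> and \<open>- m - 1\<close> both go to 0.\<close>

definition face :: "nat \<Rightarrow> nat \<Rightarrow> int \<Rightarrow> int" where
  "face m p = (if p \<le> m then collapse p else cut m)"

lemma face_odd: "face m p (- v) = - face m p v"
  by (simp add: face_def collapse_odd cut_def)

lemma merge_blocks_block_part:
  assumes f: "block_map n (Suc m) f" and p: "1 \<le> p" "p \<le> Suc m"
  shows "merge_blocks p (block_part n (Suc m) f) = block_part n m (face m p \<circ> f)"
proof (rule nth_equalityI)
  let ?P = "block_part n (Suc m) f"
  show len: "length (merge_blocks p ?P) = length (block_part n m (face m p \<circ> f))"
    using p by (simp add: merge_blocks_def length_block_part)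
  fix k assume "k < length (merge_blocks p ?P)"
  hence k: "k \<le> m"
    by (simp add: len length_block_part)
  have fm: "\<bar>f x\<bar> \<le> int m + 1" for x
    using f by (auto simp: block_map_def add.commute)
  have "merge_blocks p ?P ! k =
      (if k < p - 1 then ?P ! k else if k = p - 1 then ?P ! (p - 1) \<union> ?P ! p else ?P ! (k + 1))"
    using p k by (auto simp: merge_blocks_def nth_append length_block_part nth_Cons'
        intro!: arg_cong[of _ _ "nth _"])
  also have "\<dots> = block_part n m (face m p \<circ> f) ! k"
  proof (cases "p \<le> m")
    case True
    consider "k < p - 1" | "k = p - 1" | "p - 1 < k" "k < m" | "p - 1 < k" "k = m"
      using k by linarith
    thus ?thesis
    proof cases
      case 1
      then show ?thesis
        using True p by (auto simp: nth_block_part face_def collapse_def abs_if sgn_if)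
    next
      case 2
      then show ?thesis
        using True p by (auto simp: nth_block_part face_def collapse_def abs_if sgn_if split: if_splits)
    next
      case 3
      then show ?thesis
        using True p by (auto simp: nth_block_part face_def collapse_def abs_if sgn_if split: if_splits)
    next
      case 4
      then show ?thesis
        using True p by (auto simp: nth_block_part face_def collapse_def abs_if sgn_if split: if_splits)
    qed
  next
    case False
    hence "p = Suc m"
      using p by simp
    show ?thesis
    proof (cases "k < m")
      case True
      then show ?thesis
        using \<open>p = Suc m\<close> by (auto simp: nth_block_part face_def cut_def)
    next
      case False
      hence "k = m" using k by simp
      have "f x = int m + 1 \<or> f x \<le> 0 \<longleftrightarrow> cut m (f x) \<le> 0" for x
        using fm[of x] by (auto simp: cut_def)
      then show ?thesis
        using \<open>p = Suc m\<close> \<open>k = m\<close> by (auto simp: nth_block_part face_def)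
    qed
  qed
  finally show "merge_blocks p ?P ! k = block_part n m (face m p \<circ> f) ! k" .
qed

lemma block_maps_face:
  assumes f: "f \<in> block_maps n G (Suc m)" and p: "1 \<le> p" "p \<le> Suc m"
  shows "face m p \<circ> f \<in> block_maps n G m"
proof -
  have "block_map n m (face m p \<circ> f)"
  proof (rule block_map_comp)
    show "block_map n (Suc m) f"
      using f by (simp add: block_maps_def)
    show "\<bar>face m p v\<bar> \<le> int m" if "\<bar>v\<bar> \<le> int (Suc m)" for v
      using that collapse_abs_le[of p m v] by (auto simp: face_def cut_def)
    show "\<exists>v. v \<noteq> 0 \<and> \<bar>v\<bar> \<le> int (Suc m) \<and> face m p v = u" if u: "1 \<le> u" "u \<le> int m" for u
    proof (cases "p \<le> m \<and> u > int p")
      case True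
      then show ?thesis
        using u by (intro exI[of _ "u + 1"]) (auto simp: face_def collapse_def)
    next
      case False
      then show ?thesis
        using u by (intro exI[of _ u]) (auto simp: face_def collapse_def cut_def)
    qed
  qed (rule face_odd)
  moreover have "on_arrangement G (face m p \<circ> f)"
    using f by (intro on_arrangement_comp face_odd) (simp add: block_maps_def)
  ultimately show ?thesis
    by (simp add: block_maps_def)
qed

lemma block_maps_hyperoct:
  assumes f: "f \<in> block_maps n G m" and \<pi>: "\<pi> \<in> hyperoct m"
  shows "\<pi> \<circ> f \<in> block_maps n G m"
proof -
  have "block_map n m (\<pi> \<circ> f)"
  proof (rule block_map_comp)
    show "block_map n m f"
      using f by (simp add: block_maps_def)
    show "\<exists>v. v \<noteq> 0 \<and> \<bar>v\<bar> \<le> int m \<and> \<pi> v = u" if u: "1 \<le> u" "u \<le> int m" for u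
      using u hyperoct_eq_zero[OF hyperoct_inv[OF \<pi>], of u] hyperoct_abs_le[OF hyperoct_inv[OF \<pi>], of u]
        hyperoct_inv_simps[OF \<pi>] by (intro exI[of _ "inv \<pi> u"]) auto
  qed (simp_all add: hyperoct_odd[OF \<pi>] hyperoct_abs_le[OF \<pi>])
  moreover have "m = 0 \<or> on_arrangement G (\<pi> \<circ> f)"
    using f on_arrangement_comp hyperoct_odd[OF \<pi>] by (auto simp: block_maps_def)
  ultimately show ?thesis
    by (simp add: block_maps_def)
qed

text \<open>The simplicial identity behind the vanishing of the squared boundary.\<close>

lemma face_face:
  assumes "1 \<le> i" "i < j" "j \<le> Suc (Suc m)" "\<bar>v\<bar> \<le> int (Suc (Suc m))"
  shows "face m i (face (Suc m) j v) = face m (j - 1) (face (Suc m) i v)"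
proof (cases "v \<ge> 0")
  case True
  then show ?thesis
    using assms by (auto simp: face_def collapse_def cut_def of_nat_diff)
next
  case False
  then show ?thesis
    using assms by (auto simp: face_def collapse_def cut_def of_nat_diff)
qed

section \<open>The operators defined by the Eulerian idempotents\<close>

lemma lin_ext_superset:
  assumes "finite S" "Poly_Mapping.keys c \<subseteq> S"
  shows "lin_ext f c = (\<Sum>x\<in>S. cscale (Poly_Mapping.lookup c x) (f x))"
  unfolding lin_ext_def
  by (rule sum.mono_neutral_left) (use assms in \<open>auto simp: in_keys_iff\<close>)

lemma lin_ext_add: "lin_ext f (c + d) = lin_ext f c + lin_ext f d"
proof -
  let ?S = "Poly_Mapping.keys c \<union> Poly_Mapping.keys d"
  have S: "finite ?S" "Poly_Mapping.keys (c + d) \<subseteq> ?S" "Poly_Mapping.keys c \<subseteq> ?S"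
    "Poly_Mapping.keys d \<subseteq> ?S"
    using keys_add[of c d] by auto
  show ?thesis
    by (simp only: lin_ext_superset[OF S(1,2)] lin_ext_superset[OF S(1,3)]
        lin_ext_superset[OF S(1,4)] lookup_add chains.scale_left_distrib sum.distrib)
qed

lemma lin_ext_cscale: "lin_ext f (cscale a c) = cscale a (lin_ext f c)"
proof -
  have "Poly_Mapping.keys (cscale a c) \<subseteq> Poly_Mapping.keys c"
    by (auto simp: in_keys_iff lookup_cscale)
  from lin_ext_superset[OF finite_keys this] show ?thesis
    by (simp add: lin_ext_def lookup_cscale chains.scale_sum_right)
qed

lemma lin_ext_linear: "Vector_Spaces.linear cscale cscale (lin_ext f)"
  by (simp add: Vector_Spaces.linear_iff lin_ext_add lin_ext_cscale chains.vector_space_axioms)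

lemma lin_ext_0: "lin_ext f 0 = 0"
  by (simp add: lin_ext_def)

lemma lin_ext_sum: "lin_ext f (sum h A) = (\<Sum>i\<in>A. lin_ext f (h i))"
  by (induction A rule: infinite_finite_induct) (simp_all add: lin_ext_0 lin_ext_add)

lemma lin_ext_single: "lin_ext f (Poly_Mapping.single x a) = cscale a (f x)"
  by (cases "a = 0") (simp_all add: lin_ext_def)

lemma lin_ext_cong: "(\<And>x. x \<in> Poly_Mapping.keys c \<Longrightarrow> f x = g x) \<Longrightarrow> lin_ext f c = lin_ext g c"
  by (simp add: lin_ext_def)

lemma lin_ext_lin_ext: "lin_ext f (lin_ext h c) = lin_ext (\<lambda>x. lin_ext f (h x)) c"
  unfolding lin_ext_def[of h] lin_ext_def[of "\<lambda>x. lin_ext f (h x)"]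
  by (simp add: lin_ext_sum lin_ext_cscale)

lemma lin_ext_sum_fun: "lin_ext (\<lambda>x. \<Sum>i\<in>A. F i x) c = (\<Sum>i\<in>A. lin_ext (F i) c)"
  unfolding lin_ext_def by (simp add: chains.scale_sum_right sum.swap[of _ A])

lemma lin_ext_cscale_fun: "lin_ext (\<lambda>x. cscale a (f x)) c = cscale a (lin_ext f c)"
  unfolding lin_ext_def by (simp add: chains.scale_sum_right mult.commute)

lemma lin_ext_unit: "lin_ext (\<lambda>x. Poly_Mapping.single x 1) c = c"
proof (rule poly_mapping_eqI)
  fix y
  have "Poly_Mapping.lookup (lin_ext (\<lambda>x. Poly_Mapping.single x 1) c) y =
      (\<Sum>x\<in>Poly_Mapping.keys c. if x = y then Poly_Mapping.lookup c x else 0)"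
    unfolding lin_ext_def lookup_sum
    by (intro sum.cong) (auto simp: lookup_cscale lookup_single when_def)
  thus "Poly_Mapping.lookup (lin_ext (\<lambda>x. Poly_Mapping.single x 1) c) y = Poly_Mapping.lookup c y"
    by (simp add: in_keys_iff)
qed

lemma keys_cscale: "Poly_Mapping.keys (cscale a c) \<subseteq> Poly_Mapping.keys c"
  by (auto simp: in_keys_iff lookup_cscale)

lemma keys_lin_ext:
  "Poly_Mapping.keys (lin_ext f c) \<subseteq> (\<Union>x\<in>Poly_Mapping.keys c. Poly_Mapping.keys (f x))"
proof -
  have "(\<Union>x\<in>Poly_Mapping.keys c. Poly_Mapping.keys (cscale (Poly_Mapping.lookup c x) (f x))) \<subseteq>
      (\<Union>x\<in>Poly_Mapping.keys c. Poly_Mapping.keys (f x))"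
    by (intro UN_mono order_refl keys_cscale)
  with keys_sum show ?thesis
    unfolding lin_ext_def by (rule subset_trans)
qed

lemma cscale_single: "cscale a (Poly_Mapping.single x b) = Poly_Mapping.single x (a * b)"
  by (rule poly_mapping_eqI) (simp add: lookup_cscale lookup_single when_def)

lemma single_uminus: "Poly_Mapping.single x (- a) = - Poly_Mapping.single x (a :: complex)"
  by (rule poly_mapping_eqI) (simp add: lookup_single when_def)

text \<open>Fixed points are allowed: the whole sum equals its own negative, which forces 0 over the
  complex numbers.\<close>

lemma sum_involution_eq_0:
  fixes F :: "'i \<Rightarrow> ('a \<Rightarrow>\<^sub>0 complex)"
  assumes "\<And>x. x \<in> A \<Longrightarrow> \<iota> x \<in> A" "\<And>x. x \<in> A \<Longrightarrow> \<iota> (\<iota> x) = x" "\<And>x. x \<in> A \<Longrightarrow> F (\<iota> x) = - F x"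
  shows "sum F A = 0"
proof -
  have "sum F A = (\<Sum>x\<in>A. F (\<iota> x))"
    by (rule sum.reindex_bij_witness[of _ \<iota> \<iota>]) (use assms in auto)
  also have "\<dots> = - sum F A"
    using assms(3) by (simp add: sum_negf)
  finally have eq: "sum F A = - sum F A" .
  have "Poly_Mapping.lookup (sum F A) y = 0" for y
    using arg_cong[OF eq, of "\<lambda>c. Poly_Mapping.lookup c y"] by simp
  thus ?thesis
    by (intro poly_mapping_eqI) simp
qed

text \<open>The differences of coefficients form a polynomial that vanishes at infinitely many odd
  numbers.\<close>

lemma odd_values_determine_coeffs:
  fixes a b :: "nat \<Rightarrow> complex"
  assumes "\<And>k. (\<Sum>j\<le>N. of_nat (2 * k + 1) ^ j * a j) = (\<Sum>j\<le>N. of_nat (2 * k + 1) ^ j * b j)"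
    and "j \<le> N"
  shows "a j = b j"
proof -
  define p where "p = (\<Sum>i\<le>N. monom (a i - b i) i)"
  have "poly p (of_nat (2 * k + 1)) = 0" for k
    using assms(1)[of k]
    by (simp add: p_def poly_sum poly_monom left_diff_distrib sum_subtractf mult.commute)
  hence "range (\<lambda>k. of_nat (2 * k + 1)) \<subseteq> {x. poly p x = 0}"
    by auto
  moreover have "infinite (range (\<lambda>k. of_nat (2 * k + 1) :: complex))"
  proof (rule range_inj_infinite, rule injI)
    fix k l assume "(of_nat (2 * k + 1) :: complex) = of_nat (2 * l + 1)"
    hence "2 * k + 1 = 2 * l + 1"
      by (simp only: of_nat_eq_iff)
    thus "k = l" by simp
  qed
  ultimately have "p = 0"
    using poly_roots_finite[of p] infinite_super by blast
  hence "coeff p j = 0"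
    by simp
  thus ?thesis
    using assms(2) by (simp add: p_def coeff_sum)
qed

lemma odd_values_determine_chains:
  fixes a b :: "nat \<Rightarrow> ('a \<Rightarrow>\<^sub>0 complex)"
  assumes eq: "\<And>k. (\<Sum>j\<le>N. cscale (of_nat (2 * k + 1) ^ j) (a j)) =
      (\<Sum>j\<le>N. cscale (of_nat (2 * k + 1) ^ j) (b j))"
    and "j \<le> N"
  shows "a j = b j"
proof (rule poly_mapping_eqI)
  fix y
  have "(\<Sum>j\<le>N. of_nat (2 * k + 1) ^ j * Poly_Mapping.lookup (a j) y) =
      (\<Sum>j\<le>N. of_nat (2 * k + 1) ^ j * Poly_Mapping.lookup (b j) y)" for k
    using arg_cong[OF eq[of k], of "\<lambda>c. Poly_Mapping.lookup c y"]
    by (simp only: lookup_sum lookup_cscale)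
  from odd_values_determine_coeffs[OF this \<open>j \<le> N\<close>]
  show "Poly_Mapping.lookup (a j) y = Poly_Mapping.lookup (b j) y" .
qed

definition perm_act :: "nat \<Rightarrow> nat \<Rightarrow> (int \<Rightarrow> int) \<Rightarrow> chain \<Rightarrow> chain" where
  "perm_act n m \<pi> = lin_ext (\<lambda>P. Poly_Mapping.single (act_simplex n m \<pi> P) 1)"

definition eulerian_op :: "nat \<Rightarrow> nat \<Rightarrow> nat \<Rightarrow> chain \<Rightarrow> chain" where
  "eulerian_op n m j = act_chain n m (eulerian_idem m j)"

text \<open>The Adams operation with eigenvalue \<open>(2 k + 1)\<^sup>j\<close> on the image of the \<open>j\<close>-th Eulerian
  idempotent.\<close>

definition adams_op :: "nat \<Rightarrow> nat \<Rightarrow> nat \<Rightarrow> chain \<Rightarrow> chain" where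
  "adams_op n m k c =
     (\<Sum>g\<in>odd_maps m k. cscale (hyperoct_sgn m (srt m g)) (perm_act n m (srt m g) c))"

lemma eulerian_op_eq:
  "eulerian_op n m j c =
    (\<Sum>\<pi>\<in>hyperoct m. cscale (coeff (eulerian_poly m \<pi>) j * hyperoct_sgn m \<pi>) (perm_act n m \<pi> c))"
  unfolding eulerian_op_def act_chain_def eulerian_idem_def perm_act_def
  by (simp add: lin_ext_sum lin_ext_single)

lemma eulerian_op_lin_ext:
  "eulerian_op n m j = lin_ext (\<lambda>P. \<Sum>\<pi>\<in>hyperoct m.
    cscale (coeff (eulerian_poly m \<pi>) j * hyperoct_sgn m \<pi>) (Poly_Mapping.single (act_simplex n m \<pi> P) 1))"
  by (rule ext) (simp add: eulerian_op_eq perm_act_def lin_ext_sum_fun lin_ext_cscale_fun)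

lemma adams_op_lin_ext:
  "adams_op n m k = lin_ext (\<lambda>P. \<Sum>g\<in>odd_maps m k.
    cscale (hyperoct_sgn m (srt m g)) (Poly_Mapping.single (act_simplex n m (srt m g) P) 1))"
  by (rule ext) (simp add: adams_op_def perm_act_def lin_ext_sum_fun lin_ext_cscale_fun)

lemma eulerian_op_linear: "Vector_Spaces.linear cscale cscale (eulerian_op n m j)"
  unfolding eulerian_op_lin_ext by (rule lin_ext_linear)

lemma eulerian_op_eq_0: "j > m \<Longrightarrow> eulerian_op n m j c = 0"
  using le_less_trans[OF degree_eulerian_poly] by (simp add: eulerian_op_eq coeff_eq_0)

lemma eulerian_op_0: "eulerian_op n m j 0 = 0"
  unfolding eulerian_op_lin_ext by (rule lin_ext_0)

text \<open>The value of the polynomial of \<pi> counts the odd maps sorted by \<pi>, so the sum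
  over the group regroups into a sum over odd maps, according to their sorting permutations.\<close>

lemma sum_eulerian_op:
  "(\<Sum>j\<le>m. cscale (of_nat (2 * k + 1) ^ j) (eulerian_op n m j c)) = adams_op n m k c"
proof -
  let ?x = "of_nat (2 * k + 1) :: complex"
  let ?F = "\<lambda>\<pi>. cscale (hyperoct_sgn m \<pi>) (perm_act n m \<pi> c)"
  have "(\<Sum>j\<le>m. cscale (?x ^ j) (eulerian_op n m j c)) =
      (\<Sum>\<pi>\<in>hyperoct m. \<Sum>j\<le>m. cscale (coeff (eulerian_poly m \<pi>) j * ?x ^ j) (?F \<pi>))"
    unfolding eulerian_op_eq chains.scale_sum_right
    by (subst sum.swap) (simp add: mult_ac)
  also have "\<dots> = (\<Sum>\<pi>\<in>hyperoct m. cscale (poly (eulerian_poly m \<pi>) ?x) (?F \<pi>))"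
  proof (intro sum.cong refl)
    fix \<pi>
    have "poly (eulerian_poly m \<pi>) ?x = (\<Sum>j\<le>m. coeff (eulerian_poly m \<pi>) j * ?x ^ j)"
      unfolding poly_altdef using degree_eulerian_poly[of m \<pi>]
      by (intro sum.mono_neutral_left) (auto simp: coeff_eq_0)
    thus "(\<Sum>j\<le>m. cscale (coeff (eulerian_poly m \<pi>) j * ?x ^ j) (?F \<pi>)) =
        cscale (poly (eulerian_poly m \<pi>) ?x) (?F \<pi>)"
      by (simp only: chains.scale_sum_left)
  qed
  also have "\<dots> = (\<Sum>\<pi>\<in>hyperoct m. \<Sum>g | g \<in> odd_maps m k \<and> srt m g = \<pi>. ?F (srt m g))"
  proof (intro sum.cong refl)
    fix \<pi> assume \<pi>: "\<pi> \<in> hyperoct m"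
    have "(\<Sum>g | g \<in> odd_maps m k \<and> srt m g = \<pi>. ?F (srt m g)) =
        (\<Sum>g | g \<in> odd_maps m k \<and> srt m g = \<pi>. cscale 1 (?F \<pi>))"
      by (intro sum.cong) auto
    also have "\<dots> = cscale (of_nat (card {g \<in> odd_maps m k. srt m g = \<pi>})) (?F \<pi>)"
      unfolding chains.scale_sum_left[symmetric] by simp
    also have "card {g \<in> odd_maps m k. srt m g = \<pi>} = card {g \<in> odd_maps m k. sorts m g \<pi>}"
      using srt_eq_iff[OF _ \<pi>] by (intro arg_cong[of _ _ card]) auto
    finally show "cscale (poly (eulerian_poly m \<pi>) ?x) (?F \<pi>) =
        (\<Sum>g | g \<in> odd_maps m k \<and> srt m g = \<pi>. ?F (srt m g))"
      by (simp only: poly_eulerian_poly_odd[OF \<pi>])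
  qed
  also have "\<dots> = (\<Sum>g\<in>odd_maps m k. ?F (srt m g))"
    by (rule sum.group) (use finite_odd_maps finite_hyperoct srt_hyperoct in auto)
  finally show ?thesis
    by (simp add: adams_op_def)
qed

lemma chain_space_subspace: "chains.subspace (chain_space n G r)"
proof (rule chains.subspaceI)
  fix c d a assume c: "c \<in> chain_space n G r"
  show "c + d \<in> chain_space n G r" if "d \<in> chain_space n G r"
    using c that keys_add[of c d] by (auto simp: chain_space_def)
  show "cscale a c \<in> chain_space n G r"
    using c by (auto simp: chain_space_def in_keys_iff lookup_cscale)
qed (simp add: chain_space_def)

locale coloring_complex =
  fixes n :: nat and G :: signed_graph
  assumes signed_graph: "signed_graph_on n G"
begin

abbreviation chains_at :: "nat \<Rightarrow> chain set" where
  "chains_at m \<equiv> chain_space n G (int m - 1)"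

lemma keys_chains_at:
  assumes "c \<in> chains_at m" "P \<in> Poly_Mapping.keys c"
  obtains f where "f \<in> block_maps n G m" "block_map n m f" "P = block_part n m f"
  using assms simplices_eq[OF signed_graph, of m] by (auto simp: chain_space_def block_maps_def)

lemma single_chains_at:
  "f \<in> block_maps n G m \<Longrightarrow> Poly_Mapping.single (block_part n m f) a \<in> chains_at m"
  by (auto simp: chain_space_def simplices_eq[OF signed_graph])

lemma lin_ext_chains_at:
  assumes "c \<in> chains_at m" "\<And>f. f \<in> block_maps n G m \<Longrightarrow> F (block_part n m f) \<in> chain_space n G r"
  shows "lin_ext F c \<in> chain_space n G r"
proof -
  have "Poly_Mapping.keys (F P) \<subseteq> simplices n G r" if "P \<in> Poly_Mapping.keys c" for P
    using keys_chains_at[OF assms(1) that] assms(2) unfolding chain_space_def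
    by (metis mem_Collect_eq)
  with keys_lin_ext[of F c] show ?thesis
    by (auto simp: chain_space_def)
qed

lemma perm_act_chains_at:
  assumes "c \<in> chains_at m" "\<pi> \<in> hyperoct m"
  shows "perm_act n m \<pi> c \<in> chains_at m"
  unfolding perm_act_def
proof (rule lin_ext_chains_at[OF assms(1)])
  fix f assume f: "f \<in> block_maps n G m"
  hence "act_simplex n m \<pi> (block_part n m f) = block_part n m (\<pi> \<circ> f)"
    using assms(2) by (intro act_simplex_block_part) (simp_all add: block_maps_def)
  thus "Poly_Mapping.single (act_simplex n m \<pi> (block_part n m f)) 1 \<in> chains_at m"
    using single_chains_at block_maps_hyperoct[OF f assms(2)] by metis
qed

lemma perm_act_comp:
  assumes c: "c \<in> chains_at m" and \<pi>: "\<pi> \<in> hyperoct m" and \<sigma>: "\<sigma> \<in> hyperoct m"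
  shows "perm_act n m \<pi> (perm_act n m \<sigma> c) = perm_act n m (\<pi> \<circ> \<sigma>) c"
  unfolding perm_act_def lin_ext_lin_ext
proof (rule lin_ext_cong)
  fix P assume "P \<in> Poly_Mapping.keys c"
  then obtain f where f: "f \<in> block_maps n G m" "block_map n m f" "P = block_part n m f"
    by (rule keys_chains_at[OF c])
  have "block_map n m (\<sigma> \<circ> f)"
    using block_maps_hyperoct[OF f(1) \<sigma>] by (simp add: block_maps_def)
  thus "lin_ext (\<lambda>P. Poly_Mapping.single (act_simplex n m \<pi> P) 1)
      (Poly_Mapping.single (act_simplex n m \<sigma> P) 1) =
      Poly_Mapping.single (act_simplex n m (\<pi> \<circ> \<sigma>) P) 1"
    using f \<pi> \<sigma> by (simp add: lin_ext_single act_simplex_block_part hyperoct_comp comp_assoc)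
qed

lemma perm_act_id:
  assumes c: "c \<in> chains_at m" shows "perm_act n m id c = c"
proof -
  have "perm_act n m id c = lin_ext (\<lambda>P. Poly_Mapping.single P 1) c"
    unfolding perm_act_def
  proof (rule lin_ext_cong)
    fix P assume "P \<in> Poly_Mapping.keys c"
    then obtain f where f: "block_map n m f" "P = block_part n m f"
      by (rule keys_chains_at[OF c])
    have "act_simplex n m id P = P"
      using act_simplex_block_part[OF f(1) hyperoct_id] by (simp only: f(2) id_comp)
    thus "Poly_Mapping.single (act_simplex n m id P) 1 = Poly_Mapping.single P 1"
      by simp
  qed
  thus ?thesis
    by (simp add: lin_ext_unit)
qed

lemma eulerian_op_chains_at:
  assumes "c \<in> chains_at m" shows "eulerian_op n m j c \<in> chains_at m"
  unfolding eulerian_op_eq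
  by (intro chains.subspace_sum[OF chain_space_subspace] chains.subspace_scale[OF chain_space_subspace]
      perm_act_chains_at assms)

text \<open>Here \<open>2 * k + 1 = 1\<close>, so this evaluates the sum of all Eulerian
  idempotents. The only odd map is 0, which the identity sorts.\<close>

lemma adams_op_0:
  assumes c: "c \<in> chains_at m" shows "adams_op n m 0 c = c"
proof -
  have "odd_maps m 0 = {\<lambda>_. 0}"
    by (auto simp: odd_maps_def)
  moreover have "srt m (\<lambda>_. 0) = id"
    by (rule srt_eqI[OF hyperoct_id]) (simp add: sorts_def lexlt_def)
  ultimately show ?thesis
    using perm_act_id[OF c] hyperoct_sgn_id by (simp add: adams_op_def)
qed

lemma adams_op_adams_op:
  assumes c: "c \<in> chains_at m"
  shows "adams_op n m k (adams_op n m l c) = adams_op n m (l * (2 * k + 1) + k) c"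
proof -
  let ?e = "\<lambda>g. hyperoct_sgn m (srt m g)" and ?a = "\<lambda>g. perm_act n m (srt m g)"
  have "adams_op n m k (adams_op n m l c) =
      (\<Sum>g\<in>odd_maps m k. \<Sum>f\<in>odd_maps m l. cscale (?e g * ?e f) (?a g (?a f c)))"
    unfolding adams_op_def perm_act_def
    by (simp add: lin_ext_sum lin_ext_cscale chains.scale_sum_right)
  also have "\<dots> = (\<Sum>g\<in>odd_maps m k. \<Sum>f\<in>odd_maps m l.
      cscale (?e (lex_pair k (srt m g) g f)) (?a (lex_pair k (srt m g) g f) c))"
    by (intro sum.cong refl)
       (simp only: srt_comp perm_act_comp[OF c] srt_hyperoct hyperoct_sgn_comp)
  also have "\<dots> = (\<Sum>x\<in>odd_maps m k \<times> odd_maps m l.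
      (\<lambda>e. cscale (?e e) (?a e c)) ((\<lambda>(g, f). lex_pair k (srt m g) g f) x))"
    by (subst sum.cartesian_product) (simp add: case_prod_unfold)
  also have "\<dots> = adams_op n m (l * (2 * k + 1) + k) c"
    unfolding adams_op_def by (rule sum.reindex_bij_betw[OF lex_pair_bij])
  finally show ?thesis .
qed

lemma sum_eulerian_op_eq:
  assumes c: "c \<in> chains_at m" shows "(\<Sum>j\<le>m. eulerian_op n m j c) = c"
  using sum_eulerian_op[where k = 0 and m = m and n = n and c = c] adams_op_0[OF c] by simp

text \<open>Let \<open>E x\<close> be the sum of all \<open>x ^ i\<close> times the
  \<open>i\<close>-th operator. The product rule reads \<open>E x \<circ> E y = E (x * y)\<close> at
  odd arguments. Comparing coefficients in \<open>x\<close> shows that the \<open>i\<close>-th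
  operator composed with \<open>E y\<close> is \<open>y ^ i\<close> times itself; comparing those in
  \<open>y\<close> gives the claim. Indices above \<open>m\<close> give 0.\<close>

lemma eulerian_op_orthogonal:
  assumes c: "c \<in> chains_at m"
  shows "eulerian_op n m i (eulerian_op n m j c) = (if i = j then eulerian_op n m j c else 0)"
proof (cases "i \<le> m \<and> j \<le> m")
  case True
  let ?x = "\<lambda>k. of_nat (2 * k + 1) :: complex"
  have "(\<Sum>i\<le>m. cscale (?x k ^ i) (\<Sum>j\<le>m. cscale (?x l ^ j) (eulerian_op n m i (eulerian_op n m j c)))) =
      (\<Sum>i\<le>m. cscale (?x k ^ i) (cscale (?x l ^ i) (eulerian_op n m i c)))" for k l
  proof -
    have "eulerian_op n m i (\<Sum>j\<le>m. cscale (?x l ^ j) (eulerian_op n m j c)) =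
        (\<Sum>j\<le>m. cscale (?x l ^ j) (eulerian_op n m i (eulerian_op n m j c)))" for i
      by (simp only: eulerian_op_lin_ext lin_ext_sum lin_ext_cscale)
    note inner = this[unfolded sum_eulerian_op]
    have "(\<Sum>i\<le>m. cscale (?x k ^ i) (\<Sum>j\<le>m. cscale (?x l ^ j) (eulerian_op n m i (eulerian_op n m j c)))) =
        adams_op n m k (adams_op n m l c)"
      by (simp only: inner[symmetric] sum_eulerian_op)
    also have "\<dots> = (\<Sum>i\<le>m. cscale (?x (l * (2 * k + 1) + k) ^ i) (eulerian_op n m i c))"
      by (simp only: adams_op_adams_op[OF c] sum_eulerian_op)
    also have "?x (l * (2 * k + 1) + k) = ?x k * ?x l"
      by (simp add: algebra_simps)
    finally show ?thesis
      by (simp only: power_mult_distrib chains.scale_scale)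
  qed
  hence row: "(\<Sum>j\<le>m. cscale (?x l ^ j) (eulerian_op n m i (eulerian_op n m j c))) =
      cscale (?x l ^ i) (eulerian_op n m i c)" for l
    using True by (intro odd_values_determine_chains[where N = m and j = i and
      a = "\<lambda>i. \<Sum>j\<le>m. cscale (?x l ^ j) (eulerian_op n m i (eulerian_op n m j c))" and
      b = "\<lambda>i. cscale (?x l ^ i) (eulerian_op n m i c)"]) simp_all
  also have "cscale (?x l ^ i) (eulerian_op n m i c) =
      (\<Sum>j\<le>m. cscale (?x l ^ j) (if i = j then eulerian_op n m i c else 0))" for l
    using True by (simp add: if_distrib[of "cscale _"] cong: if_cong)
  finally show ?thesis
    using True odd_values_determine_chains[where N = m and j = j and
      a = "\<lambda>j. eulerian_op n m i (eulerian_op n m j c)" and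
      b = "\<lambda>j. if i = j then eulerian_op n m i c else 0"] by auto
next
  case False
  then show ?thesis
    by (auto simp: eulerian_op_eq_0 eulerian_op_0)
qed

end

section \<open>The boundary commutes with the Adams operations\<close>

definition block_simplex :: "nat \<Rightarrow> nat \<Rightarrow> (int \<Rightarrow> int) \<Rightarrow> complex \<Rightarrow> chain" where
  "block_simplex n m f = Poly_Mapping.single (block_part n m f)"

lemma boundary_map_block_simplex:
  assumes "block_map n (Suc m) f"
  shows "boundary_map (int m) (block_simplex n (Suc m) f a) =
    (\<Sum>p = 1..Suc m. block_simplex n m (face m p \<circ> f) (a * (- 1) ^ (p - 1)))"
proof -
  have "nat (int m + 1) = Suc m"
    by simp
  thus ?thesis
    unfolding boundary_map_def block_simplex_def lin_ext_single chains.scale_sum_right cscale_single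
    by (intro sum.cong) (auto simp: merge_blocks_block_part[OF assms])
qed

lemma adams_op_block_simplex:
  assumes "block_map n m f"
  shows "adams_op n m k (block_simplex n m f a) =
    (\<Sum>g\<in>odd_maps m k. block_simplex n m (srt m g \<circ> f) (a * hyperoct_sgn m (srt m g)))"
  unfolding adams_op_lin_ext block_simplex_def lin_ext_single chains.scale_sum_right cscale_single
  using assms by (intro sum.cong) (auto simp: act_simplex_block_part srt_hyperoct)

text \<open>In the boundary of an Adams operation, the merging of positions \<open>p\<close> and \<open>p + 1\<close> cancels
  unless both positions have the same value under the odd map.\<close>

lemma adams_op_inner_face:
  assumes f: "block_map n (Suc m) f" and p: "1 \<le> p" "p \<le> m"
  shows "(\<Sum>g\<in>odd_maps (Suc m) k. block_simplex n m (face m p \<circ> (srt (Suc m) g \<circ> f))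
      (hyperoct_sgn (Suc m) (srt (Suc m) g) * (- 1) ^ (p - 1))) =
    (\<Sum>g\<in>odd_maps m k. block_simplex n m (srt m g \<circ> (face m (nat \<bar>inv (srt m g) (int p)\<bar>) \<circ> f))
      (hyperoct_sgn m (srt m g) * (- 1) ^ (nat \<bar>inv (srt m g) (int p)\<bar> - 1)))"
    (is "(\<Sum>g\<in>?O. ?F g) = (\<Sum>g\<in>?O'. ?R g)")
proof -
  let ?E = "{g \<in> ?O. g (int p) = g (int p + 1)}" and ?N = "{g \<in> ?O. g (int p) \<noteq> g (int p + 1)}"
  have "?O = ?E \<union> ?N" "?E \<inter> ?N = {}" "finite ?E" "finite ?N"
    using finite_odd_maps by auto
  hence "sum ?F ?O = sum ?F ?E + sum ?F ?N"
    by (metis (no_types, lifting) sum.union_disjoint)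
  \<comment> \<open>Precomposition with \<open>coxeter_gen p\<close> exchanges two labels that the
    face merges, and it changes the sign.\<close>
  also have "sum ?F ?N = 0"
  proof (rule sum_involution_eq_0[of _ "\<lambda>g. g \<circ> coxeter_gen p"])
    fix g assume g: "g \<in> ?N"
    have s: "coxeter_gen p (int p) = int p + 1" "coxeter_gen p (int p + 1) = int p"
      using p by (auto simp: coxeter_gen_pos)
    show "g \<circ> coxeter_gen p \<in> ?N"
      using g p odd_maps_swap[of g "Suc m" k p] by (auto simp: s)
    show "g \<circ> coxeter_gen p \<circ> coxeter_gen p = g"
      by (simp add: fun_eq_iff coxeter_gen_invol)
    have srt: "srt (Suc m) (g \<circ> coxeter_gen p) = coxeter_gen p \<circ> srt (Suc m) g"
      using g p by (intro srt_swap) auto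
    have "hyperoct_sgn (Suc m) (coxeter_gen p \<circ> srt (Suc m) g) = - hyperoct_sgn (Suc m) (srt (Suc m) g)"
      using g p srt_hyperoct[of g "Suc m" k]
      by (subst hyperoct_sgn_comp) (auto simp: coxeter_gen_hyperoct hyperoct_sgn_gen)
    moreover have "collapse p (coxeter_gen p v) = collapse p v" for v
      using p by (auto simp: collapse_def coxeter_gen_pos abs_if sgn_if)
    hence "face m p \<circ> (coxeter_gen p \<circ> srt (Suc m) g \<circ> f) = face m p \<circ> (srt (Suc m) g \<circ> f)"
      using p by (simp add: face_def fun_eq_iff)
    ultimately show "?F (g \<circ> coxeter_gen p) = - ?F g"
      by (simp add: srt block_simplex_def single_uminus)
  qed
  also have "sum ?F ?E = (\<Sum>g\<in>?O'. ?F (g \<circ> collapse p))"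
    by (rule sum.reindex_bij_betw[OF collapse_bij[OF p], symmetric])
  also have "\<dots> = sum ?R ?O'"
  proof (intro sum.cong refl)
    fix g assume g: "g \<in> ?O'"
    define q where "q = nat \<bar>inv (srt m g) (int p)\<bar>"
    have \<pi>: "inv (srt m g) \<in> hyperoct m"
      by (rule hyperoct_inv[OF srt_hyperoct[OF g]])
    have q: "1 \<le> q" "q \<le> m"
      using p hyperoct_eq_zero[OF \<pi>, of "int p"] hyperoct_abs_le[OF \<pi>, of "int p"]
      by (auto simp: q_def)
    have "\<bar>f x\<bar> \<le> int (Suc m)" for x
      using f by (simp add: block_map_def)
    hence "face m p \<circ> (srt (Suc m) (g \<circ> collapse p) \<circ> f) = srt m g \<circ> (face m q \<circ> f)"
      using srt_collapse(1)[OF g p q_def] p q by (simp add: fun_eq_iff face_def)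
    \<comment> \<open>The sign of the lifted permutation converts the sign of face \<open>p\<close>
      into that of face \<open>q\<close>.\<close>
    moreover have "hyperoct_sgn (Suc m) (srt (Suc m) (g \<circ> collapse p)) * (- 1) ^ (p - 1) =
        hyperoct_sgn m (srt m g) * (- 1) ^ (q - 1)"
    proof -
      have "(- 1) ^ (p + q) * (- 1) ^ (p - 1) = ((- 1) ^ (q - 1) :: complex)"
        using p(1) q(1) by (auto simp: minus_one_power_iff)
      thus ?thesis
        using srt_collapse(2)[OF g p q_def] by (simp add: mult_ac)
    qed
    ultimately show "?F (g \<circ> collapse p) = ?R g"
      unfolding q_def by (simp only:)
  qed
  finally show ?thesis
    by (simp only: add_0_right)
qed

text \<open>Dropping the last block cancels between values \<open>a\<close> and \<open>- 1 - a\<close> of the odd map at the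
  last position, which leaves the maximal value.\<close>

lemma adams_op_last_face:
  "(\<Sum>g\<in>odd_maps (Suc m) k. block_simplex n m (face m (Suc m) \<circ> (srt (Suc m) g \<circ> f))
      (hyperoct_sgn (Suc m) (srt (Suc m) g) * a)) =
    (\<Sum>g\<in>odd_maps m k. block_simplex n m (srt m g \<circ> (face m (Suc m) \<circ> f))
      (hyperoct_sgn m (srt m g) * a))"
    (is "(\<Sum>g\<in>?O. ?F g) = (\<Sum>g\<in>?O'. ?R g)")
proof -
  let ?M = "int (Suc m)"
  let ?E = "{g \<in> ?O. g ?M = int k}" and ?N = "{g \<in> ?O. g ?M \<noteq> int k}"
  have "?O = ?E \<union> ?N" "?E \<inter> ?N = {}" "finite ?E" "finite ?N"
    using finite_odd_maps by auto
  hence "sum ?F ?O = sum ?F ?E + sum ?F ?N"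
    by (metis (no_types, lifting) sum.union_disjoint)
  \<comment> \<open>Paired maps have sorting permutations that differ by the sign of the last label,
    and the last face sends that label to 0 in either case.\<close>
  also have "sum ?F ?N = 0"
  proof (rule sum_involution_eq_0[of _ "flip_last (Suc m)"])
    fix g assume "g \<in> ?N"
    hence g: "g \<in> ?O" "g ?M \<noteq> int k"
      by auto
    note flip = flip_last_odd_maps[OF g(1) _ g(2)]
    show "flip_last (Suc m) g \<in> ?N" "flip_last (Suc m) (flip_last (Suc m) g) = g"
      using flip by auto
    have srt: "srt (Suc m) (flip_last (Suc m) g) = neg_at (Suc m) \<circ> srt (Suc m) g"
      using g(1) by (intro srt_flip_last) auto
    have "hyperoct_sgn (Suc m) (neg_at (Suc m) \<circ> srt (Suc m) g) = - hyperoct_sgn (Suc m) (srt (Suc m) g)"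
      using srt_hyperoct[OF g(1)]
      by (subst hyperoct_sgn_comp) (auto simp: neg_at_hyperoct hyperoct_sgn_neg_at)
    moreover have "cut m (neg_at (Suc m) v) = cut m v" for v
      by (auto simp: cut_def neg_at_def)
    hence "face m (Suc m) \<circ> (neg_at (Suc m) \<circ> srt (Suc m) g \<circ> f) = face m (Suc m) \<circ> (srt (Suc m) g \<circ> f)"
      by (simp add: face_def fun_eq_iff)
    ultimately show "?F (flip_last (Suc m) g) = - ?F g"
      by (simp add: srt block_simplex_def single_uminus)
  qed
  also have "sum ?F ?E = (\<Sum>g\<in>?O'. ?F (extend_max m k g))"
    by (rule sum.reindex_bij_betw[OF extend_max_bij, symmetric])
  also have "\<dots> = sum ?R ?O'"
  proof (intro sum.cong refl)
    fix g assume g: "g \<in> ?O'"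
    note \<pi> = srt_hyperoct[OF g]
    have "cut m (srt m g v) = srt m g (cut m v)" for v
      using hyperoct_abs_le[OF \<pi>, of v] hyperoct_zero[OF \<pi>] by (simp add: cut_def)
    hence "face m (Suc m) \<circ> (srt m g \<circ> f) = srt m g \<circ> (face m (Suc m) \<circ> f)"
      by (simp add: face_def fun_eq_iff)
    thus "?F (extend_max m k g) = ?R g"
      by (simp only: srt_extend_max[OF g] hyperoct_sgn_Suc[OF \<pi>])
  qed
  finally show ?thesis
    by (simp only: add_0_right)
qed

lemma boundary_adams_op_block_simplex:
  assumes f: "f \<in> block_maps n G (Suc m)"
  shows "boundary_map (int m) (adams_op n (Suc m) k (block_simplex n (Suc m) f 1)) =
    adams_op n m k (boundary_map (int m) (block_simplex n (Suc m) f 1))"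
proof -
  have bf: "block_map n (Suc m) f"
    using f by (simp add: block_maps_def)
  have bsf: "block_map n (Suc m) (srt (Suc m) g \<circ> f)" if "g \<in> odd_maps (Suc m) k" for g
    using block_maps_hyperoct[OF f srt_hyperoct[OF that]] by (simp add: block_maps_def)
  have bff: "block_map n m (face m q \<circ> f)" if "q \<in> {1..Suc m}" for q
    using block_maps_face[OF f] that by (simp add: block_maps_def)
  define R where "R g q = block_simplex n m (srt m g \<circ> (face m q \<circ> f))
    (hyperoct_sgn m (srt m g) * (- 1) ^ (q - 1))" for g q
  \<comment> \<open>Face \<open>p\<close> of a permuted simplex has become face \<open>q\<close> of
    the original one, with \<open>q\<close> the place of the label \<open>p\<close> up to sign. As
    \<open>p\<close> runs through \<open>1..m\<close>, so does \<open>q\<close>.\<close>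
  have reindex: "(\<Sum>p = 1..m. R g (nat \<bar>inv (srt m g) (int p)\<bar>)) = (\<Sum>q = 1..m. R g q)"
    if g: "g \<in> odd_maps m k" for g
  proof (rule sum.reindex_bij_witness[of _ "\<lambda>q. nat \<bar>srt m g (int q)\<bar>" "\<lambda>p. nat \<bar>inv (srt m g) (int p)\<bar>"])
    note \<pi> = srt_hyperoct[OF g]
    have range: "nat \<bar>\<sigma> (int p)\<bar> \<in> {1..m}" if "\<sigma> \<in> hyperoct m" "p \<in> {1..m}" for \<sigma> p
      using that(2) hyperoct_eq_zero[OF that(1), of "int p"] hyperoct_abs_le[OF that(1), of "int p"] by auto
    fix p assume p: "p \<in> {1..m}"
    show "nat \<bar>inv (srt m g) (int p)\<bar> \<in> {1..m}" "nat \<bar>srt m g (int p)\<bar> \<in> {1..m}"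
      using range p \<pi> hyperoct_inv[OF \<pi>] by blast+
    show "nat \<bar>srt m g (int (nat \<bar>inv (srt m g) (int p)\<bar>))\<bar> = p"
      using hyperoct_abs[OF \<pi>, of "inv (srt m g) (int p)"] by (simp add: hyperoct_inv_simps[OF \<pi>])
    show "nat \<bar>inv (srt m g) (int (nat \<bar>srt m g (int p)\<bar>))\<bar> = p"
      using hyperoct_abs[OF hyperoct_inv[OF \<pi>], of "srt m g (int p)"]
      by (simp add: hyperoct_inv_simps[OF \<pi>])
  qed simp
  have "boundary_map (int m) (adams_op n (Suc m) k (block_simplex n (Suc m) f 1)) =
      (\<Sum>g\<in>odd_maps (Suc m) k. boundary_map (int m)
        (block_simplex n (Suc m) (srt (Suc m) g \<circ> f) (hyperoct_sgn (Suc m) (srt (Suc m) g))))"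
    unfolding adams_op_block_simplex[OF bf] by (simp add: boundary_map_def lin_ext_sum)
  also have "\<dots> = (\<Sum>g\<in>odd_maps (Suc m) k. \<Sum>p = 1..Suc m.
      block_simplex n m (face m p \<circ> (srt (Suc m) g \<circ> f))
        (hyperoct_sgn (Suc m) (srt (Suc m) g) * (- 1) ^ (p - 1)))"
    by (intro sum.cong refl boundary_map_block_simplex bsf)
  also have "\<dots> = (\<Sum>p = 1..Suc m. \<Sum>g\<in>odd_maps (Suc m) k.
      block_simplex n m (face m p \<circ> (srt (Suc m) g \<circ> f))
        (hyperoct_sgn (Suc m) (srt (Suc m) g) * (- 1) ^ (p - 1)))"
    by (rule sum.swap)
  also have "\<dots> = (\<Sum>p = 1..m. \<Sum>g\<in>odd_maps m k. R g (nat \<bar>inv (srt m g) (int p)\<bar>)) +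
      (\<Sum>g\<in>odd_maps m k. R g (Suc m))"
    unfolding R_def
  proof (subst sum.nat_ivl_Suc')
    show "(\<Sum>g\<in>odd_maps (Suc m) k. block_simplex n m (face m (Suc m) \<circ> (srt (Suc m) g \<circ> f))
          (hyperoct_sgn (Suc m) (srt (Suc m) g) * (- 1) ^ (Suc m - 1))) +
        (\<Sum>p = 1..m. \<Sum>g\<in>odd_maps (Suc m) k. block_simplex n m (face m p \<circ> (srt (Suc m) g \<circ> f))
          (hyperoct_sgn (Suc m) (srt (Suc m) g) * (- 1) ^ (p - 1))) =
        (\<Sum>p = 1..m. \<Sum>g\<in>odd_maps m k.
          block_simplex n m (srt m g \<circ> (face m (nat \<bar>inv (srt m g) (int p)\<bar>) \<circ> f))
            (hyperoct_sgn m (srt m g) * (- 1) ^ (nat \<bar>inv (srt m g) (int p)\<bar> - 1))) +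
        (\<Sum>g\<in>odd_maps m k. block_simplex n m (srt m g \<circ> (face m (Suc m) \<circ> f))
          (hyperoct_sgn m (srt m g) * (- 1) ^ (Suc m - 1)))"
      unfolding adams_op_last_face
      by (subst add.commute, intro arg_cong2[of _ _ _ _ "(+)"] sum.cong[OF refl] refl
          adams_op_inner_face[OF bf]) auto
  qed simp
  also have "(\<Sum>p = 1..m. \<Sum>g\<in>odd_maps m k. R g (nat \<bar>inv (srt m g) (int p)\<bar>)) =
      (\<Sum>q = 1..m. \<Sum>g\<in>odd_maps m k. R g q)"
    by (subst (1 2) sum.swap) (intro sum.cong refl reindex)
  also have "\<dots> + (\<Sum>g\<in>odd_maps m k. R g (Suc m)) = (\<Sum>q = 1..Suc m. \<Sum>g\<in>odd_maps m k. R g q)"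
    by simp
  also have "\<dots> = (\<Sum>q = 1..Suc m. adams_op n m k (block_simplex n m (face m q \<circ> f) ((- 1) ^ (q - 1))))"
    by (intro sum.cong refl) (simp only: adams_op_block_simplex[OF bff] R_def mult.commute)
  also have "\<dots> = adams_op n m k (boundary_map (int m) (block_simplex n (Suc m) f 1))"
    unfolding boundary_map_block_simplex[OF bf] by (simp only: adams_op_lin_ext lin_ext_sum mult_1)
  finally show ?thesis .
qed

lemma boundary_boundary_block_simplex:
  assumes f: "f \<in> block_maps n G (Suc (Suc m))"
  shows "boundary_map (int m) (boundary_map (int (Suc m)) (block_simplex n (Suc (Suc m)) f 1)) = 0"
proof -
  have bf: "block_map n (Suc (Suc m)) f"
    using f by (simp add: block_maps_def)
  have bff: "block_map n (Suc m) (face (Suc m) q \<circ> f)" if "q \<in> {1..Suc (Suc m)}" for q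
    using block_maps_face[OF f] that by (simp add: block_maps_def)
  define F where "F = (\<lambda>(j, i). block_simplex n m (face m i \<circ> (face (Suc m) j \<circ> f))
    ((- 1) ^ (j - 1) * (- 1) ^ (i - 1)))"
  define A where "A = {1..Suc (Suc m)} \<times> {1..Suc m}"
  have "boundary_map (int m) (boundary_map (int (Suc m)) (block_simplex n (Suc (Suc m)) f 1)) =
      (\<Sum>j = 1..Suc (Suc m). boundary_map (int m)
        (block_simplex n (Suc m) (face (Suc m) j \<circ> f) ((- 1) ^ (j - 1))))"
    unfolding boundary_map_block_simplex[OF bf] by (simp only: boundary_map_def lin_ext_sum mult_1)
  also have "\<dots> = (\<Sum>j = 1..Suc (Suc m). \<Sum>i = 1..Suc m. F (j, i))"
    unfolding F_def prod.case by (intro sum.cong refl boundary_map_block_simplex bff)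
  also have "\<dots> = sum F A"
    unfolding A_def sum.cartesian_product by (simp only: case_prod_eta)
  also have "\<dots> = 0"
  proof (rule sum_involution_eq_0)
    \<comment> \<open>A pair \<open>(j, i)\<close> means face \<open>j\<close> followed by face
      \<open>i\<close>. The two ways to reach the same iterated face have index sums that differ by
      one, hence opposite signs.\<close>
    define \<iota> :: "nat \<times> nat \<Rightarrow> nat \<times> nat" where "\<iota> = (\<lambda>(j, i). if i < j then (i, j - 1) else (i + 1, j))"
    have anti: "F (i, j - 1) = - F (j, i)" if "1 \<le> i" "i < j" "j \<le> Suc (Suc m)" for i j
    proof -
      have "\<bar>f x\<bar> \<le> int (Suc (Suc m))" for x
        using bf by (simp add: block_map_def)
      hence "face m (j - 1) \<circ> (face (Suc m) i \<circ> f) = face m i \<circ> (face (Suc m) j \<circ> f)"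
        using face_face[OF that] by (simp add: fun_eq_iff)
      moreover have "(- 1) ^ (i - 1) * (- 1) ^ (j - 1 - 1) =
          - ((- 1) ^ (j - 1) * (- 1) ^ (i - 1) :: complex)"
        using that by (cases j) (auto simp: minus_one_power_iff)
      ultimately show ?thesis
        by (simp add: F_def block_simplex_def single_uminus)
    qed
    fix x assume "x \<in> A"
    then obtain j i where x: "x = (j, i)" and ij: "1 \<le> j" "j \<le> Suc (Suc m)" "1 \<le> i" "i \<le> Suc m"
      by (auto simp: A_def)
    show "\<iota> x \<in> A"
      using ij by (auto simp: \<iota>_def x A_def)
    show "\<iota> (\<iota> x) = x"
      using ij by (auto simp: \<iota>_def x)
    show "F (\<iota> x) = - F x"
    proof (cases "i < j")
      case True
      then show ?thesis
        using anti[of i j] ij by (simp add: \<iota>_def x)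
    next
      case False
      then show ?thesis
        using anti[of j "i + 1"] ij by (simp add: \<iota>_def x)
    qed
  qed
  finally show ?thesis .
qed

context coloring_complex
begin

lemma linear_eq_on_chains_at:
  assumes c: "c \<in> chains_at m"
    and eq: "\<And>f. f \<in> block_maps n G m \<Longrightarrow>
      lin_ext F (lin_ext F' (block_simplex n m f 1)) = lin_ext H (lin_ext H' (block_simplex n m f 1))"
  shows "lin_ext F (lin_ext F' c) = lin_ext H (lin_ext H' c)"
  unfolding lin_ext_lin_ext
proof (rule lin_ext_cong)
  fix P assume "P \<in> Poly_Mapping.keys c"
  then obtain f where f: "f \<in> block_maps n G m" "P = block_part n m f"
    by (rule keys_chains_at[OF c])
  with eq[OF f(1)] show "lin_ext F (F' P) = lin_ext H (H' P)"
    by (simp add: block_simplex_def lin_ext_single)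
qed

lemma boundary_map_chains_at:
  assumes c: "c \<in> chains_at (Suc m)"
  shows "boundary_map (int m) c \<in> chains_at m"
  unfolding boundary_map_def
proof (rule lin_ext_chains_at[OF c])
  fix f assume f: "f \<in> block_maps n G (Suc m)"
  hence bf: "block_map n (Suc m) f"
    by (simp add: block_maps_def)
  show "(\<Sum>i = 1..nat (int m + 1). Poly_Mapping.single (merge_blocks i (block_part n (Suc m) f))
      ((- 1) ^ (i - 1))) \<in> chains_at m"
    by (intro chains.subspace_sum[OF chain_space_subspace])
       (auto simp: merge_blocks_block_part[OF bf] intro!: single_chains_at block_maps_face[OF f])
qed

lemma boundary_adams_op:
  assumes c: "c \<in> chains_at (Suc m)"
  shows "boundary_map (int m) (adams_op n (Suc m) k c) = adams_op n m k (boundary_map (int m) c)"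
  unfolding boundary_map_def adams_op_lin_ext
  by (rule linear_eq_on_chains_at[OF c])
     (rule boundary_adams_op_block_simplex[unfolded boundary_map_def adams_op_lin_ext])

lemma boundary_boundary:
  assumes c: "c \<in> chains_at (Suc (Suc m))"
  shows "boundary_map (int m) (boundary_map (int (Suc m)) c) = 0"
proof -
  have "boundary_map (int m) (boundary_map (int (Suc m)) c) = lin_ext (\<lambda>_. 0) (lin_ext (\<lambda>_. 0 :: chain) c)"
    unfolding boundary_map_def
    using boundary_boundary_block_simplex[unfolded boundary_map_def]
    by (intro linear_eq_on_chains_at[OF c]) (simp add: lin_ext_def)
  thus ?thesis
    by (simp add: lin_ext_def)
qed

text \<open>The two sides belong to polynomials of degrees at most \<open>m + 1\<close> and
  \<open>m\<close>; the second is padded with the zero operator at \<open>j = m + 1\<close>. In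
  particular the boundary kills the top component.\<close>

lemma boundary_eulerian_op:
  assumes c: "c \<in> chains_at (Suc m)"
  shows "boundary_map (int m) (eulerian_op n (Suc m) j c) = eulerian_op n m j (boundary_map (int m) c)"
proof (cases "j \<le> Suc m")
  case True
  have "(\<Sum>j\<le>Suc m. cscale (of_nat (2 * k + 1) ^ j) (boundary_map (int m) (eulerian_op n (Suc m) j c))) =
      (\<Sum>j\<le>Suc m. cscale (of_nat (2 * k + 1) ^ j) (eulerian_op n m j (boundary_map (int m) c)))" for k
  proof -
    have "(\<Sum>j\<le>Suc m. cscale (of_nat (2 * k + 1) ^ j) (boundary_map (int m) (eulerian_op n (Suc m) j c))) =
        boundary_map (int m) (\<Sum>j\<le>Suc m. cscale (of_nat (2 * k + 1) ^ j) (eulerian_op n (Suc m) j c))"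
      unfolding boundary_map_def by (simp only: lin_ext_sum lin_ext_cscale)
    also have "\<dots> = adams_op n m k (boundary_map (int m) c)"
      by (simp only: sum_eulerian_op boundary_adams_op[OF c])
    also have "\<dots> = (\<Sum>j\<le>m. cscale (of_nat (2 * k + 1) ^ j) (eulerian_op n m j (boundary_map (int m) c)))"
      by (simp only: sum_eulerian_op)
    finally show ?thesis
      by (simp add: eulerian_op_eq_0)
  qed
  from odd_values_determine_chains[where N = "Suc m" and j = j, OF this True] show ?thesis .
next
  case False
  then show ?thesis
    by (simp add: eulerian_op_eq_0 boundary_map_def lin_ext_0)
qed

end

section \<open>Direct sums of complexes and homology\<close>

lemma linear_cscaleD:
  assumes "Vector_Spaces.linear cscale cscale f"
  shows "f (x + y) = f x + f y" "f (cscale a x) = cscale a (f x)" "f 0 = 0"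
    "f (sum h A) = (\<Sum>i\<in>A. f (h i))"
proof -
  have add: "f (x + y) = f x + f y" and scale: "f (cscale a x) = cscale a (f x)" for x y a
    using assms by (auto simp: Vector_Spaces.linear_iff)
  have zero: "f 0 = 0"
    using scale[of 0 0] by simp
  show "f (x + y) = f x + f y" "f (cscale a x) = cscale a (f x)" "f 0 = 0"
    by (fact add scale zero)+
  show "f (sum h A) = (\<Sum>i\<in>A. f (h i))"
    by (induction A rule: infinite_finite_induct) (simp_all add: add zero)
qed

lemma subspace_linear_image:
  assumes "Vector_Spaces.linear cscale cscale f" "chains.subspace S"
  shows "chains.subspace (f ` S)"
proof (rule chains.subspaceI)
  show "0 \<in> f ` S"
    using linear_cscaleD(3)[OF assms(1)] chains.subspace_0[OF assms(2)] by (metis imageI)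
  show "x + y \<in> f ` S" if "x \<in> f ` S" "y \<in> f ` S" for x y
    using that chains.subspace_add[OF assms(2)] by (auto simp flip: linear_cscaleD(1)[OF assms(1)])
  show "cscale a x \<in> f ` S" if "x \<in> f ` S" for a x
    using that chains.subspace_scale[OF assms(2)] by (auto simp flip: linear_cscaleD(2)[OF assms(1)])
qed

text \<open>Orthogonal projections that add up to the identity and commute with the differential
  split a complex. \<open>N r\<close> bounds the indices acting nontrivially in degree
  \<open>r\<close>, which keeps all sums finite.\<close>

lemma complex_direct_sumI:
  fixes e :: "nat \<Rightarrow> int \<Rightarrow> chain \<Rightarrow> chain" and N :: "int \<Rightarrow> nat"
  assumes C: "chain_complex C d"
    and lin: "\<And>j r. Vector_Spaces.linear cscale cscale (e j r)"
    and into: "\<And>j r c. c \<in> C r \<Longrightarrow> e j r c \<in> C r"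
    and vanish: "\<And>j r c. c \<in> C r \<Longrightarrow> N r < j \<Longrightarrow> e j r c = 0"
    and total: "\<And>r c. c \<in> C r \<Longrightarrow> (\<Sum>j\<le>N r. e j r c) = c"
    and orth: "\<And>i j r c. c \<in> C r \<Longrightarrow> e i r (e j r c) = (if i = j then e j r c else 0)"
    and comm: "\<And>j r c. c \<in> C r \<Longrightarrow> d r (e j r c) = e j (r - 1) (d r c)"
  shows "complex_direct_sum C (\<lambda>j r. e j r ` C r) d"
proof -
  have sub: "chains.subspace (C r)" and dlin: "Vector_Spaces.linear cscale cscale (d r)"
    and dC: "c \<in> C r \<Longrightarrow> d r c \<in> C (r - 1)" and dd: "c \<in> C r \<Longrightarrow> d (r - 1) (d r c) = 0" for r c
    using C by (auto simp: chain_complex_def)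
  have "chain_complex (\<lambda>r. e j r ` C r) d" for j
    unfolding chain_complex_def
    using subspace_linear_image[OF lin sub] dlin comm dC dd into linear_cscaleD(3)[OF lin] by auto
  moreover have "internal_direct_sum (C r) (\<lambda>j. e j r ` C r)" for r
  proof -
    have "\<exists>!w. (\<forall>j. w j \<in> e j r ` C r) \<and> finite {j. w j \<noteq> 0} \<and> v = (\<Sum>j | w j \<noteq> 0. w j)"
      if v: "v \<in> C r" for v
    proof (rule ex1I[of _ "\<lambda>j. e j r v"], intro conjI allI)
      have supp: "{j. e j r v \<noteq> 0} \<subseteq> {..N r}"
        using vanish[OF v] by (metis (mono_tags) atMost_iff linorder_not_le mem_Collect_eq subsetI)
      thus "finite {j. e j r v \<noteq> 0}"
        by (rule finite_subset) simp
      have "(\<Sum>j | e j r v \<noteq> 0. e j r v) = (\<Sum>j\<le>N r. e j r v)"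
        using supp by (intro sum.mono_neutral_left) auto
      thus "v = (\<Sum>j | e j r v \<noteq> 0. e j r v)"
        by (simp add: total[OF v])
      show "e j r v \<in> e j r ` C r" for j
        using v by simp
      fix w assume w: "(\<forall>j. w j \<in> e j r ` C r) \<and> finite {j. w j \<noteq> 0} \<and> v = (\<Sum>j | w j \<noteq> 0. w j)"
      \<comment> \<open>The projection of index \<open>i\<close> fixes \<open>w i\<close> and kills
        every other summand.\<close>
      show "w = (\<lambda>j. e j r v)"
      proof
        fix i
        have ew: "e i r (w j) = (if i = j then w j else 0)" for j
          using w orth by (metis imageE)
        have "e i r v = (\<Sum>j | w j \<noteq> 0. e i r (w j))"
          using w linear_cscaleD(4)[OF lin] by metis
        also have "\<dots> = (\<Sum>j | w j \<noteq> 0. if i = j then w j else 0)"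
          by (simp only: ew)
        also have "\<dots> = w i"
          using w by (simp add: sum.delta')
        finally show "w i = e i r v" ..
      qed
    qed
    thus ?thesis
      unfolding internal_direct_sum_def using sub subspace_linear_image[OF lin sub] into by auto
  qed
  ultimately show ?thesis
    using C by (simp add: complex_direct_sum_def)
qed

section \<open>Arithmetic of cosets\<close>

lemma coset_eq_iff:
  assumes "chains.subspace B"
  shows "x +o B = y +o B \<longleftrightarrow> x - y \<in> B"
proof
  assume "x +o B = y +o B"
  hence "x \<in> y +o B"
    using chains.subspace_0[OF assms] by (force simp: elt_set_plus_def)
  thus "x - y \<in> B"
    by (auto simp: elt_set_plus_def)
next
  have aux: "x +o B \<subseteq> y +o B" if "x - y \<in> B" for x y
  proof
    fix z assume "z \<in> x +o B"
    then obtain b where "b \<in> B" "z = x + b"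
      by (auto simp: elt_set_plus_def)
    hence "z = y + ((x - y) + b)" "(x - y) + b \<in> B"
      using that chains.subspace_add[OF assms] by auto
    thus "z \<in> y +o B"
      unfolding elt_set_plus_def by blast
  qed
  assume xy: "x - y \<in> B"
  moreover have "y - x \<in> B"
    using chains.subspace_neg[OF assms xy] by simp
  ultimately show "x +o B = y +o B"
    using aux by blast
qed

lemma subspace_absorb:
  assumes "chains.subspace B" "W \<subseteq> B" "0 \<in> W" shows "W + B = B"
proof
  show "W + B \<subseteq> B"
    using assms chains.subspace_add[OF assms(1)] by (auto simp: set_plus_def)
  show "B \<subseteq> W + B"
    using assms(3) by (force simp: set_plus_def)
qed

lemma coset_add:
  assumes "chains.subspace B" "W \<subseteq> B" "0 \<in> W"
  shows "(x +o W) + (y +o B) = (x + y) +o B"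
  by (simp only: set_plus_rearrange subspace_absorb[OF assms])

lemma elt_set_plus_image: "z +o B = (+) z ` B"
  by (auto simp: elt_set_plus_def)

lemma coset_scale_coset:
  assumes "chains.subspace B"
  shows "coset_scale B a (z +o B) = cscale a z +o B"
proof -
  have "cscale a ` (z +o B) = cscale a z +o (cscale a ` B)"
    by (simp add: elt_set_plus_image image_image chains.scale_right_distrib)
  moreover have "cscale a ` B \<subseteq> B" "0 \<in> cscale a ` B"
    using chains.subspace_scale[OF assms] chains.subspace_0[OF assms]
    by (auto simp: image_iff intro: bexI[of _ 0])
  ultimately show ?thesis
    unfolding coset_scale_def using coset_add[OF assms, of "cscale a ` B" "cscale a z" 0] by simp
qed

text \<open>The final summand \<open>B\<close> absorbs all the \<open>W j\<close>, and it makes a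
  coset of \<open>B\<close> out of the empty sum \<open>{0}\<close> as well.\<close>

lemma sum_cosets:
  assumes B: "chains.subspace B" and W: "\<And>j. j \<in> J \<Longrightarrow> W j \<subseteq> B" "\<And>j. j \<in> J \<Longrightarrow> 0 \<in> W j"
    and "finite J"
  shows "(\<Sum>j\<in>J. z j +o W j) + B = (\<Sum>j\<in>J. z j) +o B"
  using \<open>finite J\<close> W
proof (induction J)
  case empty
  then show ?case by simp
next
  case (insert j J)
  then show ?case
    by (simp add: add.assoc coset_add[OF B])
qed

lemma internal_direct_sum_unique:
  assumes ds: "internal_direct_sum V W" and K: "finite K"
    and a: "\<And>j. a j \<in> W j" "\<And>j. j \<notin> K \<Longrightarrow> a j = 0"
    and b: "\<And>j. b j \<in> W j" "\<And>j. j \<notin> K \<Longrightarrow> b j = 0"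
    and eq: "sum a K = sum b K"
  shows "a = b"
proof -
  have V: "chains.subspace V" "\<And>j. W j \<subseteq> V"
    using ds by (auto simp: internal_direct_sum_def)
  have supp: "finite {j. x j \<noteq> 0} \<and> sum x K = (\<Sum>j | x j \<noteq> 0. x j)"
    if x: "\<And>j. j \<notin> K \<Longrightarrow> x j = 0" for x :: "nat \<Rightarrow> chain"
  proof -
    have "{j. x j \<noteq> 0} \<subseteq> K"
      using x by auto
    thus ?thesis
      using K finite_subset by (auto intro: sum.mono_neutral_right)
  qed
  have "sum a K \<in> V"
    using V a(1) by (intro chains.subspace_sum) auto
  with ds have "\<exists>!w. (\<forall>j. w j \<in> W j) \<and> finite {j. w j \<noteq> 0} \<and> sum a K = (\<Sum>j | w j \<noteq> 0. w j)"
    by (auto simp: internal_direct_sum_def)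
  moreover have "(\<forall>j. a j \<in> W j) \<and> finite {j. a j \<noteq> 0} \<and> sum a K = (\<Sum>j | a j \<noteq> 0. a j)"
    using a(1) supp[of a, OF a(2)] by blast
  moreover have "(\<forall>j. b j \<in> W j) \<and> finite {j. b j \<noteq> 0} \<and> sum a K = (\<Sum>j | b j \<noteq> 0. b j)"
    using b(1) supp[of b, OF b(2)] eq by metis
  ultimately show ?thesis
    by blast
qed

lemma internal_direct_sum_decompose:
  assumes "internal_direct_sum V W" "v \<in> V"
  obtains w K where "\<And>j. w j \<in> W j" "finite K" "\<And>j. j \<notin> K \<Longrightarrow> w j = 0" "v = sum w K"
proof -
  obtain w where w: "\<forall>j. w j \<in> W j" "finite {j. w j \<noteq> 0}" "v = (\<Sum>j | w j \<noteq> 0. w j)"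
    using assms unfolding internal_direct_sum_def by blast
  show thesis
    by (rule that[OF _ w(2) _ w(3)]) (use w(1) in simp_all)
qed

text \<open>The differential respects components, so an element is a boundary, or a cycle, exactly
  when each component is one within its own summand. Boundaries give injectivity, cycles give
  surjectivity.\<close>

lemma complex_direct_sum_homology:
  assumes ds: "complex_direct_sum C D d"
  shows "homology_direct_sum C D d r"
proof -
  have ids: "internal_direct_sum (C s) (\<lambda>j. D j s)" and cC: "chain_complex C d"
    and cD: "chain_complex (D j) d" for j s
    using ds by (simp_all add: complex_direct_sum_def)
  have DC: "D j s \<subseteq> C s" for j s
    using ids[of s] by (simp add: internal_direct_sum_def)
  have subC: "chains.subspace (C s)" and dlin: "Vector_Spaces.linear cscale cscale (d s)" for s
    using cC by (simp_all add: chain_complex_def)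
  have subD: "chains.subspace (D j s)" and dD: "x \<in> D j s \<Longrightarrow> d s x \<in> D j (s - 1)" for j s x
    using cD[of j] by (auto simp: chain_complex_def)
  note dadd = linear_cscaleD(1)[OF dlin] and dscale = linear_cscaleD(2)[OF dlin]
    and d0 = linear_cscaleD(3)[OF dlin] and dsum = linear_cscaleD(4)[OF dlin]
  define B where "B = boundaries C d r"
  define W where "W j = boundaries (D j) d r" for j
  have subB: "chains.subspace B" and subW: "chains.subspace (W j)" for j
    unfolding B_def W_def boundaries_def by (intro subspace_linear_image[OF dlin] subC subD)+
  have WB: "W j \<subseteq> B" and W0: "0 \<in> W j" for j
    using DC chains.subspace_0[OF subW] by (auto simp: W_def B_def boundaries_def)
  have WD: "W j \<subseteq> D j r" for j
    using dD[of _ j "r + 1"] by (auto simp: W_def boundaries_def)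
  have cycC: "chains.subspace (cycles C d r)"
    using subC[of r] by (auto simp: cycles_def chains.subspace_def dadd dscale d0)
  have cycD: "chains.subspace (cycles (D j) d r)" for j
    using subD[of j r] by (auto simp: cycles_def chains.subspace_def dadd dscale d0)
  have cyc_sub: "cycles (D j) d r \<subseteq> cycles C d r" for j
    using DC by (auto simp: cycles_def)

  define rep where "rep h z \<longleftrightarrow> (\<forall>j. z j \<in> cycles (D j) d r \<and> h j = z j +o W j)" for h z
  have carrier: "h \<in> homology_sum_carrier D d r \<longleftrightarrow> (\<exists>z. rep h z) \<and> finite {j. h j \<noteq> W j}" for h
    unfolding homology_sum_carrier_def homology_def rep_def W_def image_iff mem_Collect_eq
    by (simp add: choice_iff Bex_def)
  have zero_coset: "z +o W j = W j \<longleftrightarrow> z \<in> W j" for z j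
    using coset_eq_iff[OF subW, of z j 0] by simp
  \<comment> \<open>Any finite index set containing the support may be used, since the additional
    representatives lie in \<open>W j\<close>, hence in \<open>B\<close>. This allows two families
    to be compared over a common index set.\<close>
  have map_eq: "homology_sum_map C D d r h = (\<Sum>j\<in>J. z j) +o B"
    if h: "rep h z" and J: "finite J" "{j. h j \<noteq> W j} \<subseteq> J" for h z J
  proof -
    let ?S = "{j. h j \<noteq> W j}"
    have fS: "finite ?S"
      using J finite_subset by blast
    have "homology_sum_map C D d r h = (\<Sum>j\<in>?S. z j +o W j) + B"
      unfolding homology_sum_map_def B_def[symmetric] W_def[symmetric]
      using h by (intro arg_cong2[of _ _ _ _ "(+)"] sum.cong) (auto simp: rep_def)
    also have "\<dots> = (\<Sum>j\<in>?S. z j) +o B"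
      by (rule sum_cosets[OF subB WB W0 fS])
    also have "\<dots> = (\<Sum>j\<in>J. z j) +o B"
    proof -
      have "z j \<in> B" if "j \<in> J - ?S" for j
        using that h zero_coset[of "z j" j] WB[of j] by (auto simp: rep_def)
      hence "(\<Sum>j\<in>J - ?S. z j) \<in> B"
        by (intro chains.subspace_sum[OF subB])
      moreover have "(\<Sum>j\<in>J. z j) = (\<Sum>j\<in>?S. z j) + (\<Sum>j\<in>J - ?S. z j)"
        using sum.subset_diff[OF J(2,1), of z] by (simp only: add.commute)
      ultimately show ?thesis
        using coset_eq_iff[OF subB, of "\<Sum>j\<in>J. z j" "\<Sum>j\<in>?S. z j"] by simp
    qed
    finally show ?thesis .
  qed

  have inj: "inj_on (homology_sum_map C D d r) (homology_sum_carrier D d r)"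
  proof (rule inj_onI)
    fix g h assume "g \<in> homology_sum_carrier D d r" "h \<in> homology_sum_carrier D d r"
      and eq: "homology_sum_map C D d r g = homology_sum_map C D d r h"
    then obtain y z where y: "rep g y" "finite {j. g j \<noteq> W j}" and z: "rep h z" "finite {j. h j \<noteq> W j}"
      unfolding carrier by blast
    define J where "J = {j. g j \<noteq> W j} \<union> {j. h j \<noteq> W j}"
    have J: "finite J" "{j. g j \<noteq> W j} \<subseteq> J" "{j. h j \<noteq> W j} \<subseteq> J"
      using y z by (auto simp: J_def)
    have "(\<Sum>j\<in>J. y j) +o B = (\<Sum>j\<in>J. z j) +o B"
      using eq map_eq[OF y(1) J(1,2)] map_eq[OF z(1) J(1,3)] by simp
    hence "(\<Sum>j\<in>J. y j - z j) \<in> B"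
      by (simp add: coset_eq_iff[OF subB] sum_subtractf)
    then obtain c where c: "c \<in> C (r + 1)" "(\<Sum>j\<in>J. y j - z j) = d (r + 1) c"
      by (auto simp: B_def boundaries_def)
    obtain w K where w: "\<And>j. w j \<in> D j (r + 1)" "finite K" "\<And>j. j \<notin> K \<Longrightarrow> w j = 0" "c = sum w K"
      using internal_direct_sum_decompose[OF ids c(1)] by blast
    have dw: "d (r + 1) (w j) \<in> W j" for j
      using w(1) by (auto simp: W_def boundaries_def)
    \<comment> \<open>Both sides are the components of \<open>d (r + 1) c\<close>. Outside
      \<open>J\<close> the representatives may still be nonzero boundaries, so 0 is put in their
      place.\<close>
    have decomp: "(\<lambda>j. if j \<in> J then y j - z j else 0) = (\<lambda>j. d (r + 1) (w j))"
    proof (rule internal_direct_sum_unique[OF ids[of r], of "J \<union> K"])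
      have "y j - z j \<in> D j r" for j
        using y(1) z(1) by (intro chains.subspace_diff[OF subD]) (auto simp: rep_def cycles_def)
      thus "(if j \<in> J then y j - z j else 0) \<in> D j r" for j
        using chains.subspace_0[OF subD] by simp
      show "d (r + 1) (w j) \<in> D j r" for j
        using dw WD by blast
      have "(\<Sum>j\<in>J \<union> K. if j \<in> J then y j - z j else 0) = (\<Sum>j\<in>J. y j - z j)"
        using J(1) w(2) by (intro sum.mono_neutral_cong_right) auto
      also have "\<dots> = (\<Sum>j\<in>K. d (r + 1) (w j))"
        unfolding c(2) w(4) dsum ..
      also have "\<dots> = (\<Sum>j\<in>J \<union> K. d (r + 1) (w j))"
        using J(1) w(2,3) d0 by (intro sum.mono_neutral_left) auto
      finally show "(\<Sum>j\<in>J \<union> K. if j \<in> J then y j - z j else 0) = (\<Sum>j\<in>J \<union> K. d (r + 1) (w j))" .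
    qed (use J(1) w(2,3) d0 in auto)
    have yz: "y j - z j \<in> W j" if "j \<in> J" for j
      using fun_cong[OF decomp, of j] dw[of j] that by simp
    show "g = h"
    proof
      fix j
      show "g j = h j"
      proof (cases "j \<in> J")
        case True
        then show ?thesis
          using y(1) z(1) yz[OF True] coset_eq_iff[OF subW, of "y j" j "z j"] by (simp add: rep_def)
      qed (auto simp: J_def)
    qed
  qed

  have "homology_sum_map C D d r ` homology_sum_carrier D d r = homology C d r"
  proof (intro equalityI subsetI)
    fix X assume "X \<in> homology_sum_map C D d r ` homology_sum_carrier D d r"
    then obtain h where "h \<in> homology_sum_carrier D d r" "X = homology_sum_map C D d r h"
      by blast
    then obtain z where h: "rep h z" "finite {j. h j \<noteq> W j}" "X = homology_sum_map C D d r h"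
      unfolding carrier by blast
    have "X = (\<Sum>j | h j \<noteq> W j. z j) +o B"
      using map_eq[OF h(1,2)] h(3) by simp
    moreover have "(\<Sum>j | h j \<noteq> W j. z j) \<in> cycles C d r"
      using h(1) cyc_sub by (intro chains.subspace_sum[OF cycC]) (auto simp: rep_def)
    ultimately show "X \<in> homology C d r"
      unfolding homology_def B_def by blast
  next
    fix X assume "X \<in> homology C d r"
    then obtain z where z: "z \<in> C r" "d r z = 0" "X = z +o B"
      by (auto simp: homology_def cycles_def B_def)
    obtain w K where w: "\<And>j. w j \<in> D j r" "finite K" "\<And>j. j \<notin> K \<Longrightarrow> w j = 0" "z = sum w K"
      using internal_direct_sum_decompose[OF ids z(1)] by blast
    \<comment> \<open>These are the components of \<open>d r z\<close>, which is 0.\<close>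
    have "(\<lambda>j. d r (w j)) = (\<lambda>_. 0)"
    proof (rule internal_direct_sum_unique[OF ids[of "r - 1"] w(2)])
      show "(\<Sum>j\<in>K. d r (w j)) = (\<Sum>j\<in>K. 0)"
        using z(2) by (simp add: w(4) dsum)
    qed (use w dD d0 chains.subspace_0[OF subD] in auto)
    hence "w j \<in> cycles (D j) d r" for j
      using w(1) by (auto simp: cycles_def fun_eq_iff)
    hence rep: "rep (\<lambda>j. w j +o W j) w"
      by (simp add: rep_def)
    have supp: "{j. w j +o W j \<noteq> W j} \<subseteq> K"
      using w(3) zero_coset W0 by (metis (mono_tags, lifting) mem_Collect_eq subsetI)
    have "(\<lambda>j. w j +o W j) \<in> homology_sum_carrier D d r"
      unfolding carrier using rep finite_subset[OF supp w(2)] by blast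
    moreover have "homology_sum_map C D d r (\<lambda>j. w j +o W j) = X"
      using map_eq[OF rep w(2) supp] z(3) w(4) by simp
    ultimately show "X \<in> homology_sum_map C D d r ` homology_sum_carrier D d r"
      by blast
  qed
  with inj have bij: "bij_betw (homology_sum_map C D d r) (homology_sum_carrier D d r) (homology C d r)"
    by (simp add: bij_betw_def)

  have add: "homology_sum_map C D d r (\<lambda>j. g j + h j) =
      homology_sum_map C D d r g + homology_sum_map C D d r h"
    if gh: "g \<in> homology_sum_carrier D d r" "h \<in> homology_sum_carrier D d r" for g h
  proof -
    from gh obtain y z where y: "rep g y" "finite {j. g j \<noteq> W j}" and z: "rep h z" "finite {j. h j \<noteq> W j}"
      unfolding carrier by blast
    define J where "J = {j. g j \<noteq> W j} \<union> {j. h j \<noteq> W j}"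
    have J: "finite J" "{j. g j \<noteq> W j} \<subseteq> J" "{j. h j \<noteq> W j} \<subseteq> J"
      using y z by (auto simp: J_def)
    have rep: "rep (\<lambda>j. g j + h j) (\<lambda>j. y j + z j)"
      using y(1) z(1) chains.subspace_add[OF cycD] coset_add[OF subW subset_refl W0] by (simp add: rep_def)
    have "{j. g j + h j \<noteq> W j} \<subseteq> J"
      using subspace_absorb[OF subW subset_refl W0] by (auto simp: J_def)
    from map_eq[OF rep J(1) this] show ?thesis
      unfolding map_eq[OF y(1) J(1,2)] map_eq[OF z(1) J(1,3)]
      using coset_add[OF subB subset_refl chains.subspace_0[OF subB]] by (simp add: sum.distrib)
  qed

  have scale: "homology_sum_map C D d r (\<lambda>j. coset_scale (boundaries (D j) d r) a (h j)) =
      coset_scale (boundaries C d r) a (homology_sum_map C D d r h)"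
    if h: "h \<in> homology_sum_carrier D d r" for a h
  proof -
    from h obtain z where z: "rep h z" "finite {j. h j \<noteq> W j}"
      unfolding carrier by blast
    have rep: "rep (\<lambda>j. coset_scale (W j) a (h j)) (\<lambda>j. cscale a (z j))"
      using z(1) chains.subspace_scale[OF cycD] coset_scale_coset[OF subW] by (simp add: rep_def)
    have "coset_scale (W j) a (W j) = W j" for j
      using coset_scale_coset[OF subW, of j a 0] by simp
    hence "{j. coset_scale (W j) a (h j) \<noteq> W j} \<subseteq> {j. h j \<noteq> W j}"
      by auto
    from map_eq[OF rep z(2) this] show ?thesis
      unfolding map_eq[OF z subset_refl] W_def[symmetric] B_def[symmetric] coset_scale_coset[OF subB]
      by (simp add: chains.scale_sum_right)
  qed
  show ?thesis
    unfolding homology_direct_sum_def using bij add scale by blast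
qed

section \<open>The decomposition of the coloring complex\<close>

lemma boundary_map_neg: "r < 0 \<Longrightarrow> boundary_map r c = 0"
  by (simp add: boundary_map_def lin_ext_def)

lemma chain_space_low:
  assumes "r < - 1" shows "chain_space n G r = {0}"
  using assms by (auto simp: chain_space_def simplices_def)

context coloring_complex
begin

lemma chain_complex_chain_space: "chain_complex (chain_space n G) boundary_map"
  unfolding chain_complex_def
proof (intro allI conjI)
  fix r
  show "chains.subspace (chain_space n G r)"
    by (rule chain_space_subspace)
  show "Vector_Spaces.linear cscale cscale (boundary_map r)"
    unfolding boundary_map_def by (rule lin_ext_linear)
  show "boundary_map r ` chain_space n G r \<subseteq> chain_space n G (r - 1)"
  proof (cases "r < 0")
    case True
    then show ?thesis
      using chains.subspace_0[OF chain_space_subspace] by (auto simp: boundary_map_neg)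
  next
    case False
    then show ?thesis
      using boundary_map_chains_at[of _ "nat r"] by auto
  qed
  show "\<forall>c\<in>chain_space n G r. boundary_map (r - 1) (boundary_map r c) = 0"
  \<comment> \<open>For \<open>r < 1\<close> the outer map has negative degree and is an empty
    sum.\<close>
  proof (cases "r < 1")
    case True
    then show ?thesis
      by (simp add: boundary_map_neg)
  next
    case False
    define l where "l = nat (r - 1)"
    have "r = int (Suc l)"
      using False by (simp add: l_def)
    then show ?thesis
      using boundary_boundary[of _ l] by simp
  qed
qed

lemma complex_direct_sum_eulerian:
  "complex_direct_sum (chain_space n G) (eulerian_space n G) boundary_map"
proof -
  have "complex_direct_sum (chain_space n G)
      (\<lambda>j r. eulerian_op n (nat (r + 1)) j ` chain_space n G r) boundary_map"
  proof (rule complex_direct_sumI[OF chain_complex_chain_space, where N = "\<lambda>r. nat (r + 1)"])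
    fix i j r c assume c: "c \<in> chain_space n G r"
    \<comment> \<open>\<open>nat (r + 1)\<close> is 0 for every \<open>r \<le> - 1\<close>, so
      degrees below -1 are not of the form \<open>int m - 1\<close> with
      \<open>m = nat (r + 1)\<close>; they are settled by the vanishing of their chain
      spaces.\<close>
    have low: "c = 0" if "r < - 1"
      using c chain_space_low[OF that] by simp
    define m where "m = nat (r + 1)"
    have cm: "c \<in> chains_at m" if "r \<ge> - 1"
      using c that by (simp add: m_def)
    show "eulerian_op n (nat (r + 1)) j c \<in> chain_space n G r"
    proof (cases "r < - 1")
      case False
      then show ?thesis
        using eulerian_op_chains_at[OF cm] by (simp add: m_def)
    qed (use c low eulerian_op_0 in simp)
    show "(\<Sum>j\<le>nat (r + 1). eulerian_op n (nat (r + 1)) j c) = c"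
    proof (cases "r < - 1")
      case False
      then show ?thesis
        using sum_eulerian_op_eq[OF cm] by (simp add: m_def)
    qed (simp add: low eulerian_op_0)
    show "eulerian_op n (nat (r + 1)) i (eulerian_op n (nat (r + 1)) j c) =
        (if i = j then eulerian_op n (nat (r + 1)) j c else 0)"
    proof (cases "r < - 1")
      case False
      then show ?thesis
        using eulerian_op_orthogonal[OF cm] by (simp add: m_def)
    qed (simp add: low eulerian_op_0)
    show "boundary_map r (eulerian_op n (nat (r + 1)) j c) =
        eulerian_op n (nat (r - 1 + 1)) j (boundary_map r c)"
    proof (cases "r < 0")
      case True
      then show ?thesis
        by (simp add: boundary_map_neg eulerian_op_0)
    next
      case False
      define l where "l = nat r"
      have "r = int l" "nat (r + 1) = Suc l" "nat (r - 1 + 1) = l"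
        using False by (auto simp: l_def)
      then show ?thesis
        using boundary_eulerian_op[of c l j] c by simp
    qed
  qed (simp_all add: eulerian_op_linear eulerian_op_eq_0)
  moreover have "eulerian_space n G = (\<lambda>j r. eulerian_op n (nat (r + 1)) j ` chain_space n G r)"
    by (simp add: fun_eq_iff eulerian_space_def eulerian_op_def)
  ultimately show ?thesis
    by simp
qed

end

theorem theorem4p2:
  fixes n :: nat and G :: signed_graph
  assumes "signed_graph_on n G"
  shows "complex_direct_sum (chain_space n G) (eulerian_space n G) boundary_map \<and>
         (\<forall>r. homology_direct_sum (chain_space n G) (eulerian_space n G) boundary_map r)"
proof -
  interpret coloring_complex n G
    by unfold_locales (rule assms)
  show ?thesis
    using complex_direct_sum_eulerian complex_direct_sum_homology by blast
qed

end
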